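(* Let $K$ be a unital commutative $\mathbb Q$-algebra. For any non-empty set $W\subseteq \mathbb N^+$, the $5$-tuple $$\Omega_{\mathbb T}^W:=(\tilde f(t),\tilde g(t),\tilde d(t),\tilde h(t),\tilde m(t))\in \mathcal H_{GL}^W[[t]]^{\times 5}$$ defined by $$\tilde f(t)=\sum_{T\in\bar{\mathbb S}^W}(-1)^{o(T)+|T|}t^{|T|}\mathcal V_T,\qquad \tilde g(t)=\sum_{T\in\bar{\mathbb T}^W}t^{|T|}\mathcal V_T,\qquad \tilde d(t)=\sum_{T\in\bar{\mathbb P}^W}t^{|T|}\theta_T\mathcal V_T,$$ $$\tilde h(t)=\sum_{T\in\bar{\mathbb H}^W}t^{|T|-1}\beta_T\mathcal V_T,\qquad \tilde m(t)=\sum_{T\in\bar{\mathbb P}^W}t^{|T|-1}\gamma_T\mathcal V_T$$ is a noncommutative symmetric (NCS) system over the Grossman-Larson Hopf algebra $\mathcal H_{GL}^W$.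
   Context: **NCS systems.** Let $A$ be a unital associative (not necessarily commutative) $K$-algebra and $t$ a formal parameter commuting with $A$. A $5$-tuple $(f(t),g(t),d(t),h(t),m(t))\in A[[t]]^{\times 5}$ is an NCS system over $A$ if: $f(0)=1$; $f(-t)g(t)=g(t)f(-t)=1$; $e^{d(t)}=g(t)$; $\frac{dg(t)}{dt}=g(t)h(t)$; $\frac{dg(t)}{dt}=m(t)g(t)$. **Trees.** All rooted trees are finite, considered up to isomorphism (preserving root and labels). $\mathbb T^W$ is the set of rooted trees with every vertex labeled by an element of $W$ (its weight); $\mathbb F^W$ is the set of finite disjoint unions of such trees (forests, including the empty one). $B_+(T_1,\dots,T_m)$ is the rooted tree obtained by joining the roots of $T_1,\dots,T_m$ to a new root labeled $0$; $B_+(\emptyset)=\circ$ is the single vertex labeled $0$. $\bar{\mathbb T}^W:=\{B_+(F): F\in\mathbb F^W\}$. For $T\in\bar{\mathbb T}^W$: $|T|$ is the sum of the labels of the vertices (root counted $0$), $o(T)$ is the number of children of the root, $v(T)$ the number of vertices, $\alpha(T)$ the number of (root- and label-preserving) automorphisms, $\mathcal V_T:=T/\alpha(T)$. $\bar{\mathbb S}^W$ is the set of $T\in\bar{\mathbb T}^W$ of height at most $1$ (all non-root vertices are children of the root; $\circ$ is included). $\bar{\mathbb H}^W$ is the set of chains $T\in\bar{\mathbb T}^W$, $T\ne\circ$ (trees with a single leaf). $\bar{\mathbb P}^W$ is the set of primitive $T\in\bar{\mathbb T}^W$, i.e. those whose root has exactly one child. For $T\in\bar{\mathbb H}^W$,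 $\beta_T$ is the label of the unique leaf; for $T\in\bar{\mathbb P}^W$, $\gamma_T$ is the label of the unique child of the root. **Grossman-Larson Hopf algebra.** $\mathcal H_{GL}^W$ is the free $K$-module with basis $\bar{\mathbb T}^W$. For $T=B_+(T_1,\dots,T_m)$ and $S$ in $\bar{\mathbb T}^W$, the product $T\cdot S$ is the sum of the $v(S)^m$ rooted trees obtained by joining the root of each $T_i$ by an edge to some vertex of $S$, in all possible ways; the unit is $\circ=1$. The coproduct is $\Delta(T)=\sum_{I\sqcup J=\{1,\dots,m\}}B_+(T_I)\otimes B_+(T_J)$, where $B_+(T_I)$ is $B_+$ applied to the $T_i$, $i\in I$; the counit sends $\circ$ to $1$ and all other trees to $0$. **Constants $\theta_T$.** For an unlabeled rooted tree $T$ and an edge $e$, cutting $e$ splits $T$ into $R_e(T)$ (containing the root) and a tree $P_e(T)$. For distinct edges write $e\succ e'$ if $e'$ is an edge of $R_e(T)$; $e_1\succ\dots\succ e_{m-1}$ means $e_i\succ e_j$ for all $i<j$. For such a sequence set $S_0=T$, $T_{\vec e,i}=B_+(P_{e_i}(S_{i-1}))$, $S_i=R_{e_i}(S_{i-1})$ for $1\le i\le m-1$, and $T_{\vec e,m}=S_{m-1}$ ($B_+$ here adds an unlabeled new root). Define $\theta_T\in\mathbb Q$ by: $\theta_T=0$ if $T$ is the single vertex or if the root of $T$ has more than one child; $\theta_{B_+(\circ)}=1$ (the two-vertex tree); and if the root of $T$ has exactly one child and $v(T)\ge 3$, $$\theta_T=1-\sum_{m\ge2}\frac1{m!}\sum_{\substack{(e_1,\dots,e_{m-1})\in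 E(T)^{m-1}\\ e_1\succ\cdots\succ e_{m-1}}}\theta_{T_{\vec e,1}}\cdots\theta_{T_{\vec e,m}}.$$ For labeled $T$, $\theta_T$ is that of the underlying unlabeled rooted tree. *)

theory Defs
  imports
    Complex_Main
    "HOL-Algebra.Module"
    "HOL-Library.Multiset"
    "HOL-Library.Sublist"
    "HOL-Combinatorics.Permutations"
begin

definition rat_ring :: "rat ring" where
  "rat_ring = \<lparr>carrier = UNIV, monoid.mult = (*), one = 1, zero = 0, add = (+)\<rparr>"

text \<open>The library locale \<^locale>\<open>algebra\<close> is for commutative algebras, so \<open>algebra rat_ring K\<close>
  says that \<open>K\<close> is a unital commutative \<open>\<rat>\<close>-algebra.\<close>

definition rat_scalar :: "(rat, 'k, 'm) module_scheme \<Rightarrow> rat \<Rightarrow> 'k" where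
  "rat_scalar K q = q \<odot>\<^bsub>K\<^esub> \<one>\<^bsub>K\<^esub>"

locale assoc_algebra = module R M + ring M for R (structure) and M (structure) +
  assumes smult_mult_left:
      "\<lbrakk>a \<in> carrier R; x \<in> carrier M; y \<in> carrier M\<rbrakk> \<Longrightarrow>
       (a \<odot>\<^bsub>M\<^esub> x) \<otimes>\<^bsub>M\<^esub> y = a \<odot>\<^bsub>M\<^esub> (x \<otimes>\<^bsub>M\<^esub> y)"
    and smult_mult_right:
      "\<lbrakk>a \<in> carrier R; x \<in> carrier M; y \<in> carrier M\<rbrakk> \<Longrightarrow>
       x \<otimes>\<^bsub>M\<^esub> (a \<odot>\<^bsub>M\<^esub> y) = a \<odot>\<^bsub>M\<^esub> (x \<otimes>\<^bsub>M\<^esub> y)"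

text \<open>An element of \<open>A[[t]]\<close> is its sequence of coefficients.\<close>

definition ps_ring :: "('a, 'm) ring_scheme \<Rightarrow> (nat \<Rightarrow> 'a) ring" where
  "ps_ring A =
     \<lparr>carrier = UNIV \<rightarrow> carrier A,
      monoid.mult = (\<lambda>f g n. \<Oplus>\<^bsub>A\<^esub>i\<in>{..n}. f i \<otimes>\<^bsub>A\<^esub> g (n - i)),
      one = (\<lambda>n. if n = 0 then \<one>\<^bsub>A\<^esub> else \<zero>\<^bsub>A\<^esub>),
      zero = (\<lambda>n. \<zero>\<^bsub>A\<^esub>),
      add = (\<lambda>f g n. f n \<oplus>\<^bsub>A\<^esub> g n)\<rparr>"

definition ps_deriv :: "('a, 'm) ring_scheme \<Rightarrow> (nat \<Rightarrow> 'a) \<Rightarrow> nat \<Rightarrow> 'a" where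
  "ps_deriv A f = (\<lambda>n. [Suc n] \<cdot>\<^bsub>A\<^esub> f (Suc n))"

definition ps_neg_arg :: "('a, 'm) ring_scheme \<Rightarrow> (nat \<Rightarrow> 'a) \<Rightarrow> nat \<Rightarrow> 'a" where
  "ps_neg_arg A f = (\<lambda>n. if even n then f n else \<ominus>\<^bsub>A\<^esub> f n)"  \<comment> \<open>\<open>f(-t)\<close>\<close>

text \<open>The exponential of a series \<open>d\<close> with \<open>d 0 = \<zero>\<close>: then \<open>d\<^sup>k\<close> has no terms of degree
  below \<open>k\<close>, so only \<open>k \<le> n\<close> contribute to the coefficient of \<open>t\<^sup>n\<close>.\<close>

definition ps_exp ::
  "(rat, 'k, 'm) module_scheme \<Rightarrow> ('k, 'a, 'n) module_scheme \<Rightarrow> (nat \<Rightarrow> 'a) \<Rightarrow> nat \<Rightarrow> 'a" where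
  "ps_exp K A d =
     (\<lambda>n. \<Oplus>\<^bsub>A\<^esub>k\<in>{..n}. rat_scalar K (1 / fact k) \<odot>\<^bsub>A\<^esub> (d [^]\<^bsub>ps_ring A\<^esub> k) n)"

text \<open>The condition \<open>d 0 = \<zero>\<close> is what makes \<open>e\<^bsup>d(t)\<^esup>\<close> meaningful in \<open>A[[t]]\<close>.\<close>

definition ncs_system ::
  "(rat, 'k, 'm) module_scheme \<Rightarrow> ('k, 'a, 'n) module_scheme \<Rightarrow>
   (nat \<Rightarrow> 'a) \<Rightarrow> (nat \<Rightarrow> 'a) \<Rightarrow> (nat \<Rightarrow> 'a) \<Rightarrow> (nat \<Rightarrow> 'a) \<Rightarrow> (nat \<Rightarrow> 'a) \<Rightarrow> bool" where
  "ncs_system K A f g d h m \<longleftrightarrow>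
     algebra rat_ring K \<and> assoc_algebra K A \<and>
     {f, g, d, h, m} \<subseteq> carrier (ps_ring A) \<and>
     f 0 = \<one>\<^bsub>A\<^esub> \<and>
     ps_neg_arg A f \<otimes>\<^bsub>ps_ring A\<^esub> g = \<one>\<^bsub>ps_ring A\<^esub> \<and>
     g \<otimes>\<^bsub>ps_ring A\<^esub> ps_neg_arg A f = \<one>\<^bsub>ps_ring A\<^esub> \<and>
     d 0 = \<zero>\<^bsub>A\<^esub> \<and> ps_exp K A d = g \<and>
     ps_deriv A g = g \<otimes>\<^bsub>ps_ring A\<^esub> h \<and>
     ps_deriv A g = m \<otimes>\<^bsub>ps_ring A\<^esub> g"

text \<open>Nesting through multisets makes the elements of this type exactly the isomorphism classes
  of finite labeled rooted trees; a forest is a multiset of trees.\<close>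

datatype (labels: 'a) tree = Node (root_label: 'a) (branches: "'a tree multiset")

text \<open>Planar trees are concrete representatives. Their vertices are the paths from the root,
  given by the numbers of the branches taken.\<close>

datatype 'a ptree = PNode (proot_label: 'a) (pbranches: "'a ptree list")

primrec iso_class :: "'a ptree \<Rightarrow> 'a tree" where
  "iso_class (PNode a ts) = Node a (mset (map iso_class ts))"

definition planar :: "'a tree \<Rightarrow> 'a ptree" where
  "planar T = (SOME t. iso_class t = T)"

lemma iso_class_planar [simp]: "iso_class (planar T) = T"
proof -
  have "\<exists>t. iso_class t = T"
  proof (induction T)
    case (Node a F)
    then obtain r where r: "\<And>T. T \<in># F \<Longrightarrow> iso_class (r T) = T"
      by metis
    obtain Ts where Ts: "mset Ts = F"
      using ex_mset by blast
    have "map (iso_class \<circ> r) Ts = Ts"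
      by (rule map_idI) (use r Ts in auto)
    then have "iso_class (PNode a (map r Ts)) = Node a F"
      using Ts by (metis iso_class.simps map_map)
    then show ?case ..
  qed
  then show ?thesis
    unfolding planar_def by (rule someI_ex)
qed

lemma size_nth_ptree [termination_simp]:
  "i < length ts \<Longrightarrow> size (ts ! i) < Suc (size_list size ts)"
  by (metis le_imp_less_Suc nth_mem order_refl size_list_estimation')

fun verts :: "'a ptree \<Rightarrow> nat list set" where
  "verts (PNode a ts) = insert [] (\<Union>i\<in>{..<length ts}. (#) i ` verts (ts ! i))"

fun vert_label :: "'a ptree \<Rightarrow> nat list \<Rightarrow> 'a" where
  "vert_label t [] = proot_label t"
| "vert_label t (i # v) = vert_label (pbranches t ! i) v"

text \<open>The parent of a vertex \<open>v \<noteq> []\<close> is \<open>butlast v\<close>.\<close>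

definition automorphisms :: "'a ptree \<Rightarrow> (nat list \<Rightarrow> nat list) set" where
  "automorphisms t =
     {\<phi>. \<phi> permutes verts t \<and> \<phi> [] = [] \<and>
         (\<forall>v\<in>verts t - {[]}. \<phi> (butlast v) = butlast (\<phi> v)) \<and>
         (\<forall>v\<in>verts t. vert_label t (\<phi> v) = vert_label t v)}"

definition num_auts :: "'a tree \<Rightarrow> nat" where  \<comment> \<open>\<open>\<alpha>(T)\<close>\<close>
  "num_auts T = card (automorphisms (planar T))"

primrec weight :: "nat tree \<Rightarrow> nat" where
  "weight (Node a F) = a + (\<Sum>\<^sub># (image_mset weight F))"

primrec leaves :: "'a tree \<Rightarrow> 'a multiset" where
  "leaves (Node a F) = (if F = {#} then {#a#} else \<Sum>\<^sub># (image_mset leaves F))"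

abbreviation single_vertex :: "nat tree" where
  "single_vertex \<equiv> Node 0 {#}"

definition bar_T :: "nat set \<Rightarrow> nat tree set" where
  "bar_T W = {Node 0 F | F. \<forall>T\<in>#F. labels T \<subseteq> W}"

definition bar_S :: "nat set \<Rightarrow> nat tree set" where
  "bar_S W = {T \<in> bar_T W. \<forall>C\<in>#branches T. branches C = {#}}"

definition bar_H :: "nat set \<Rightarrow> nat tree set" where
  "bar_H W = {T \<in> bar_T W. T \<noteq> single_vertex \<and> size (leaves T) = 1}"

definition bar_P :: "nat set \<Rightarrow> nat tree set" where
  "bar_P W = {T \<in> bar_T W. size (branches T) = 1}"

definition leaf_label :: "nat tree \<Rightarrow> nat" where  \<comment> \<open>\<open>\<beta>\<^sub>T\<close>\<close>
  "leaf_label T = (THE b. leaves T = {#b#})"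

definition child_label :: "nat tree \<Rightarrow> nat" where  \<comment> \<open>\<open>\<gamma>\<^sub>T\<close>\<close>
  "child_label T = (THE c. \<exists>C. branches T = {#C#} \<and> c = root_label C)"

text \<open>\<open>graft s F\<close> attaches the planar trees \<open>F v\<close> as additional branches at each vertex \<open>v\<close>.\<close>

fun graft :: "'a ptree \<Rightarrow> (nat list \<Rightarrow> 'a ptree list) \<Rightarrow> 'a ptree" where
  "graft (PNode a ts) F =
     PNode a (map (\<lambda>i. graft (ts ! i) (\<lambda>v. F (i # v))) [0..<length ts] @ F [])"

text \<open>The \<open>v(S)\<^sup>m\<close> terms, with multiplicity, of the product of basis elements
  \<open>T = B\<^sub>+(T\<^sub>1, \<dots>, T\<^sub>m)\<close> and \<open>S\<close>: one for each map \<open>\<phi>\<close> from the branches of \<open>T\<close> to the vertices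
  of \<open>S\<close>.\<close>

definition gl_terms :: "'a tree \<Rightarrow> 'a tree \<Rightarrow> 'a tree multiset" where
  "gl_terms T S =
     (let ts = pbranches (planar T); m = length ts; s = planar S in
      image_mset
        (\<lambda>\<phi>. iso_class (graft s (\<lambda>v. map (\<lambda>i. ts ! i) (filter (\<lambda>i. \<phi> i = v) [0..<m]))))
        (mset_set ({..<m} \<rightarrow>\<^sub>E verts s)))"

text \<open>Elements of the free module are the finitely supported functions from \<open>bar_T W\<close> to \<open>K\<close>,
  extended by zero to all trees.\<close>

definition gl_algebra ::
  "('k, 'm) ring_scheme \<Rightarrow> nat set \<Rightarrow> ('k, nat tree \<Rightarrow> 'k) module" where
  "gl_algebra K W =
     \<lparr>carrier = {x. range x \<subseteq> carrier K \<and> finite {T. x T \<noteq> \<zero>\<^bsub>K\<^esub>} \<and> (\<forall>T. T \<notin> bar_T W \<longrightarrow> x T = \<zero>\<^bsub>K\<^esub>)},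
      monoid.mult = (\<lambda>x y U. \<Oplus>\<^bsub>K\<^esub>T\<in>{T. x T \<noteq> \<zero>\<^bsub>K\<^esub>}. \<Oplus>\<^bsub>K\<^esub>S\<in>{S. y S \<noteq> \<zero>\<^bsub>K\<^esub>}.
                [count (gl_terms T S) U] \<cdot>\<^bsub>K\<^esub> (x T \<otimes>\<^bsub>K\<^esub> y S)),
      one = (\<lambda>U. if U = single_vertex then \<one>\<^bsub>K\<^esub> else \<zero>\<^bsub>K\<^esub>),
      zero = (\<lambda>U. \<zero>\<^bsub>K\<^esub>),
      add = (\<lambda>x y U. x U \<oplus>\<^bsub>K\<^esub> y U),
      smult = (\<lambda>c x U. c \<otimes>\<^bsub>K\<^esub> x U)\<rparr>"

definition gl_basis :: "('k, 'm) ring_scheme \<Rightarrow> nat tree \<Rightarrow> nat tree \<Rightarrow> 'k" where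
  "gl_basis K T = (\<lambda>U. if U = T then \<one>\<^bsub>K\<^esub> else \<zero>\<^bsub>K\<^esub>)"

text \<open>Here an unlabeled rooted tree is given by its vertex set, a finite prefix-closed set of
  paths containing \<open>[]\<close>; child numbers need not be consecutive, so that a subtree containing the
  root keeps its vertices. An edge is identified with its end point farther from the root.\<close>

definition rooted_tree_set :: "nat list set \<Rightarrow> bool" where
  "rooted_tree_set V \<longleftrightarrow> finite V \<and> [] \<in> V \<and> (\<forall>v\<in>V. \<forall>u. prefix u v \<longrightarrow> u \<in> V)"

definition edges :: "nat list set \<Rightarrow> nat list set" where
  "edges V = V - {[]}"

definition cut_root :: "nat list \<Rightarrow> nat list set \<Rightarrow> nat list set" where  \<comment> \<open>\<open>R\<^sub>e(T)\<close>\<close>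
  "cut_root e V = {v \<in> V. \<not> prefix e v}"

definition cut_branch :: "nat list \<Rightarrow> nat list set \<Rightarrow> nat list set" where
  \<comment> \<open>\<open>P\<^sub>e(T)\<close>, with paths starting at its own root\<close>
  "cut_branch e V = {v. e @ v \<in> V}"

definition add_root :: "nat list set \<Rightarrow> nat list set" where  \<comment> \<open>\<open>B\<^sub>+\<close> of a single tree\<close>
  "add_root V = insert [] ((#) 0 ` V)"

definition edge_chain :: "nat list set \<Rightarrow> nat list list \<Rightarrow> bool" where
  \<comment> \<open>\<open>e\<^sub>1 \<succ> \<dots> \<succ> e\<^sub>m\<^sub>-\<^sub>1\<close>; distinctness is implied since \<open>e\<close> is not an edge of \<open>R\<^sub>e(T)\<close>\<close>
  "edge_chain V es \<longleftrightarrow>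
     set es \<subseteq> edges V \<and> sorted_wrt (\<lambda>e e'. e' \<in> edges (cut_root e V)) es"

text \<open>The list of \<open>T\<close>\<open>\<^sub>e\<^sub>,\<^sub>1\<close>, \<open>\<dots>\<close>, \<open>T\<close>\<open>\<^sub>e\<^sub>,\<^sub>m\<close> for a sequence \<open>e\<close> of \<open>m - 1\<close> edges.\<close>

fun pieces :: "nat list set \<Rightarrow> nat list list \<Rightarrow> nat list set list" where
  "pieces S [] = [S]"
| "pieces S (e # es) = add_root (cut_branch e S) # pieces (cut_root e S) es"

text \<open>The guard \<open>card U < card V\<close> only ensures termination. It fails only if \<open>m = 2\<close> and \<open>e\<^sub>1\<close> is
  the root edge of a tree whose root has one child, where the last factor, \<open>\<theta>\<close> of the single
  vertex, is zero anyway; \<open>theta_set_rec\<close> below is the equation without the guard. Sequences of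
  more than \<open>card V - 1\<close> distinct edges do not exist.\<close>

function theta_set :: "nat list set \<Rightarrow> rat" where
  "theta_set V =
     (if V = {[]} \<or> card {v \<in> V. length v = 1} > 1 then 0
      else if card V = 2 then 1
      else 1 - (\<Sum>m\<in>{2..card V}. 1 / fact m *
             (\<Sum>es\<in>{es. length es = m - 1 \<and> edge_chain V es}.
                prod_list (map (\<lambda>U. if card U < card V then theta_set U else 0) (pieces V es)))))"
  by pat_completeness auto
termination
  by (relation "measure card") auto

declare theta_set.simps [simp del]

lemma card_cut:
  assumes "finite V"
  shows "card (add_root (cut_branch e V)) + card (cut_root e V) = Suc (card V)"
    and "finite (cut_branch e V)"
proof -
  have V: "V = (@) e ` cut_branch e V \<union> cut_root e V"
    by (auto simp: cut_branch_def cut_root_def prefix_def)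
  have fin: "finite ((@) e ` cut_branch e V)"
    by (rule finite_subset[OF _ assms]) (auto simp: cut_branch_def)
  have inj: "inj_on ((@) e) A" for A
    by (auto simp: inj_on_def)
  show fin': "finite (cut_branch e V)"
    using fin inj finite_imageD by blast
  have "card V = card ((@) e ` cut_branch e V) + card (cut_root e V)"
    by (subst V, rule card_Un_disjoint) (use fin assms in \<open>auto simp: cut_root_def\<close>)
  moreover have "card (add_root (cut_branch e V)) = Suc (card (cut_branch e V))"
    unfolding add_root_def
    by (subst card_insert_disjoint) (auto simp: fin' card_image)
  ultimately show "card (add_root (cut_branch e V)) + card (cut_root e V) = Suc (card V)"
    by (simp add: card_image inj)
qed

lemma card_pieces_le:
  assumes "finite V" "[] \<in> V" "[] \<notin> set es" "U \<in> set (pieces V es)"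
  shows "card U \<le> card V"
  using assms
proof (induction es arbitrary: V)
  case Nil
  then show ?case by simp
next
  case (Cons e es)
  have "[] \<in> cut_root e V" and fin: "finite (cut_root e V)"
    using Cons.prems by (auto simp: cut_root_def)
  then have "card (cut_root e V) > 0"
    using card_gt_0_iff by blast
  moreover have "card (cut_root e V) \<le> card V"
    using Cons.prems(1) by (auto simp: cut_root_def intro: card_mono)
  ultimately show ?case
    using Cons.IH[OF fin \<open>[] \<in> cut_root e V\<close>] Cons.prems(3,4) card_cut(1)[OF Cons.prems(1), of e]
    by fastforce
qed

lemma theta_set_rec:
  assumes "rooted_tree_set V" "V \<noteq> {[]}" "\<not> card {v \<in> V. length v = 1} > 1" "card V \<noteq> 2"
  shows "theta_set V = 1 - (\<Sum>m\<in>{2..card V}. 1 / fact m *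
           (\<Sum>es\<in>{es. length es = m - 1 \<and> edge_chain V es}.
              prod_list (map theta_set (pieces V es))))"
proof -
  have V: "finite V" "[] \<in> V"
    using assms(1) by (auto simp: rooted_tree_set_def)
  have eq: "prod_list (map (\<lambda>U. if card U < card V then theta_set U else 0) (pieces V es)) =
      prod_list (map theta_set (pieces V es))"
    if es: "edge_chain V es" "es \<noteq> []" for es
  proof -
    obtain e es' where es_eq: "es = e # es'"
      using es(2) by (cases es) auto
    let ?R = "cut_root e V"
    have e: "e \<in> V" "e \<noteq> []" and es': "set es' \<subseteq> edges ?R"
      using es(1) by (auto simp: es_eq edge_chain_def edges_def)
    have R: "finite ?R" "[] \<in> ?R"
      using V e by (auto simp: cut_root_def)
    have "?R \<subset> V"
      using e by (auto simp: cut_root_def)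
    then have less: "card ?R < card V"
      using V(1) psubset_card_mono by blast
    have rest: "card U < card V" if "U \<in> set (pieces ?R es')" for U
      using card_pieces_le[OF R _ that] es' less by (force simp: edges_def)
    show ?thesis
    proof (cases "?R = {[]}")
      case True
      then have "es' = []"
        using es' by (simp add: edges_def)
      moreover have "theta_set {[]} = 0"
        by (subst theta_set.simps) simp
      ultimately show ?thesis
        using True by (simp add: es_eq)
    next
      case False
      then have "{[]} \<subset> ?R"
        using R(2) by auto
      then have "card ?R > 1"
        using psubset_card_mono[OF R(1), of "{[]}"] by simp
      then have "card (add_root (cut_branch e V)) < card V"
        using card_cut(1)[OF V(1), of e] by linarith
      then have "\<forall>U\<in>set (pieces V es). card U < card V"
        using rest by (simp add: es_eq)
      then show ?thesis
        by (intro arg_cong[where f = prod_list] map_cong refl) auto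
    qed
  qed
  have "theta_set V = 1 - (\<Sum>m\<in>{2..card V}. 1 / fact m *
           (\<Sum>es\<in>{es. length es = m - 1 \<and> edge_chain V es}.
              prod_list (map (\<lambda>U. if card U < card V then theta_set U else 0) (pieces V es))))"
    using assms by (subst theta_set.simps) (simp only: if_False simp_thms)
  also have "\<dots> = 1 - (\<Sum>m\<in>{2..card V}. 1 / fact m *
           (\<Sum>es\<in>{es. length es = m - 1 \<and> edge_chain V es}.
              prod_list (map theta_set (pieces V es))))"
  proof -
    have "(\<Sum>es\<in>{es. length es = m - 1 \<and> edge_chain V es}.
              prod_list (map (\<lambda>U. if card U < card V then theta_set U else 0) (pieces V es))) =
          (\<Sum>es\<in>{es. length es = m - 1 \<and> edge_chain V es}.
              prod_list (map theta_set (pieces V es)))" if "m \<in> {2..card V}" for m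
      using that by (intro sum.cong refl eq) auto
    then show ?thesis
      by simp
  qed
  finally show ?thesis .
qed

definition theta :: "'a tree \<Rightarrow> rat" where
  "theta T = theta_set (verts (planar T))"

definition V_elt :: "(rat, 'k, 'm) module_scheme \<Rightarrow> nat set \<Rightarrow> nat tree \<Rightarrow> nat tree \<Rightarrow> 'k" where
  "V_elt K W T = rat_scalar K (1 / of_nat (num_auts T)) \<odot>\<^bsub>gl_algebra K W\<^esub> gl_basis K T"

text \<open>The series \<open>\<Sum>T\<in>X. t\<^bsup>|T| - e\<^esup> c\<^sub>T \<V>\<^sub>T\<close>. For \<open>0 \<notin> W\<close> only finitely many trees in \<open>bar_T W\<close>
  have a given weight, so the finite sum defining each coefficient is the intended one.\<close>

definition tree_series ::
  "(rat, 'k, 'm) module_scheme \<Rightarrow> nat set \<Rightarrow> nat tree set \<Rightarrow> nat \<Rightarrow> (nat tree \<Rightarrow> rat) \<Rightarrow>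
   nat \<Rightarrow> nat tree \<Rightarrow> 'k" where
  "tree_series K W X e c =
     (\<lambda>n. \<Oplus>\<^bsub>gl_algebra K W\<^esub>T\<in>{T \<in> X. weight T = n + e}.
            rat_scalar K (c T) \<odot>\<^bsub>gl_algebra K W\<^esub> V_elt K W T)"

definition f_series :: "(rat, 'k, 'm) module_scheme \<Rightarrow> nat set \<Rightarrow> nat \<Rightarrow> nat tree \<Rightarrow> 'k" where
  "f_series K W = tree_series K W (bar_S W) 0 (\<lambda>T. (-1) ^ (size (branches T) + weight T))"

definition g_series :: "(rat, 'k, 'm) module_scheme \<Rightarrow> nat set \<Rightarrow> nat \<Rightarrow> nat tree \<Rightarrow> 'k" where
  "g_series K W = tree_series K W (bar_T W) 0 (\<lambda>T. 1)"

definition d_series :: "(rat, 'k, 'm) module_scheme \<Rightarrow> nat set \<Rightarrow> nat \<Rightarrow> nat tree \<Rightarrow> 'k" where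
  "d_series K W = tree_series K W (bar_P W) 0 theta"

definition h_series :: "(rat, 'k, 'm) module_scheme \<Rightarrow> nat set \<Rightarrow> nat \<Rightarrow> nat tree \<Rightarrow> 'k" where
  "h_series K W = tree_series K W (bar_H W) 1 (\<lambda>T. of_nat (leaf_label T))"

definition m_series :: "(rat, 'k, 'm) module_scheme \<Rightarrow> nat set \<Rightarrow> nat \<Rightarrow> nat tree \<Rightarrow> 'k" where
  "m_series K W = tree_series K W (bar_P W) 1 (\<lambda>T. of_nat (child_label T))"

end

theory Submission
  imports Defs "HOL-Library.Product_Plus"
begin

text \<open>In the basis of the elements \<open>\<V>\<^sub>T\<close> the symmetry factors disappear from the Grossman-Larson product:
  if \<open>x = \<Sum> a\<^sub>T \<V>\<^sub>T\<close> and \<open>y = \<Sum> b\<^sub>T \<V>\<^sub>T\<close>, then the coefficient of \<open>\<V>\<^sub>U\<close> in \<open>x y\<close> is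
  \<open>\<Sum> a\<^sub>P b\<^sub>R\<close>, summed over the ways of cutting \<open>U\<close> into a part \<open>R\<close> that contains the root and the
  forest of branches \<open>P\<close> that are cut off. The reason is that \<open>\<alpha>\<close> counts isomorphisms: a map that
  grafts \<open>T\<close> on \<open>S\<close>, together with an isomorphism from the result to \<open>U\<close>, is the same as a cut
  \<open>(P, R)\<close> of \<open>U\<close> together with isomorphisms from \<open>T\<close> to \<open>P\<close> and from \<open>S\<close> to \<open>R\<close>
  (\<open>count_gl_terms\<close>). A tree of \<open>bar_T W\<close> is determined by the forest below its root, so the
  theorem is about rational-valued functions on forests, called forms here, under the convolution
  \<open>(a * b)(F) = \<Sum> a(P) b(R)\<close>. The algebra \<open>K\<close> enters only through the ring homomorphism
  \<open>\<rat> \<rightarrow> K\<close>, and associativity of the product is coassociativity of cutting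
  (\<open>cut_sum_coassoc\<close>).

  A forest is cut by cutting each of its trees, or removing the tree entirely. Hence each of the
  identities can be checked by induction on forests. The form of \<open>g\<close> is constantly \<open>1\<close>, and the form
  of \<open>f(-t)\<close> is \<open>(-1)\<^sup>k\<close> on a forest of \<open>k\<close> single vertices and zero elsewhere; in its
  convolutions with \<open>1\<close> the removal of a tree cancels the other cuts of this tree. The form of \<open>h\<close> sees the cuts that
  leave a chain, and there is exactly one for every vertex other than the root, namely the cut that
  leaves the path to it; the form of \<open>m\<close> sees the cuts of a single edge, and every vertex other
  than the root is the root of exactly one branch cut off that way. In both cases the labels of the
  vertices add up to \<open>|T|\<close>, which is what \<open>d/dt\<close> multiplies with.

  The form \<open>\<theta>\<close> of \<open>d\<close> is infinitesimal: it vanishes on forests that are not a single tree. Only cuts of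
  one edge contribute to its convolution from the left with another form, so that the \<open>k\<close>-th convolution power
  is the sum over chains of \<open>k - 1\<close> edges in the definition of \<open>\<theta>\<close>, and this definition says
  precisely that \<open>\<Sum> \<theta>\<^sup>k / k!\<close> equals \<open>1\<close> on single trees. It equals \<open>1\<close> on all forests because the
  exponential of an infinitesimal form is multiplicative on disjoint unions (\<open>exp_form_plus\<close>).\<close>

section \<open>Cuts of forests\<close>

type_synonym 'a forest = "'a tree multiset"

primrec tree_size :: "'a tree \<Rightarrow> nat" where
  "tree_size (Node a F) = Suc (\<Sum>\<^sub># (image_mset tree_size F))"

abbreviation forest_size :: "'a forest \<Rightarrow> nat" where
  "forest_size F \<equiv> \<Sum>\<^sub># (image_mset tree_size F)"

text \<open>Removing one tree from a forest leaves the forest below the root of that tree and the remaining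
  forest, both of them smaller. Most inductions on forests below have this form.\<close>

lemma forest_induct [case_names empty add]:
  assumes "P {#}" and "\<And>a F G. P F \<Longrightarrow> P G \<Longrightarrow> P (add_mset (Node a F) G)"
  shows "P F"
proof (induction F rule: measure_induct_rule[where f = forest_size])
  case (less F)
  show ?case
  proof (cases F)
    case (add C G)
    obtain a H where C: "C = Node a H"
      by (cases C)
    show ?thesis
      unfolding add C using assms(2)[OF less less] by (simp add: add C)
  qed (simp add: assms(1))
qed

text \<open>The cuts of a disjoint union are the unions of cuts of the parts. With pairs of forests added
  componentwise, the multiset of all cuts is therefore a Minkowski sum over the trees of the forest.\<close>

definition minkowski_sum :: "'m::comm_monoid_add multiset \<Rightarrow> 'm multiset \<Rightarrow> 'm multiset" where
  "minkowski_sum M N = (\<Sum>x\<in>#M. image_mset ((+) x) N)"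

lemma minkowski_sum_simps [simp]:
  "minkowski_sum {#} N = {#}"
  "minkowski_sum (add_mset x M) N = image_mset ((+) x) N + minkowski_sum M N"
  by (simp_all add: minkowski_sum_def)

lemma sum_mset_minkowski_sum:
  "(\<Sum>z\<in>#minkowski_sum M N. f z) = (\<Sum>x\<in>#M. \<Sum>y\<in>#N. f (x + y))"
  by (induction M) (simp_all add: image_mset.compositionality comp_def)

lemma image_sum_mset: "image_mset f (\<Sum>x\<in>#M. g x) = (\<Sum>x\<in>#M. image_mset f (g x))"
  by (induction M) simp_all

lemma sum_mset_single: "(\<Sum>x\<in>#M. {#f x#}) = image_mset f M"
  by (induction M) simp_all

global_interpretation minkowski: comm_monoid_mset minkowski_sum "{#0::'m::comm_monoid_add#}"
  defines minkowski_sums = minkowski.F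
proof
  fix L M N :: "'m multiset"
  have flat: "minkowski_sum M N = (\<Sum>x\<in>#M. \<Sum>y\<in>#N. {#x + y#})" for M N :: "'m multiset"
    by (simp add: minkowski_sum_def sum_mset_single)
  have "minkowski_sum (minkowski_sum L M) N = (\<Sum>x\<in>#L. \<Sum>y\<in>#M. {#x + y + z. z \<in># N#})"
    by (simp add: minkowski_sum_def[of "minkowski_sum L M"] sum_mset_minkowski_sum)
  also have "\<dots> = minkowski_sum L (minkowski_sum M N)"
    by (simp add: minkowski_sum_def image_sum_mset image_mset.compositionality comp_def add.assoc)
  finally show "minkowski_sum (minkowski_sum L M) N = minkowski_sum L (minkowski_sum M N)" .
  show "minkowski_sum M N = minkowski_sum N M"
    unfolding flat by (subst sum_mset.swap) (simp add: add.commute)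
  show "minkowski_sum M {#0#} = M"
    by (induction M) simp_all
qed

text \<open>A cut \<open>(P, R)\<close> of a tree keeps the root in \<open>R\<close>. In a cut of a forest, every tree \<open>C\<close> either goes to \<open>P\<close>
  entirely, which is the pair \<open>({#C#}, {#})\<close>, or is cut as a tree. Cuts are counted with
  multiplicity: isomorphic pairs at different places of the tree are different cuts.\<close>

primrec tree_cuts :: "'a tree \<Rightarrow> ('a forest \<times> 'a tree) multiset" where
  "tree_cuts (Node a F) =
     image_mset (apsnd (Node a))
       (minkowski_sums (image_mset (\<lambda>C. add_mset ({#C#}, {#})
          (image_mset (apsnd (\<lambda>R. {#R#})) (tree_cuts C))) F))"

definition forest_cuts :: "'a forest \<Rightarrow> ('a forest \<times> 'a forest) multiset" where
  "forest_cuts F =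
     minkowski_sums (image_mset (\<lambda>C. add_mset ({#C#}, {#})
          (image_mset (apsnd (\<lambda>R. {#R#})) (tree_cuts C))) F)"

lemma tree_cuts_Node: "tree_cuts (Node a F) = image_mset (apsnd (Node a)) (forest_cuts F)"
  by (simp add: forest_cuts_def)

lemma forest_cuts_add_mset:
  "forest_cuts (add_mset (Node a F) G) =
    minkowski_sum (add_mset ({#Node a F#}, {#})
      (image_mset (\<lambda>(P, R). (P, {#Node a R#})) (forest_cuts F))) (forest_cuts G)"
  by (simp add: forest_cuts_def[of "add_mset _ _"] tree_cuts_Node image_mset.compositionality comp_def
      case_prod_unfold flip: forest_cuts_def) (simp add: apsnd_def map_prod_def case_prod_unfold)

text \<open>Additive quantities such as size and weight pass from a forest to its cuts by this rule.\<close>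

lemma forest_cuts_induct [consumes 1, case_names empty cut keep]:
  assumes "(P, R) \<in># forest_cuts F"
    and "Q {#} {#} {#}"
    and "\<And>a F G P R. Q G P R \<Longrightarrow> Q (add_mset (Node a F) G) (add_mset (Node a F) P) R"
    and "\<And>a F G P R P' R'. Q F P R \<Longrightarrow> Q G P' R' \<Longrightarrow>
      Q (add_mset (Node a F) G) (P + P') (add_mset (Node a R) R')"
  shows "Q F P R"
  using assms(1)
proof (induction F arbitrary: P R rule: forest_induct)
  case empty
  then show ?case
    using assms(2) by (simp add: forest_cuts_def zero_prod_def)
next
  case (add a F G)
  then show ?case
    using assms(3,4) by (auto simp: forest_cuts_add_mset minkowski_sum_def)
qed

lemma forest_size_cut: "(P, R) \<in># forest_cuts F \<Longrightarrow> forest_size P + forest_size R = forest_size F"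
  by (induction F P R rule: forest_cuts_induct) auto

abbreviation forest_weight :: "nat forest \<Rightarrow> nat" where
  "forest_weight F \<equiv> \<Sum>\<^sub># (image_mset weight F)"

lemma forest_weight_cut: "(P, R) \<in># forest_cuts F \<Longrightarrow> forest_weight P + forest_weight R = forest_weight F"
  by (induction F P R rule: forest_cuts_induct) auto

abbreviation forest_labels :: "'a forest \<Rightarrow> 'a set" where
  "forest_labels F \<equiv> \<Union>C\<in>set_mset F. labels C"

lemma forest_labels_cut: "(P, R) \<in># forest_cuts F \<Longrightarrow> forest_labels P \<union> forest_labels R = forest_labels F"
  by (induction F P R rule: forest_cuts_induct) auto

text \<open>The coproduct dual to the product is only ever used in sums over all cuts. As a functional it has
  a rewriting rule, \<open>cut_sum_add_mset\<close>, that serves as its recursive definition.\<close>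

definition cut_sum :: "'a forest \<Rightarrow> ('a forest \<Rightarrow> 'a forest \<Rightarrow> 'b::comm_monoid_add) \<Rightarrow> 'b" where
  "cut_sum F f = (\<Sum>(P, R)\<in>#forest_cuts F. f P R)"

lemma cut_sum_empty [simp]: "cut_sum {#} f = f {#} {#}"
  by (simp add: cut_sum_def forest_cuts_def zero_prod_def)

lemma cut_sum_add_mset [simp]:
  "cut_sum (add_mset (Node a F) G) f =
     cut_sum G (\<lambda>P R. f (add_mset (Node a F) P) R) +
     cut_sum F (\<lambda>P R. cut_sum G (\<lambda>P' R'. f (P + P') (add_mset (Node a R) R')))"
  by (simp add: cut_sum_def forest_cuts_add_mset sum_mset_minkowski_sum case_prod_unfold
      image_mset.compositionality comp_def plus_prod_def)

lemma cut_sum_0 [simp]: "cut_sum F (\<lambda>P R. 0) = 0"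
  by (simp add: cut_sum_def case_prod_unfold)

lemma cut_sum_distrib: "cut_sum F (\<lambda>P R. f P R + g P R) = cut_sum F f + cut_sum F g"
  by (simp add: cut_sum_def case_prod_unfold sum_mset.distrib)

lemma cut_sum_mult_left:
  fixes c :: "'b::semiring_0"
  shows "cut_sum F (\<lambda>P R. c * f P R) = c * cut_sum F f"
  by (simp add: cut_sum_def case_prod_unfold sum_mset_distrib_left)

lemma cut_sum_mult_right:
  fixes c :: "'b::semiring_0"
  shows "cut_sum F (\<lambda>P R. f P R * c) = cut_sum F f * c"
  by (simp add: cut_sum_def case_prod_unfold sum_mset_distrib_right)

lemma cut_sum_uminus [simp]:
  fixes f :: "'a forest \<Rightarrow> 'a forest \<Rightarrow> 'b::ring_1"
  shows "cut_sum F (\<lambda>P R. - f P R) = - cut_sum F f"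
  using cut_sum_mult_left[of F "- 1" f] by simp

lemma cut_sum_of_nat: "of_nat (cut_sum F f) = cut_sum F (\<lambda>P R. of_nat (f P R))"
proof -
  have "of_nat (\<Sum>x\<in>#M. g x) = (\<Sum>x\<in>#M. of_nat (g x))" for M and g :: "_ \<Rightarrow> nat"
    by (induction M) simp_all
  then show ?thesis
    unfolding cut_sum_def case_prod_unfold .
qed

lemma cut_sum_cong:
  assumes "\<And>P R. (P, R) \<in># forest_cuts F \<Longrightarrow> f P R = g P R"
  shows "cut_sum F f = cut_sum F g"
  unfolding cut_sum_def using assms by (auto intro!: arg_cong[where f = sum_mset] image_mset_cong)

lemma cut_sum_sum_mset: "cut_sum F (\<lambda>P R. \<Sum>x\<in>#M. f x P R) = (\<Sum>x\<in>#M. cut_sum F (f x))"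
  unfolding cut_sum_def case_prod_unfold by (subst sum_mset.swap) simp

lemma cut_sum_sum: "cut_sum F (\<lambda>P R. \<Sum>x\<in>A. f x P R) = (\<Sum>x\<in>A. cut_sum F (f x))"
  by (simp add: sum_unfold_sum_mset cut_sum_sum_mset)

lemma cut_sum_swap:
  "cut_sum F (\<lambda>P R. cut_sum G (\<lambda>P' R'. f P R P' R')) =
   cut_sum G (\<lambda>P' R'. cut_sum F (\<lambda>P R. f P R P' R'))"
  unfolding cut_sum_def case_prod_unfold by (rule sum_mset.swap)

lemma cut_sum_plus:
  "cut_sum (F + G) f = cut_sum F (\<lambda>P R. cut_sum G (\<lambda>P' R'. f (P + P') (R + R')))"
proof (induction F arbitrary: f rule: forest_induct)
  case (add a F H)
  then show ?case
    by (simp add: add.assoc)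
qed simp

text \<open>Cutting twice: the part cut off can be cut again, or the part that is kept, and both ways list the
  partitions of the forest into an upper, a middle and a lower layer. This is the coassociativity of
  the Connes-Kreimer coproduct. In the inductive step the three summands correspond to the layer
  that contains the root of the new tree.\<close>

lemma cut_sum_coassoc:
  "cut_sum F (\<lambda>P R. cut_sum P (\<lambda>A B. f A B R)) = cut_sum F (\<lambda>A V. cut_sum V (\<lambda>B R. f A B R))"
proof (induction F arbitrary: f rule: forest_induct)
  case (add a F G)
  let ?C = "Node a F"
  have "cut_sum (add_mset ?C G) (\<lambda>P R. cut_sum P (\<lambda>A B. f A B R)) =
    cut_sum G (\<lambda>P R. cut_sum P (\<lambda>A B. f (add_mset ?C A) B R)) +
    cut_sum F (\<lambda>A B. cut_sum G (\<lambda>P R. cut_sum P (\<lambda>A' B'. f (A + A') (add_mset (Node a B) B') R))) +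
    cut_sum F (\<lambda>P R. cut_sum P (\<lambda>A B. cut_sum G (\<lambda>P' R'. cut_sum P' (\<lambda>A' B'.
      f (A + A') (B + B') (add_mset (Node a R) R')))))"
    by (simp add: cut_sum_plus cut_sum_distrib cut_sum_swap[of G])
  also have "\<dots> =
    cut_sum G (\<lambda>A V. cut_sum V (\<lambda>B R. f (add_mset ?C A) B R)) +
    cut_sum F (\<lambda>A B. cut_sum G (\<lambda>A' V'. cut_sum V' (\<lambda>B' R'. f (A + A') (add_mset (Node a B) B') R'))) +
    cut_sum F (\<lambda>A V. cut_sum V (\<lambda>B R. cut_sum G (\<lambda>A' V'. cut_sum V' (\<lambda>B' R'.
      f (A + A') (B + B') (add_mset (Node a R) R')))))"
    by (simp add: add.IH(2) add.IH(1)[of "\<lambda>A B R. cut_sum G (\<lambda>A' V'. cut_sum V' (\<lambda>B' R'.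
      f (A + A') (B + B') (add_mset (Node a R) R')))"])
  also have "\<dots> = cut_sum (add_mset ?C G) (\<lambda>A V. cut_sum V (\<lambda>B R. f A B R))"
    by (simp add: cut_sum_distrib add.assoc cut_sum_swap[of G])
  finally show ?case .
qed simp

lemma cut_sum_kept_empty: "cut_sum F (\<lambda>P R. if R = {#} then f P else 0) = f F"
  by (induction F arbitrary: f rule: forest_induct) simp_all

lemma cut_sum_cut_empty: "cut_sum F (\<lambda>P R. if P = {#} then f R else 0) = f F"
proof (induction F arbitrary: f rule: forest_induct)
  case (add a F G)
  have "cut_sum (add_mset (Node a F) G) (\<lambda>P R. if P = {#} then f R else 0) =
    cut_sum F (\<lambda>P R. if P = {#} then cut_sum G (\<lambda>P' R'. if P' = {#} then f (add_mset (Node a R) R') else 0) else 0)"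
    by (simp, rule cut_sum_cong) (auto intro!: cut_sum_cong)
  then show ?case
    by (simp add: add.IH)
qed simp

text \<open>Choosing a tree of the part that is kept amounts to choosing the tree \<open>u\<close> of the forest from which it
  remains, a cut of \<open>u\<close> that keeps its root, and a cut of the other trees.\<close>

lemma cut_sum_kept_branch:
  fixes f :: "'a forest \<Rightarrow> 'a tree \<Rightarrow> 'a forest \<Rightarrow> 'b::comm_monoid_add"
  shows "cut_sum X (\<lambda>P R. \<Sum>r\<in>#R. f P r (R - {#r#})) =
   (\<Sum>u\<in>#X. cut_sum (branches u) (\<lambda>P1 R1. cut_sum (X - {#u#})
      (\<lambda>P2 R2. f (P1 + P2) (Node (root_label u) R1) R2)))"
proof (induction X arbitrary: f rule: forest_induct)
  case (add a F G)
  let ?C = "Node a F"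
  have del: "(\<Sum>r\<in>#R. h r (add_mset x R - {#r#})) = (\<Sum>r\<in>#R. h r (add_mset x (R - {#r#})))"
    for h :: "_ \<Rightarrow> _ \<Rightarrow> 'b" and x :: "'a tree" and R
    by (intro arg_cong[where f = sum_mset] image_mset_cong) simp
  let ?K = "\<lambda>f. \<Sum>u\<in>#G. cut_sum (branches u) (\<lambda>P1 R1. cut_sum (G - {#u#})
      (\<lambda>P2 R2. f (P1 + P2) (Node (root_label u) R1) R2))"
  have "cut_sum (add_mset ?C G) (\<lambda>P R. \<Sum>r\<in>#R. f P r (R - {#r#})) =
    cut_sum G (\<lambda>P R. \<Sum>r\<in>#R. f (add_mset ?C P) r (R - {#r#})) +
    cut_sum F (\<lambda>P1 R1. cut_sum G (\<lambda>P2 R2. f (P1 + P2) (Node a R1) R2)) +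
    cut_sum F (\<lambda>P1 R1. cut_sum G (\<lambda>P2 R2. \<Sum>r\<in>#R2. f (P1 + P2) r (add_mset (Node a R1) (R2 - {#r#}))))"
    by (simp add: del cut_sum_distrib add.assoc)
  also have "\<dots> = 
    cut_sum F (\<lambda>P1 R1. cut_sum G (\<lambda>P2 R2. f (P1 + P2) (Node a R1) R2)) +
    (?K (\<lambda>P r R. f (add_mset ?C P) r R) + 
      cut_sum F (\<lambda>P1 R1. ?K (\<lambda>P r R. f (P1 + P) r (add_mset (Node a R1) R))))"
    by (simp add: add.IH(2)[of "\<lambda>P r R. f (add_mset ?C P) r R"]
      add.IH(2)[of "\<lambda>P r R. f (P1 + P) r (add_mset (Node a R1) R)" for P1 R1] add.assoc add.left_commute)
  also have "(?K (\<lambda>P r R. f (add_mset ?C P) r R) + 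
      cut_sum F (\<lambda>P1 R1. ?K (\<lambda>P r R. f (P1 + P) r (add_mset (Node a R1) R)))) =
    (\<Sum>u\<in>#G. cut_sum (branches u) (\<lambda>P1 R1. cut_sum (add_mset ?C (G - {#u#}))
      (\<lambda>P2 R2. f (P1 + P2) (Node (root_label u) R1) R2)))"
    by (simp add: cut_sum_sum_mset sum_mset.distrib cut_sum_distrib cut_sum_swap[of F] add.left_commute add.assoc)
  also have "\<dots> = (\<Sum>u\<in>#G. cut_sum (branches u) (\<lambda>P1 R1. cut_sum (add_mset ?C G - {#u#})
      (\<lambda>P2 R2. f (P1 + P2) (Node (root_label u) R1) R2)))"
    by (intro arg_cong[where f = sum_mset] image_mset_cong) simp
  finally show ?case
    by simp
qed simp

section \<open>Symmetry factors and the product of basis elements\<close>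

text \<open>An automorphism permutes isomorphic branches and acts within the branches, so \<open>\<alpha>\<close> is given by this
  recursion. That it counts the automorphisms of a planar representative is \<open>num_auts_eq\<close> below.\<close>

primrec aut :: "'a tree \<Rightarrow> nat" where
  "aut (Node a F) = \<Prod>\<^sub># (image_mset aut F) * (\<Prod>C\<in>set_mset F. fact (count F C))"

definition forest_aut :: "'a forest \<Rightarrow> nat" where
  "forest_aut F = \<Prod>\<^sub># (image_mset aut F) * (\<Prod>C\<in>set_mset F. fact (count F C))"

lemma aut_Node: "aut (Node a F) = forest_aut F"
  by (simp add: forest_aut_def)

declare aut.simps [simp del]
declare aut_Node [simp]

lemma forest_aut_empty [simp]: "forest_aut {#} = 1"
  by (simp add: forest_aut_def)

lemma forest_aut_add_mset:
  "forest_aut (add_mset C F) = Suc (count F C) * aut C * forest_aut F"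
proof -
  let ?S = "insert C (set_mset F)"
  have "(\<Prod>D\<in>?S. fact (count (add_mset C F) D)) =
      fact (Suc (count F C)) * (\<Prod>D\<in>?S - {C}. fact (count F D) :: nat)"
    by (subst prod.remove[of _ C]) (simp_all, intro disjI2 prod.cong, auto)
  also have "\<dots> = Suc (count F C) * (\<Prod>D\<in>?S. fact (count F D))"
    by (subst (2) prod.remove[of _ C]) (simp_all add: algebra_simps)
  also have "(\<Prod>D\<in>?S. fact (count F D) :: nat) = (\<Prod>D\<in>set_mset F. fact (count F D))"
    by (rule prod.mono_neutral_right) (auto simp: not_in_iff)
  finally show ?thesis
    by (simp add: forest_aut_def algebra_simps)
qed

lemma forest_aut_pos: "forest_aut F > 0"
  by (induction F rule: forest_induct) (auto simp: forest_aut_add_mset)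

lemma aut_pos: "aut C > 0"
  by (cases C) (simp add: forest_aut_pos)

text \<open>The number of isomorphisms between two trees, or two forests. Unlike \<open>aut\<close> alone, these numbers expand
  along the choice of the image of one tree (\<open>forest_isos_add_mset\<close>), like a permanent.\<close>

definition tree_isos :: "'a tree \<Rightarrow> 'a tree \<Rightarrow> nat" where
  "tree_isos C D = (if C = D then aut C else 0)"

definition forest_isos :: "'a forest \<Rightarrow> 'a forest \<Rightarrow> nat" where
  "forest_isos F G = (if F = G then forest_aut F else 0)"

lemma tree_isos_Node [simp]:
  "tree_isos (Node a F) (Node b G) = (if a = b then forest_isos F G else 0)"
  by (simp add: tree_isos_def forest_isos_def)

lemma forest_isos_empty: "forest_isos {#} F = (if F = {#} then 1 else 0)"
  by (auto simp: forest_isos_def)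

lemma forest_isos_add_mset:
  "forest_isos (add_mset C F) G = (\<Sum>u\<in>#G. tree_isos C u * forest_isos F (G - {#u#}))"
proof -
  have "(\<Sum>u\<in>#G. tree_isos C u * forest_isos F (G - {#u#})) =
      (\<Sum>u\<in>#G. if u = C then aut C * forest_isos F (G - {#C#}) else 0)"
    by (intro arg_cong[where f = sum_mset] image_mset_cong) (auto simp: tree_isos_def)
  also have "\<dots> = forest_isos (add_mset C F) G"
  proof (cases "G = add_mset C F")
    case False
    then have "C \<in># G \<Longrightarrow> F \<noteq> G - {#C#}"
      using insert_DiffM by metis
    with False show ?thesis
      by (simp add: sum_mset_delta forest_isos_def not_in_iff) (metis not_in_iff)
  qed (simp add: sum_mset_delta forest_isos_def forest_aut_add_mset algebra_simps)
  finally show ?thesis ..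
qed

abbreviation indexed_forest :: "('i \<Rightarrow> 'a tree) \<Rightarrow> 'i set \<Rightarrow> 'a forest" where
  "indexed_forest T A \<equiv> image_mset T (mset_set A)"

lemma sum_sum_mset_swap: "(\<Sum>x\<in>A. \<Sum>u\<in>#M. f x u) = (\<Sum>u\<in>#M. \<Sum>x\<in>A. f x u)"
  unfolding sum_unfold_sum_mset by (rule sum_mset.swap)

lemma cut_sum_prod:
  fixes f g :: "'a forest \<Rightarrow> 'a forest \<Rightarrow> 'b::comm_semiring_0"
  shows "cut_sum F f * cut_sum G g = cut_sum F (\<lambda>P R. cut_sum G (\<lambda>P' R'. f P R * g P' R'))"
  by (simp add: cut_sum_mult_left cut_sum_mult_right)

text \<open>An isomorphism to a disjoint union is determined by the set \<open>B\<close> of trees that it maps to the first part.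
  Trees are indexed by a set here because the subsets \<open>B\<close> have to distinguish isomorphic trees.\<close>

lemma forest_isos_plus:
  assumes "finite A"
  shows "forest_isos (indexed_forest T A) (P + Q) =
    (\<Sum>B\<in>Pow A. forest_isos (indexed_forest T B) P * forest_isos (indexed_forest T (A - B)) Q)"
  using assms
proof (induction A arbitrary: P Q rule: finite_induct)
  case (insert a A)
  let ?I = "\<lambda>B P. forest_isos (indexed_forest T B) P"
  have step: "?I (insert a B) P = (\<Sum>u\<in>#P. tree_isos (T a) u * ?I B (P - {#u#}))"
    if "B \<subseteq> A" for B P
  proof -
    have "finite B" "a \<notin> B"
      using that insert.hyps finite_subset by auto
    then show ?thesis
      by (simp add: forest_isos_add_mset)
  qed
  \<comment> \<open>The image \<open>u\<close> of the tree \<open>a\<close> lies in \<open>P\<close> or in \<open>Q\<close>; accordingly \<open>a\<close> belongs to \<open>B\<close> or not.\<close>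
  have "?I (insert a A) (P + Q) =
      (\<Sum>u\<in>#P. tree_isos (T a) u * ?I A (P + Q - {#u#})) +
      (\<Sum>u\<in>#Q. tree_isos (T a) u * ?I A (P + Q - {#u#}))"
    by (simp add: step)
  also have "(\<Sum>u\<in>#P. tree_isos (T a) u * ?I A (P + Q - {#u#})) =
      (\<Sum>u\<in>#P. tree_isos (T a) u * (\<Sum>B\<in>Pow A. ?I B (P - {#u#}) * ?I (A - B) Q))"
    by (intro arg_cong[where f = sum_mset] image_mset_cong) (simp flip: insert.IH)
  also have "\<dots> = (\<Sum>B\<in>Pow A. (\<Sum>u\<in>#P. tree_isos (T a) u * ?I B (P - {#u#})) * ?I (A - B) Q)"
    by (simp add: sum_distrib_left sum_mset_distrib_right mult.assoc sum_sum_mset_swap)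
  also have "\<dots> = (\<Sum>B\<in>Pow A. ?I (insert a B) P * ?I (A - B) Q)"
    by (intro sum.cong) (auto simp: step)
  also have "(\<Sum>u\<in>#Q. tree_isos (T a) u * ?I A (P + Q - {#u#})) =
      (\<Sum>u\<in>#Q. tree_isos (T a) u * (\<Sum>B\<in>Pow A. ?I B P * ?I (A - B) (Q - {#u#})))"
    by (intro arg_cong[where f = sum_mset] image_mset_cong) (simp flip: insert.IH)
  also have "\<dots> = (\<Sum>B\<in>Pow A. ?I B P * (\<Sum>u\<in>#Q. tree_isos (T a) u * ?I (A - B) (Q - {#u#})))"
    by (simp add: sum_distrib_left sum_mset_distrib_left mult.left_commute sum_sum_mset_swap)
  also have "\<dots> = (\<Sum>B\<in>Pow A. ?I B P * ?I (insert a (A - B)) Q)"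
    by (intro sum.cong) (auto simp: step)
  also have "(\<Sum>B\<in>Pow A. ?I (insert a B) P * ?I (A - B) Q) +
      (\<Sum>B\<in>Pow A. ?I B P * ?I (insert a (A - B)) Q) =
      (\<Sum>B\<in>Pow (insert a A). ?I B P * ?I (insert a A - B) Q)"
  proof -
    have "(\<Sum>B\<in>insert a ` Pow A. ?I B P * ?I (insert a A - B) Q) =
        (\<Sum>B\<in>Pow A. ?I (insert a B) P * ?I (A - B) Q)"
    proof (subst sum.reindex)
      show "inj_on (insert a) (Pow A)"
        using insert.hyps by (auto simp: inj_on_def)
      have "insert a A - insert a B = A - B" for B
        using insert.hyps by auto
      then show "sum ((\<lambda>B. ?I B P * ?I (insert a A - B) Q) \<circ> insert a) (Pow A) =
          (\<Sum>B\<in>Pow A. ?I (insert a B) P * ?I (A - B) Q)"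
        by simp
    qed
    moreover have "(\<Sum>B\<in>Pow A. ?I B P * ?I (insert a A - B) Q) =
        (\<Sum>B\<in>Pow A. ?I B P * ?I (insert a (A - B)) Q)"
    proof (intro sum.cong refl)
      fix B
      assume "B \<in> Pow A"
      then have "insert a A - B = insert a (A - B)"
        using insert.hyps by auto
      then show "?I B P * ?I (insert a A - B) Q = ?I B P * ?I (insert a (A - B)) Q"
        by simp
    qed
    ultimately show ?thesis
      unfolding Pow_insert using insert.hyps by (subst sum.union_disjoint) (auto simp: add.commute)
  qed
  finally show ?case .
qed (auto simp: forest_isos_empty)

text \<open>A map into a disjoint union is given by the set of arguments that go to the first part and by two
  maps into the parts. The first part is an image since it will consist of the vertices
  \<open>j # v\<close> of the branch number \<open>j\<close>.\<close>

lemma sum_PiE_split: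
  assumes "finite A" "finite X" "finite Y" "inj_on h X" "h ` X \<inter> Y = {}"
  shows "(\<Sum>\<phi>\<in>A \<rightarrow>\<^sub>E (h ` X \<union> Y). g \<phi>) =
    (\<Sum>B\<in>Pow A. \<Sum>\<psi>\<in>B \<rightarrow>\<^sub>E X. \<Sum>\<chi>\<in>(A - B) \<rightarrow>\<^sub>E Y. g (\<lambda>i. if i \<in> B then h (\<psi> i) else \<chi> i))"
proof -
  let ?D = "SIGMA B:Pow A. (B \<rightarrow>\<^sub>E X) \<times> ((A - B) \<rightarrow>\<^sub>E Y)"
  let ?join = "\<lambda>(B, \<psi>, \<chi>). \<lambda>i. if i \<in> B then h (\<psi> i) else \<chi> i"
  let ?dom = "\<lambda>\<phi>. {i \<in> A. \<phi> i \<in> h ` X}"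
  let ?split = "\<lambda>\<phi>. (?dom \<phi>, restrict (inv_into X h \<circ> \<phi>) (?dom \<phi>), restrict \<phi> (A - ?dom \<phi>))"
  have "(\<Sum>B\<in>Pow A. \<Sum>\<psi>\<in>B \<rightarrow>\<^sub>E X. \<Sum>\<chi>\<in>(A - B) \<rightarrow>\<^sub>E Y. g (?join (B, \<psi>, \<chi>))) = (\<Sum>x\<in>?D. g (?join x))"
    using assms by (simp add: sum.Sigma sum.cartesian_product finite_PiE finite_subset split_def cong: if_cong)
  also have "\<dots> = (\<Sum>\<phi>\<in>A \<rightarrow>\<^sub>E (h ` X \<union> Y). g \<phi>)"
  proof (rule sum.reindex_bij_witness[of _ ?split ?join])
    fix x
    assume "x \<in> ?D"
    then obtain B \<psi> \<chi> where x: "x = (B, \<psi>, \<chi>)" and B: "B \<subseteq> A"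
      and \<psi>: "\<psi> \<in> B \<rightarrow>\<^sub>E X" and \<chi>: "\<chi> \<in> (A - B) \<rightarrow>\<^sub>E Y"
      by auto
    have "\<chi> i \<notin> h ` X" if "i \<in> A - B" for i
      using PiE_mem[OF \<chi> that] assms(5) by auto
    then have dom: "?dom (?join x) = B"
      using B PiE_mem[OF \<psi>] by (auto simp: x)
    have "restrict (inv_into X h \<circ> ?join x) B = \<psi>"
      using inv_into_f_f[OF assms(4) PiE_mem[OF \<psi>]] PiE_arb[OF \<psi>] by (auto simp: x fun_eq_iff)
    moreover have "restrict (?join x) (A - B) = \<chi>"
      using \<chi> by (auto simp: x fun_eq_iff PiE_def extensional_def)
    ultimately show "?split (?join x) = x"
      unfolding dom by (simp add: x)
    show "?join x \<in> A \<rightarrow>\<^sub>E (h ` X \<union> Y)"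
    proof (rule PiE_I)
      fix i
      assume "i \<in> A"
      then show "?join x i \<in> h ` X \<union> Y"
        using PiE_mem[OF \<psi>, of i] PiE_mem[OF \<chi>, of i] by (simp add: x)
    next
      fix i
      assume "i \<notin> A"
      then show "?join x i = undefined"
        using B PiE_arb[OF \<chi>, of i] by (auto simp: x)
    qed
  next
    fix \<phi>
    assume \<phi>: "\<phi> \<in> A \<rightarrow>\<^sub>E (h ` X \<union> Y)"
    then have "\<phi> i \<in> Y" if "i \<in> A - ?dom \<phi>" for i
      using PiE_mem[OF \<phi>, of i] that by auto
    then show "?split \<phi> \<in> ?D"
      by (auto simp: inv_into_into)
    show "?join (?split \<phi>) = \<phi>"
      using \<phi> by (auto simp: fun_eq_iff f_inv_into_f PiE_def extensional_def)
  qed simp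
  finally show ?thesis
    by simp
qed

text \<open>The isomorphism class of a grafted tree depends only on the multiset of classes of the trees attached
  at each vertex; this avoids the order of the attached branches.\<close>

fun graft_class :: "'a ptree \<Rightarrow> (nat list \<Rightarrow> 'a forest) \<Rightarrow> 'a tree" where
  "graft_class (PNode a ss) M =
     Node a (indexed_forest (\<lambda>j. graft_class (ss ! j) (\<lambda>v. M (j # v))) {..<length ss} + M [])"

lemma mset_map_nth: "image_mset f (mset ts) = image_mset (\<lambda>j. f (ts ! j)) (mset_set {..<length ts})"
proof -
  have "map f ts = map (\<lambda>j. f (ts ! j)) [0..<length ts]"
    by (rule nth_equalityI) simp_all
  then have "image_mset f (mset ts) = mset (map (\<lambda>j. f (ts ! j)) [0..<length ts])"
    by (metis mset_map)
  then show ?thesis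
    by (simp only: mset_map mset_upt atLeast0LessThan)
qed

lemma iso_class_graft: "iso_class (graft s F) = graft_class s (\<lambda>v. mset (map iso_class (F v)))"
proof (induction s F rule: graft.induct)
  case (1 a ts F)
  then show ?case
    by (auto simp: atLeast0LessThan image_mset.compositionality comp_def intro!: image_mset_cong)
qed

lemma finite_verts: "finite (verts t)"
  by (induction t rule: verts.induct) simp

abbreviation attached :: "('i \<Rightarrow> 'a tree) \<Rightarrow> 'i set \<Rightarrow> ('i \<Rightarrow> nat list) \<Rightarrow> nat list \<Rightarrow> 'a forest" where
  "attached T A \<phi> \<equiv> \<lambda>v. indexed_forest T {i \<in> A. \<phi> i = v}"

text \<open>The combinatorial core. The left-hand side counts pairs of a map \<open>\<phi>\<close>, which tells where the trees
  \<open>T i\<close> are attached to \<open>s\<close>, and an isomorphism of the resulting tree with \<open>U\<close>. Such an isomorphism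
  maps \<open>s\<close> to a part of \<open>U\<close> that contains the root and the attached trees to the branches that are cut
  off. The proof is by induction on \<open>s\<close> and, for a fixed root, on a set \<open>J\<close> of branches of the root:
  splitting off the branch \<open>j\<close>, the set \<open>B\<close> of trees that are attached within it varies over all
  subsets, and \<open>u\<close> is the tree of \<open>X\<close> to which the isomorphism maps this branch.\<close>

lemma sum_graftings:
  assumes "finite A"
  shows "(\<Sum>\<phi>\<in>A \<rightarrow>\<^sub>E verts s. tree_isos (graft_class s (attached T A \<phi>)) U) =
    cut_sum (branches U) (\<lambda>P R. forest_isos (indexed_forest T A) P *
      tree_isos (iso_class s) (Node (root_label U) R))"
  using assms
proof (induction s arbitrary: A U rule: measure_induct_rule[where f = size])
  case (less s)
  obtain a ss where s: "s = PNode a ss"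
    by (cases s)
  obtain b X where U: "U = Node b X"
    by (cases U)
  let ?V = "\<lambda>J. insert [] (\<Union>j\<in>J. (#) j ` verts (ss ! j))"
  let ?S = "\<lambda>J. indexed_forest (\<lambda>j. iso_class (ss ! j)) J"
  let ?g = "\<lambda>A \<phi> j. graft_class (ss ! j) (\<lambda>v. attached T A \<phi> (j # v))"
  have *: "(\<Sum>\<phi>\<in>A \<rightarrow>\<^sub>E ?V J. forest_isos (indexed_forest (?g A \<phi>) J + attached T A \<phi> []) X) =
      cut_sum X (\<lambda>P R. forest_isos (indexed_forest T A) P * forest_isos (?S J) R)"
    if "J \<subseteq> {..<length ss}" "finite A" for J A X
    using finite_subset[OF that(1) finite_lessThan] that
  proof (induction J arbitrary: A X rule: finite_induct)
    case empty
    have "cut_sum X (\<lambda>P R. forest_isos (indexed_forest T A) P * forest_isos (?S {}) R) =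
        cut_sum X (\<lambda>P R. if R = {#} then forest_isos (indexed_forest T A) P else 0)"
      by (intro cut_sum_cong) (simp add: forest_isos_empty)
    then show ?case
      by (simp add: cut_sum_kept_empty PiE_singleton cong: conj_cong)
  next
    case (insert j J)
    have j: "j < length ss"
      using insert.prems by simp
    have "size (ss ! j) < size s"
      using j by (simp add: s size_nth_ptree)
    note IH1 = less.IH[OF this]
    note IH2 = insert.IH
    have split: "?V (insert j J) = (#) j ` verts (ss ! j) \<union> ?V J"
      by auto
    \<comment> \<open>The trees attached in the branch \<open>j\<close> and those attached elsewhere do not interact.\<close>
    have summand: "forest_isos (indexed_forest (?g A \<phi>) (insert j J) + attached T A \<phi> []) X =
        (\<Sum>u\<in>#X. tree_isos (graft_class (ss ! j) (attached T B \<psi>)) u *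
          forest_isos (indexed_forest (?g (A - B) \<chi>) J + attached T (A - B) \<chi> []) (X - {#u#}))"
      if B: "B \<in> Pow A" and \<psi>: "\<psi> \<in> B \<rightarrow>\<^sub>E verts (ss ! j)" and \<chi>: "\<chi> \<in> (A - B) \<rightarrow>\<^sub>E ?V J"
        and \<phi>: "\<phi> = (\<lambda>i. if i \<in> B then j # \<psi> i else \<chi> i)" for B \<psi> \<chi> \<phi>
    proof -
      have "\<chi> i \<noteq> j # v" if "i \<in> A - B" for i v
        using PiE_mem[OF \<chi> that] insert.hyps by auto
      then have eq1: "{i \<in> A. \<phi> i = j # v} = {i \<in> B. \<psi> i = v}" for v
        using B by (auto simp: \<phi>)
      have eq2: "{i \<in> A. \<phi> i = k # v} = {i \<in> A - B. \<chi> i = k # v}" if "k \<noteq> j" for k v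
        using that by (auto simp: \<phi>)
      have eq3: "{i \<in> A. \<phi> i = []} = {i \<in> A - B. \<chi> i = []}"
        by (auto simp: \<phi>)
      have eq4: "indexed_forest (?g A \<phi>) J = indexed_forest (?g (A - B) \<chi>) J"
      proof (rule image_mset_cong)
        fix k
        assume "k \<in># mset_set J"
        then have "k \<noteq> j"
          using insert.hyps by auto
        then show "?g A \<phi> k = ?g (A - B) \<chi> k"
          by (simp only: eq2[OF \<open>k \<noteq> j\<close>])
      qed
      show ?thesis
        using insert.hyps by (simp only: mset_set.insert image_mset_add_mset union_mset_add_mset_left
          forest_isos_add_mset eq1 eq3 eq4 not_False_eq_True)
    qed
    have "(\<Sum>\<phi>\<in>A \<rightarrow>\<^sub>E ?V (insert j J).
        forest_isos (indexed_forest (?g A \<phi>) (insert j J) + attached T A \<phi> []) X) =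
      (\<Sum>B\<in>Pow A. \<Sum>\<psi>\<in>B \<rightarrow>\<^sub>E verts (ss ! j). \<Sum>\<chi>\<in>(A - B) \<rightarrow>\<^sub>E ?V J.
        \<Sum>u\<in>#X. tree_isos (graft_class (ss ! j) (attached T B \<psi>)) u *
          forest_isos (indexed_forest (?g (A - B) \<chi>) J + attached T (A - B) \<chi> []) (X - {#u#}))"
      unfolding split
    proof (subst sum_PiE_split[OF \<open>finite A\<close>])
      show "(#) j ` verts (ss ! j) \<inter> ?V J = {}"
        using insert.hyps by auto
      show "inj_on ((#) j) (verts (ss ! j))"
        by simp
      show "finite (verts (ss ! j))" "finite (?V J)"
        using insert.hyps by (simp_all add: finite_verts)
    qed (intro sum.cong refl summand; assumption)
    also have "\<dots> = (\<Sum>u\<in>#X. \<Sum>B\<in>Pow A.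
        (\<Sum>\<psi>\<in>B \<rightarrow>\<^sub>E verts (ss ! j). tree_isos (graft_class (ss ! j) (attached T B \<psi>)) u) *
        (\<Sum>\<chi>\<in>(A - B) \<rightarrow>\<^sub>E ?V J.
          forest_isos (indexed_forest (?g (A - B) \<chi>) J + attached T (A - B) \<chi> []) (X - {#u#})))"
      unfolding sum_product
      by (simp add: sum_sum_mset_swap)
    also have "\<dots> = (\<Sum>u\<in>#X. \<Sum>B\<in>Pow A.
        cut_sum (branches u) (\<lambda>P R. forest_isos (indexed_forest T B) P *
          tree_isos (iso_class (ss ! j)) (Node (root_label u) R)) *
        cut_sum (X - {#u#}) (\<lambda>P R. forest_isos (indexed_forest T (A - B)) P * forest_isos (?S J) R))"
    proof (intro arg_cong[where f = sum_mset] image_mset_cong sum.cong refl arg_cong2[where f = "(*)"])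
      fix u B
      assume "B \<in> Pow A"
      then have "finite B" "finite (A - B)"
        using \<open>finite A\<close> finite_subset by auto
      show "(\<Sum>\<psi>\<in>B \<rightarrow>\<^sub>E verts (ss ! j). tree_isos (graft_class (ss ! j) (attached T B \<psi>)) u) =
          cut_sum (branches u) (\<lambda>P R. forest_isos (indexed_forest T B) P *
            tree_isos (iso_class (ss ! j)) (Node (root_label u) R))"
        by (rule IH1[OF \<open>finite B\<close>])
      show "(\<Sum>\<chi>\<in>(A - B) \<rightarrow>\<^sub>E ?V J.
          forest_isos (indexed_forest (?g (A - B) \<chi>) J + attached T (A - B) \<chi> []) (X - {#u#})) =
          cut_sum (X - {#u#}) (\<lambda>P R. forest_isos (indexed_forest T (A - B)) P * forest_isos (?S J) R)"
        using insert.prems(1) by (intro IH2 \<open>finite (A - B)\<close>) simp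
    qed
    also have "\<dots> = (\<Sum>u\<in>#X. cut_sum (branches u) (\<lambda>P1 R1. cut_sum (X - {#u#}) (\<lambda>P2 R2.
        forest_isos (indexed_forest T A) (P1 + P2) *
        (tree_isos (iso_class (ss ! j)) (Node (root_label u) R1) * forest_isos (?S J) R2))))"
      by (simp add: cut_sum_prod flip: cut_sum_sum)
        (simp add: forest_isos_plus[OF \<open>finite A\<close>] sum_distrib_left sum_distrib_right mult_ac)
    also have "\<dots> = cut_sum X (\<lambda>P R. forest_isos (indexed_forest T A) P * forest_isos (?S (insert j J)) R)"
      using insert.hyps
      using cut_sum_kept_branch[of X "\<lambda>P r R. forest_isos (indexed_forest T A) P *
        (tree_isos (iso_class (ss ! j)) r * forest_isos (?S J) R)"]
      by (simp add: forest_isos_add_mset sum_mset_distrib_left)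
    finally show ?case .
  qed
  have "(\<Sum>\<phi>\<in>A \<rightarrow>\<^sub>E verts s. tree_isos (graft_class s (attached T A \<phi>)) U) =
     (if a = b then \<Sum>\<phi>\<in>A \<rightarrow>\<^sub>E ?V {..<length ss}.
        forest_isos (indexed_forest (?g A \<phi>) {..<length ss} + attached T A \<phi> []) X else 0)"
    by (simp add: s U)
  also have "\<dots> = cut_sum (branches U) (\<lambda>P R. forest_isos (indexed_forest T A) P *
      tree_isos (iso_class s) (Node (root_label U) R))"
    using \<open>finite A\<close> by (simp add: * s U mset_map_nth)
  finally show ?case .
qed

text \<open>Since \<open>tree_isos X U\<close> is \<open>aut U\<close> if \<open>X = U\<close> and zero otherwise, summing it over all graftings counts
  the term \<open>U\<close>, up to the factor \<open>aut U\<close>.\<close>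

lemma count_gl_terms:
  "count (gl_terms T S) U * aut U =
    aut T * aut S * cut_sum (branches U)
      (\<lambda>P R. if P = branches T \<and> Node (root_label U) R = S then 1 else 0)"
proof -
  define ts s m where "ts = pbranches (planar T)" and "s = planar S" and "m = length ts"
  define X where "X = (\<lambda>\<phi>. iso_class (graft s (\<lambda>v. map ((!) ts) (filter (\<lambda>i. \<phi> i = v) [0..<m]))))"
  have "T = iso_class (PNode (proot_label (planar T)) ts)"
    by (simp add: ts_def)
  from arg_cong[OF this, of branches] have T: "branches T = indexed_forest (\<lambda>i. iso_class (ts ! i)) {..<m}"
    by (simp add: m_def mset_map_nth)
  have X: "X \<phi> = graft_class s (attached (\<lambda>i. iso_class (ts ! i)) {..<m} \<phi>)" for \<phi>
  proof -
    have "mset (filter (\<lambda>i. \<phi> i = v) [0..<m]) = mset_set {i \<in> {..<m}. \<phi> i = v}" for v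
      by (simp add: atLeast0LessThan)
    then show ?thesis
      by (simp add: X_def iso_class_graft image_mset.compositionality comp_def flip: mset_filter)
  qed
  have fin: "finite ({..<m} \<rightarrow>\<^sub>E verts s)"
    by (simp add: finite_PiE finite_verts)
  have "count (gl_terms T S) U = (\<Sum>\<phi>\<in>{..<m} \<rightarrow>\<^sub>E verts s. if X \<phi> = U then 1 else 0)"
  proof -
    have "gl_terms T S = image_mset X (mset_set ({..<m} \<rightarrow>\<^sub>E verts s))"
      by (simp add: gl_terms_def Let_def ts_def s_def m_def X_def)
    moreover have "count (image_mset X M) U = (\<Sum>\<phi>\<in>#M. if X \<phi> = U then 1 else 0)" for M
      by (induction M) auto
    ultimately show ?thesis
      by (simp add: sum_unfold_sum_mset)
  qed
  then have "count (gl_terms T S) U * aut U = (\<Sum>\<phi>\<in>{..<m} \<rightarrow>\<^sub>E verts s. tree_isos (X \<phi>) U)"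
    by (simp only: sum_distrib_right) (intro sum.cong refl, simp add: tree_isos_def)
  also have "\<dots> = cut_sum (branches U) (\<lambda>P R. forest_isos (branches T) P *
      tree_isos S (Node (root_label U) R))"
    unfolding X T by (subst sum_graftings) (simp_all add: s_def)
  also have "\<dots> = cut_sum (branches U) (\<lambda>P R. aut T * aut S *
      (if P = branches T \<and> Node (root_label U) R = S then 1 else 0))"
    by (intro cut_sum_cong) (cases T, auto simp: forest_isos_def tree_isos_def)
  finally show ?thesis
    by (simp add: cut_sum_mult_left)
qed

section \<open>Counting automorphisms of planar trees\<close>

definition bijections :: "'i set \<Rightarrow> 'j set \<Rightarrow> ('i \<Rightarrow> 'j) set" where
  "bijections A B = {\<sigma> \<in> A \<rightarrow>\<^sub>E B. bij_betw \<sigma> A B}"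

lemma finite_bijections: "finite A \<Longrightarrow> finite B \<Longrightarrow> finite (bijections A B)"
  by (simp add: bijections_def finite_PiE)

text \<open>A bijection from \<open>insert a A\<close> is given by the image \<open>b\<close> of \<open>a\<close> and a bijection from \<open>A\<close> to the rest.\<close>

lemma sum_bijections_insert:
  assumes "finite A" "finite B" "a \<notin> A"
  shows "(\<Sum>\<sigma>\<in>bijections (insert a A) B. g \<sigma>) = (\<Sum>b\<in>B. \<Sum>\<sigma>\<in>bijections A (B - {b}). g (\<sigma>(a := b)))"
proof -
  have "(\<Sum>b\<in>B. \<Sum>\<sigma>\<in>bijections A (B - {b}). g (\<sigma>(a := b))) =
      (\<Sum>(b, \<sigma>)\<in>(SIGMA b:B. bijections A (B - {b})). g (\<sigma>(a := b)))"
    using assms by (simp add: sum.Sigma finite_bijections)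
  also have "\<dots> = (\<Sum>\<sigma>\<in>bijections (insert a A) B. g \<sigma>)"
  proof (rule sum.reindex_bij_witness[of _ "\<lambda>\<sigma>. (\<sigma> a, \<sigma>(a := undefined))" "\<lambda>(b, \<sigma>). \<sigma>(a := b)"])
    fix x
    assume x: "x \<in> (SIGMA b:B. bijections A (B - {b}))"
    obtain b \<sigma> where [simp]: "x = (b, \<sigma>)"
      by fastforce
    have b: "b \<in> B" and \<sigma>: "\<sigma> \<in> A \<rightarrow>\<^sub>E B - {b}" and bij: "bij_betw \<sigma> A (B - {b})"
      using x by (auto simp: bijections_def)
    have "bij_betw (\<sigma>(a := b)) A (B - {b})"
      using bij by (rule bij_betw_cong[THEN iffD1, rotated]) (use assms(3) in auto)
    then have "bij_betw (\<sigma>(a := b)) (insert a A) (B - {b} \<union> {b})"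
      using notIn_Un_bij_betw[of a A "\<sigma>(a := b)" "B - {b}"] assms(3) by simp
    then have "bij_betw (\<sigma>(a := b)) (insert a A) B"
      using b by (simp add: insert_absorb)
    moreover have "\<sigma>(a := b) \<in> insert a A \<rightarrow>\<^sub>E B"
      using b \<sigma> by (auto simp: PiE_def extensional_def)
    ultimately show "(case x of (b, \<sigma>) \<Rightarrow> \<sigma>(a := b)) \<in> bijections (insert a A) B"
      by (simp add: bijections_def)
    show "((case x of (b, \<sigma>) \<Rightarrow> \<sigma>(a := b)) a, (case x of (b, \<sigma>) \<Rightarrow> \<sigma>(a := b))(a := undefined)) = x"
      using PiE_arb[OF \<sigma> assms(3)] by (auto simp: fun_eq_iff)
  next
    fix \<sigma>
    assume "\<sigma> \<in> bijections (insert a A) B"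
    then have \<sigma>: "\<sigma> \<in> insert a A \<rightarrow>\<^sub>E B" and bij: "bij_betw \<sigma> (insert a A) B"
      by (auto simp: bijections_def)
    have "bij_betw \<sigma> A (B - {\<sigma> a})"
      using bij assms(3) by (auto simp: bij_betw_def inj_on_def)
    then have "bij_betw (\<sigma>(a := undefined)) A (B - {\<sigma> a})"
      by (rule bij_betw_cong[THEN iffD1, rotated]) (use assms(3) in auto)
    moreover from this have "\<sigma>(a := undefined) \<in> A \<rightarrow>\<^sub>E B - {\<sigma> a}"
      using PiE_arb[OF \<sigma>] bij_betwE by fastforce
    ultimately show "(\<sigma> a, \<sigma>(a := undefined)) \<in> (SIGMA b:B. bijections A (B - {b}))"
      using \<sigma> by (auto simp: bijections_def)
  qed auto
  finally show ?thesis ..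
qed

text \<open>Both sides obey the same expansion along the image of one element, by \<open>sum_bijections_insert\<close> and
  \<open>forest_isos_add_mset\<close>.\<close>

lemma sum_bijections_tree_isos:
  assumes "finite A" "finite B"
  shows "(\<Sum>\<sigma>\<in>bijections A B. \<Prod>i\<in>A. tree_isos (f i) (g (\<sigma> i))) =
    forest_isos (indexed_forest f A) (indexed_forest g B)"
  using assms
proof (induction A arbitrary: B rule: finite_induct)
  case empty
  have *: "bijections {} B = (if B = {} then {\<lambda>_. undefined} else {})"
    by (auto simp: bijections_def bij_betw_def)
  show ?case
    using empty by (simp add: * forest_isos_empty mset_set_empty_iff)
next
  case (insert a A)
  have "(\<Sum>\<sigma>\<in>bijections (insert a A) B. \<Prod>i\<in>insert a A. tree_isos (f i) (g (\<sigma> i))) =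
      (\<Sum>b\<in>B. \<Sum>\<sigma>\<in>bijections A (B - {b}). tree_isos (f a) (g b) * (\<Prod>i\<in>A. tree_isos (f i) (g (\<sigma> i))))"
    using insert.hyps insert.prems
    by (subst sum_bijections_insert) (auto intro!: sum.cong prod.cong arg_cong2[where f = "(*)"])
  also have "\<dots> = (\<Sum>b\<in>B. tree_isos (f a) (g b) *
      forest_isos (indexed_forest f A) (indexed_forest g B - {#g b#}))"
    using insert.prems by (intro sum.cong) (simp_all add: insert.IH image_mset_Diff mset_set_Diff flip: sum_distrib_left)
  also have "\<dots> = forest_isos (indexed_forest f (insert a A)) (indexed_forest g B)"
    using insert.hyps by (simp add: forest_isos_add_mset sum_unfold_sum_mset image_mset.compositionality comp_def)
  finally show ?case .
qed

lemma verts_Node [simp]: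
  "[] \<in> verts t"
  "i # v \<in> verts (PNode a ts) \<longleftrightarrow> i < length ts \<and> v \<in> verts (ts ! i)"
  by (cases t) auto

declare verts.simps [simp del]

lemma verts_butlast: "v \<in> verts t \<Longrightarrow> butlast v \<in> verts t"
proof (induction t arbitrary: v rule: verts.induct)
  case (1 a ts)
  then show ?case
    by (cases v) auto
qed

text \<open>Isomorphisms of planar trees as rooted labeled trees, the order of branches being ignored. They are
  normalized to \<open>undefined\<close> outside the vertices, so that they can be decomposed into extensional
  functions on the branches, whereas automorphisms in the sense of \<open>permutes\<close> are the identity there.\<close>

definition isos :: "'a ptree \<Rightarrow> 'a ptree \<Rightarrow> (nat list \<Rightarrow> nat list) set" where
  "isos t u = {\<phi> \<in> bijections (verts t) (verts u). \<phi> [] = [] \<and>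
     (\<forall>v\<in>verts t - {[]}. \<phi> (butlast v) = butlast (\<phi> v)) \<and>
     (\<forall>v\<in>verts t. vert_label u (\<phi> v) = vert_label t v)}"

lemma card_automorphisms: "card (automorphisms t) = card (isos t t)"
proof (rule bij_betw_same_card)
  let ?V = "verts t"
  show "bij_betw (\<lambda>\<phi>. restrict \<phi> ?V) (automorphisms t) (isos t t)"
  proof (rule bij_betw_byWitness[where f' = "\<lambda>\<phi> v. if v \<in> ?V then \<phi> v else v"])
    show "\<forall>\<phi>\<in>automorphisms t. (\<lambda>v. if v \<in> ?V then restrict \<phi> ?V v else v) = \<phi>"
      by (auto simp: automorphisms_def fun_eq_iff permutes_not_in)
    show "\<forall>\<phi>\<in>isos t t. restrict (\<lambda>v. if v \<in> ?V then \<phi> v else v) ?V = \<phi>"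
      by (auto simp: isos_def bijections_def fun_eq_iff PiE_def extensional_def)
    show "(\<lambda>\<phi>. restrict \<phi> ?V) ` automorphisms t \<subseteq> isos t t"
    proof safe
      fix \<phi>
      assume \<phi>: "\<phi> \<in> automorphisms t"
      then have "\<phi> permutes ?V"
        by (simp add: automorphisms_def)
      then have bij: "bij_betw (restrict \<phi> ?V) ?V ?V"
        using bij_betw_restrict_eq permutes_imp_bij by blast
      then have "restrict \<phi> ?V \<in> bijections ?V ?V"
        using bij_betwE by (fastforce simp: bijections_def)
      with \<phi> show "restrict \<phi> ?V \<in> isos t t"
        by (auto simp: isos_def automorphisms_def verts_butlast)
    qed
    show "(\<lambda>\<phi> v. if v \<in> ?V then \<phi> v else v) ` isos t t \<subseteq> automorphisms t"
    proof safe
      fix \<phi>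
      assume \<phi>: "\<phi> \<in> isos t t"
      then have "bij_betw \<phi> ?V ?V"
        by (simp add: isos_def bijections_def)
      then have "bij_betw (\<lambda>v. if v \<in> ?V then \<phi> v else v) ?V ?V"
        by (rule bij_betw_cong[THEN iffD1, rotated]) auto
      then have "(\<lambda>v. if v \<in> ?V then \<phi> v else v) permutes ?V"
        by (rule bij_imp_permutes) simp
      with \<phi> show "(\<lambda>v. if v \<in> ?V then \<phi> v else v) \<in> automorphisms t"
        by (auto simp: isos_def automorphisms_def verts_butlast)
    qed
  qed
qed

text \<open>As an isomorphism \<open>\<phi>\<close> respects parents, it maps the children of the root to children of the root, which
  defines \<open>\<sigma>\<close>, and all of the branch \<open>i\<close> to the branch \<open>\<sigma> i\<close>, which defines \<open>\<psi> i\<close>.\<close>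

lemma isos_PNode_decompose:
  assumes \<phi>: "\<phi> \<in> isos (PNode a ts) (PNode b us)"
  defines "\<sigma> \<equiv> restrict (\<lambda>i. hd (\<phi> [i])) {..<length ts}"
  defines "\<psi> \<equiv> restrict (\<lambda>i. restrict (\<lambda>w. tl (\<phi> (i # w))) (verts (ts ! i))) {..<length ts}"
  shows "\<sigma> \<in> bijections {..<length ts} {..<length us}"
    and "\<psi> \<in> (\<Pi>\<^sub>E i\<in>{..<length ts}. isos (ts ! i) (us ! \<sigma> i))"
    and "i < length ts \<Longrightarrow> w \<in> verts (ts ! i) \<Longrightarrow> \<phi> (i # w) = \<sigma> i # \<psi> i w"
proof -
  let ?T = "PNode a ts" and ?U = "PNode b us"
  have bij: "bij_betw \<phi> (verts ?T) (verts ?U)" and root: "\<phi> [] = []"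
    and parent: "\<And>v. v \<in> verts ?T \<Longrightarrow> v \<noteq> [] \<Longrightarrow> \<phi> (butlast v) = butlast (\<phi> v)"
    and label: "\<And>v. v \<in> verts ?T \<Longrightarrow> vert_label ?U (\<phi> v) = vert_label ?T v"
    using \<phi> by (auto simp: isos_def bijections_def)
  have inj: "\<phi> v = \<phi> w \<Longrightarrow> v = w" if "v \<in> verts ?T" "w \<in> verts ?T" for v w
    using bij that by (auto simp: bij_betw_def inj_on_def)
  have mem: "\<phi> v \<in> verts ?U" if "v \<in> verts ?T" for v
    using bij_betwE[OF bij] that by blast
  have nonempty: "\<phi> v \<noteq> []" if "v \<in> verts ?T" "v \<noteq> []" for v
    using inj[of v "[]"] root that by auto
  have child: "\<phi> [i] = [\<sigma> i]" if "i < length ts" for i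
  proof -
    have "butlast (\<phi> [i]) = []"
      using parent[of "[i]"] root that by simp
    then show ?thesis
      using nonempty[of "[i]"] that by (cases "\<phi> [i]") (auto simp: \<sigma>_def split: if_splits)
  qed
  \<comment> \<open>The first entry of \<open>\<phi> (i # w)\<close> is inherited from the parent, so it is that of \<open>\<phi> [i]\<close>.\<close>
  have hd: "hd (\<phi> (i # w)) = \<sigma> i" if "i < length ts" "w \<in> verts (ts ! i)" for i w
    using that(2)
  proof (induction w rule: rev_induct)
    case Nil
    then show ?case
      using child that(1) by simp
  next
    case (snoc x w)
    have w: "w \<in> verts (ts ! i)"
      using verts_butlast[OF snoc.prems] by simp
    have "\<phi> (i # w) = butlast (\<phi> (i # w @ [x]))"
      using parent[of "i # w @ [x]"] snoc.prems that(1) by (simp add: butlast_append)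
    moreover have "\<phi> (i # w) \<noteq> []"
      using nonempty w that(1) by simp
    ultimately show ?case
      using snoc.IH[OF w] by (cases "\<phi> (i # w @ [x])") (auto split: if_splits)
  qed
  show dec: "\<phi> (i # w) = \<sigma> i # \<psi> i w" if "i < length ts" "w \<in> verts (ts ! i)" for i w
    using hd[OF that] nonempty[of "i # w"] that by (cases "\<phi> (i # w)") (auto simp: \<psi>_def)
  have \<sigma>_less: "\<sigma> i < length us" if "i < length ts" for i
    using mem[of "[i]"] child[OF that] that by simp
  have \<sigma>_inj: "i = j" if "\<sigma> i = \<sigma> j" "i < length ts" "j < length ts" for i j
    using inj[of "[i]" "[j]"] child that by simp
  have \<sigma>_surj: "\<exists>i<length ts. \<sigma> i = j" if "j < length us" for j
  proof -
    have "[j] \<in> \<phi> ` verts ?T"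
      using bij that by (simp add: bij_betw_def)
    then obtain v where v: "v \<in> verts ?T" "\<phi> v = [j]"
      by auto
    then obtain i w where [simp]: "v = i # w" and i: "i < length ts" "w \<in> verts (ts ! i)"
      using root by (cases v) auto
    have "\<phi> (butlast v) = \<phi> []"
      using parent[OF v(1)] v root by simp
    then have "butlast v = []"
      using inj verts_butlast v(1) verts_Node(1) by blast
    then show ?thesis
      using i v child by (auto split: if_splits)
  qed
  have "bij_betw \<sigma> {..<length ts} {..<length us}"
    unfolding bij_betw_def using \<sigma>_less \<sigma>_inj \<sigma>_surj by (fastforce simp: inj_on_def image_iff)
  then show "\<sigma> \<in> bijections {..<length ts} {..<length us}"
    using \<sigma>_less by (auto simp: bijections_def \<sigma>_def)
  have "\<psi> i \<in> isos (ts ! i) (us ! \<sigma> i)" if i: "i < length ts" for i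
  proof -
    have bij\<psi>: "bij_betw (\<psi> i) (verts (ts ! i)) (verts (us ! \<sigma> i))"
      unfolding bij_betw_def
    proof
      show "inj_on (\<psi> i) (verts (ts ! i))"
      proof (rule inj_onI)
        fix v w
        assume "v \<in> verts (ts ! i)" "w \<in> verts (ts ! i)" "\<psi> i v = \<psi> i w"
        then show "v = w"
          using inj[of "i # v" "i # w"] dec[OF i] i by simp
      qed
      show "\<psi> i ` verts (ts ! i) = verts (us ! \<sigma> i)"
      proof safe
        fix w
        assume "w \<in> verts (ts ! i)"
        then show "\<psi> i w \<in> verts (us ! \<sigma> i)"
          using mem[of "i # w"] dec[OF i] i by simp
      next
        fix w
        assume "w \<in> verts (us ! \<sigma> i)"
        then have "\<sigma> i # w \<in> \<phi> ` verts ?T"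
          using bij \<sigma>_less[OF i] by (simp add: bij_betw_def)
        then obtain v where v: "v \<in> verts ?T" "\<phi> v = \<sigma> i # w"
          by auto
        then obtain j x where [simp]: "v = j # x" and j: "j < length ts" "x \<in> verts (ts ! j)"
          using root by (cases v) auto
        have "\<sigma> j = \<sigma> i" "\<psi> j x = w"
          using v dec[OF j] by simp_all
        then show "w \<in> \<psi> i ` verts (ts ! i)"
          using \<sigma>_inj i j by blast
      qed
    qed
    have ext: "\<psi> i \<in> bijections (verts (ts ! i)) (verts (us ! \<sigma> i))"
      using bij\<psi> bij_betwE[OF bij\<psi>] i by (auto simp: bijections_def \<psi>_def)
    have "\<psi> i (butlast w) = butlast (\<psi> i w)" if "w \<in> verts (ts ! i)" "w \<noteq> []" for w
      using parent[of "i # w"] dec[OF i that(1)] dec[OF i verts_butlast[OF that(1)]] that i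
        child[OF i] by (auto split: if_splits)
    moreover have "vert_label (us ! \<sigma> i) (\<psi> i w) = vert_label (ts ! i) w" if "w \<in> verts (ts ! i)" for w
      using label[of "i # w"] dec[OF i that] i that by simp
    moreover have "\<psi> i [] = []"
      using dec[OF i, of "[]"] child[OF i] by simp
    ultimately show ?thesis
      using ext by (simp add: isos_def)
  qed
  then show "\<psi> \<in> (\<Pi>\<^sub>E i\<in>{..<length ts}. isos (ts ! i) (us ! \<sigma> i))"
    by (auto simp: \<psi>_def)
qed

lemma isos_PNode_assemble:
  assumes \<sigma>: "\<sigma> \<in> bijections {..<length ts} {..<length us}"
    and \<psi>: "\<And>i. i < length ts \<Longrightarrow> \<psi> i \<in> isos (ts ! i) (us ! \<sigma> i)"
  shows "restrict (\<lambda>v. case v of [] \<Rightarrow> [] | i # w \<Rightarrow> \<sigma> i # \<psi> i w) (verts (PNode a ts)) \<in>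
    isos (PNode a ts) (PNode a us)" (is "?\<phi> \<in> _")
proof -
  let ?T = "PNode a ts" and ?U = "PNode a us"
  have \<sigma>_less: "\<sigma> i < length us" if "i < length ts" for i
    using \<sigma> that by (auto simp: bijections_def)
  have \<sigma>_inj: "i = j" if "\<sigma> i = \<sigma> j" "i < length ts" "j < length ts" for i j
    using \<sigma> that by (auto simp: bijections_def bij_betw_def inj_on_def)
  have \<psi>_bij: "bij_betw (\<psi> i) (verts (ts ! i)) (verts (us ! \<sigma> i))" if "i < length ts" for i
    using \<psi>[OF that] by (simp add: isos_def bijections_def)
  define \<phi> where "\<phi> = ?\<phi>"
  have Nil: "\<phi> [] = []"
    by (simp add: \<phi>_def)
  have Cons: "\<phi> (i # w) = \<sigma> i # \<psi> i w" if "i < length ts" "w \<in> verts (ts ! i)" for i w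
    using that by (simp add: \<phi>_def)
  have T_cases: "v = [] \<or> (\<exists>i w. v = i # w \<and> i < length ts \<and> w \<in> verts (ts ! i))"
    if "v \<in> verts ?T" for v
    using that by (cases v) auto
  have mem: "\<phi> v \<in> verts ?U" if "v \<in> verts ?T" for v
    using T_cases[OF that] \<sigma>_less bij_betwE[OF \<psi>_bij] by (auto simp: Nil Cons)
  have "inj_on \<phi> (verts ?T)"
  proof (rule inj_onI)
    fix v w
    assume v: "v \<in> verts ?T" and w: "w \<in> verts ?T" and eq: "\<phi> v = \<phi> w"
    show "v = w"
    proof (cases "v = [] \<or> w = []")
      case True
      then show ?thesis
        using T_cases[OF v] T_cases[OF w] eq by (auto simp: Nil Cons)
    next
      case False
      then obtain i x j y where vw: "v = i # x" "w = j # y"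
        and i: "i < length ts" "x \<in> verts (ts ! i)" and j: "j < length ts" "y \<in> verts (ts ! j)"
        using T_cases[OF v] T_cases[OF w] by auto
      have "\<sigma> i = \<sigma> j" "\<psi> i x = \<psi> j y"
        using eq vw Cons[OF i] Cons[OF j] by simp_all
      moreover from this have "i = j"
        using \<sigma>_inj i j by blast
      ultimately show ?thesis
        using \<psi>_bij[OF i(1)] i j vw by (auto simp: bij_betw_def inj_on_eq_iff)
    qed
  qed
  moreover have "v \<in> \<phi> ` verts ?T" if "v \<in> verts ?U" for v
  proof (cases v)
    case Nil
    then show ?thesis
      using \<open>\<phi> [] = []\<close> by (metis imageI verts_Node(1))
  next
    case (Cons j w)
    then have "j \<in> \<sigma> ` {..<length ts}"
      using that \<sigma> by (simp add: bijections_def bij_betw_def)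
    then obtain i where i: "i < length ts" "\<sigma> i = j"
      by auto
    then have "w \<in> \<psi> i ` verts (ts ! i)"
      using that Cons \<psi>_bij[OF i(1)] by (simp add: bij_betw_def)
    then obtain x where x: "x \<in> verts (ts ! i)" "w = \<psi> i x"
      by auto
    then have "\<phi> (i # x) = v"
      using i Cons \<open>\<And>i w. i < length ts \<Longrightarrow> w \<in> verts (ts ! i) \<Longrightarrow> \<phi> (i # w) = \<sigma> i # \<psi> i w\<close> by simp
    then show ?thesis
      using i x by (metis imageI verts_Node(2))
  qed
  ultimately have "bij_betw \<phi> (verts ?T) (verts ?U)"
    using mem by (auto simp: bij_betw_def)
  moreover have "\<phi> \<in> verts ?T \<rightarrow>\<^sub>E verts ?U"
    using mem by (auto simp: \<phi>_def)
  ultimately have bij: "\<phi> \<in> bijections (verts ?T) (verts ?U)"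
    by (simp add: bijections_def)
  have "\<phi> (butlast v) = butlast (\<phi> v)" if v: "v \<in> verts ?T" "v \<noteq> []" for v
  proof -
    obtain i w where vw: "v = i # w" and i: "i < length ts" "w \<in> verts (ts ! i)"
      using T_cases[OF v(1)] v(2) by blast
    have root: "\<psi> i [] = []"
      using \<psi>[OF i(1)] by (simp add: isos_def)
    show ?thesis
    proof (cases "w = []")
      case True
      then show ?thesis
        using vw i by (simp add: Nil Cons root)
    next
      case False
      then have "\<psi> i w \<noteq> \<psi> i []"
        using \<psi>_bij[OF i(1)] i(2) False by (auto simp: bij_betw_def inj_on_eq_iff)
      moreover have "\<psi> i (butlast w) = butlast (\<psi> i w)"
        using \<psi>[OF i(1)] i(2) False by (simp add: isos_def)
      ultimately show ?thesis
        using vw i False verts_butlast[OF i(2)] by (simp add: Cons root)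
    qed
  qed
  moreover have "vert_label ?U (\<phi> v) = vert_label ?T v" if v: "v \<in> verts ?T" for v
  proof (cases "v = []")
    case False
    then obtain i w where vw: "v = i # w" and i: "i < length ts" "w \<in> verts (ts ! i)"
      using T_cases[OF v] by blast
    then show ?thesis
      using \<psi>[OF i(1)] by (simp add: Cons isos_def)
  qed (simp add: Nil)
  ultimately show ?thesis
    using bij Nil by (simp add: isos_def \<phi>_def[symmetric])
qed

lemma card_isos_PNode:
  "card (isos (PNode a ts) (PNode b us)) =
    (if a = b then \<Sum>\<sigma>\<in>bijections {..<length ts} {..<length us}.
        \<Prod>i<length ts. card (isos (ts ! i) (us ! \<sigma> i)) else 0)"
proof (cases "a = b")
  case False
  have "a = b" if "\<phi> \<in> isos (PNode a ts) (PNode b us)" for \<phi>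
  proof -
    have "\<phi> [] = []" "vert_label (PNode b us) (\<phi> []) = vert_label (PNode a ts) []"
      using that verts_Node(1)[of "PNode a ts"] unfolding isos_def by blast+
    then show ?thesis
      by simp
  qed
  with False have "isos (PNode a ts) (PNode b us) = {}"
    by blast
  with False show ?thesis
    by simp
next
  case [simp]: True
  let ?n = "length ts"
  let ?D = "SIGMA \<sigma>:bijections {..<?n} {..<length us}. \<Pi>\<^sub>E i\<in>{..<?n}. isos (ts ! i) (us ! \<sigma> i)"
  let ?join = "\<lambda>(\<sigma>, \<psi>). restrict (\<lambda>v. case v of [] \<Rightarrow> [] | i # w \<Rightarrow> \<sigma> i # \<psi> i w) (verts (PNode b ts))"
  let ?split = "\<lambda>\<phi>. (restrict (\<lambda>i. hd (\<phi> [i])) {..<?n},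
    restrict (\<lambda>i. restrict (\<lambda>w. tl (\<phi> (i # w))) (verts (ts ! i))) {..<?n})"
  have "bij_betw ?join ?D (isos (PNode b ts) (PNode b us))"
  proof (rule bij_betw_byWitness[where f' = ?split])
    have "?split (?join (\<sigma>, \<psi>)) = (\<sigma>, \<psi>)"
      if \<sigma>: "\<sigma> \<in> bijections {..<?n} {..<length us}"
        and \<psi>: "\<psi> \<in> (\<Pi>\<^sub>E i\<in>{..<?n}. isos (ts ! i) (us ! \<sigma> i))" for \<sigma> \<psi>
    proof -
      have "restrict (\<lambda>i. hd (?join (\<sigma>, \<psi>) [i])) {..<?n} = \<sigma>"
        using \<sigma> by (auto simp: fun_eq_iff bijections_def PiE_def extensional_def)
      moreover have "restrict (\<lambda>i. restrict (\<lambda>w. tl (?join (\<sigma>, \<psi>) (i # w))) (verts (ts ! i))) {..<?n} = \<psi>"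
      proof
        fix i
        show "restrict (\<lambda>i. restrict (\<lambda>w. tl (?join (\<sigma>, \<psi>) (i # w))) (verts (ts ! i))) {..<?n} i = \<psi> i"
        proof (cases "i < ?n")
          case True
          then have "\<psi> i \<in> extensional (verts (ts ! i))"
            using PiE_mem[OF \<psi>, of i] by (simp add: isos_def bijections_def PiE_def)
          with True show ?thesis
            by (auto simp: fun_eq_iff extensional_def)
        qed (use PiE_arb[OF \<psi>] in simp)
      qed
      ultimately show ?thesis
        by (simp only: prod.inject)
    qed
    then show "\<forall>x\<in>?D. ?split (?join x) = x"
      by blast
    show "\<forall>\<phi>\<in>isos (PNode b ts) (PNode b us). ?join (?split \<phi>) = \<phi>"
    proof
      fix \<phi>
      assume \<phi>: "\<phi> \<in> isos (PNode b ts) (PNode b us)"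
      show "?join (?split \<phi>) = \<phi>"
      proof
        fix v
        have "\<phi> [] = []" "\<phi> \<in> extensional (verts (PNode b ts))"
          using \<phi> by (auto simp: isos_def bijections_def PiE_def)
        then show "?join (?split \<phi>) v = \<phi> v"
          using isos_PNode_decompose(3)[OF \<phi>] 
          by (cases v) (auto simp: restrict_def extensional_def)
      qed
    qed
    show "?join ` ?D \<subseteq> isos (PNode b ts) (PNode b us)"
      using isos_PNode_assemble[of _ ts us _ b] by fastforce
    show "?split ` isos (PNode b ts) (PNode b us) \<subseteq> ?D"
      by (intro image_subsetI SigmaI isos_PNode_decompose(1,2))
  qed
  then have "card (isos (PNode b ts) (PNode b us)) = card ?D"
    by (simp add: bij_betw_same_card)
  also have "\<dots> = (\<Sum>\<sigma>\<in>bijections {..<?n} {..<length us}. \<Prod>i<?n. card (isos (ts ! i) (us ! \<sigma> i)))"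
    by (subst card_SigmaI) (auto simp: finite_bijections finite_PiE finite_verts isos_def card_PiE)
  finally show ?thesis
    by simp
qed

text \<open>The numbers of isomorphisms of planar trees satisfy the same recursion as those of their classes, by
  \<open>card_isos_PNode\<close> and \<open>sum_bijections_tree_isos\<close>.\<close>

lemma card_isos: "card (isos t u) = tree_isos (iso_class t) (iso_class u)"
proof (induction t arbitrary: u rule: measure_induct_rule[where f = size])
  case (less t)
  obtain a ts b us where t: "t = PNode a ts" and u: "u = PNode b us"
    by (metis ptree.exhaust)
  have "(\<Sum>\<sigma>\<in>bijections {..<length ts} {..<length us}. \<Prod>i<length ts. card (isos (ts ! i) (us ! \<sigma> i))) =
      (\<Sum>\<sigma>\<in>bijections {..<length ts} {..<length us}.
        \<Prod>i<length ts. tree_isos (iso_class (ts ! i)) (iso_class (us ! \<sigma> i)))"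
    by (intro sum.cong prod.cong refl less.IH) (simp add: t size_nth_ptree)
  then show ?case
    using sum_bijections_tree_isos[of "{..<length ts}" "{..<length us}"
      "\<lambda>i. iso_class (ts ! i)" "\<lambda>j. iso_class (us ! j)"]
    by (simp add: t u card_isos_PNode mset_map_nth)
qed

lemma num_auts_eq: "num_auts T = aut T"
  by (simp add: num_auts_def card_automorphisms card_isos tree_isos_def)

section \<open>Convolution of forms\<close>

definition conv :: "('a forest \<Rightarrow> rat) \<Rightarrow> ('a forest \<Rightarrow> rat) \<Rightarrow> 'a forest \<Rightarrow> rat" where
  "conv a b F = cut_sum F (\<lambda>P R. a P * b R)"

definition unit_form :: "'a forest \<Rightarrow> rat" where
  "unit_form F = (if F = {#} then 1 else 0)"

lemma conv_assoc: "conv (conv a b) c = conv a (conv b c)"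
  unfolding conv_def
  using cut_sum_coassoc[of _ "\<lambda>A B R. a A * (b B * c R)"]
  by (simp add: mult.assoc flip: cut_sum_mult_left cut_sum_mult_right)

lemma conv_unit_left [simp]: "conv unit_form a = a"
proof
  fix F
  have "conv unit_form a F = cut_sum F (\<lambda>P R. if P = {#} then a R else 0)"
    unfolding conv_def unit_form_def by (rule cut_sum_cong) simp
  then show "conv unit_form a F = a F"
    by (simp add: cut_sum_cut_empty)
qed

lemma conv_unit_right [simp]: "conv a unit_form = a"
proof
  fix F
  have "conv a unit_form F = cut_sum F (\<lambda>P R. if R = {#} then a P else 0)"
    unfolding conv_def unit_form_def by (rule cut_sum_cong) simp
  then show "conv a unit_form F = a F"
    by (simp add: cut_sum_kept_empty)
qed

text \<open>The inverse of the form that is constantly \<open>1\<close>, thus the form of \<open>f(-t)\<close>. For a tree \<open>C\<close> with the forest \<open>F\<close>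
  below its root, removing \<open>C\<close> contributes \<open>- unit_form F\<close> to the convolution, and the other cuts of \<open>C\<close>
  contribute the convolution at \<open>F\<close>, so that they cancel by induction.\<close>

definition antipode_form :: "'a forest \<Rightarrow> rat" where
  "antipode_form F = (if \<forall>C\<in>#F. branches C = {#} then (- 1) ^ size F else 0)"

lemma antipode_form_empty [simp]: "antipode_form {#} = 1"
  by (simp add: antipode_form_def)

lemma antipode_form_plus: "antipode_form (F + G) = antipode_form F * antipode_form G"
  by (auto simp: antipode_form_def power_add)

lemma antipode_form_add_mset:
  "antipode_form (add_mset (Node a F) G) = - unit_form F * antipode_form G"
  by (simp add: antipode_form_def unit_form_def)

lemma conv_antipode_left: "conv antipode_form (\<lambda>F. 1) = unit_form"
proof
  fix F :: "'a forest"
  show "conv antipode_form (\<lambda>F. 1) F = unit_form F"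
  proof (induction F rule: forest_induct)
    case (add a F G)
    then show ?case
      by (simp add: conv_def antipode_form_add_mset antipode_form_plus cut_sum_mult_left cut_sum_mult_right)
        (simp add: unit_form_def)
  qed (simp add: conv_def unit_form_def)
qed

lemma conv_antipode_right: "conv (\<lambda>F. 1) antipode_form = unit_form"
proof
  fix F :: "'a forest"
  show "conv (\<lambda>F. 1) antipode_form F = unit_form F"
  proof (induction F rule: forest_induct)
    case (add a F G)
    have "cut_sum F (\<lambda>P R. unit_form R) = 1"
      using cut_sum_kept_empty[of F "\<lambda>_. 1 :: rat"] by (simp add: unit_form_def)
    then have "cut_sum F (\<lambda>P R. unit_form R * x) = x" for x
      by (simp only: cut_sum_mult_right mult_1)
    then show ?case
      by (simp add: conv_def antipode_form_add_mset cut_sum_mult_left) (simp add: unit_form_def)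
  qed (simp add: conv_def unit_form_def)
qed

lemma size_leaves: "size (leaves T) > 0"
proof (induction T)
  case (Node a F)
  then show ?case
    by (cases F) auto
qed

text \<open>The form of \<open>h(t)\<close>. For the root label \<open>0\<close> and a nonempty forest, having a single leaf means being a chain.\<close>

definition leaf_form :: "nat forest \<Rightarrow> rat" where
  "leaf_form F = (if F \<noteq> {#} \<and> size (leaves (Node 0 F)) = 1 then of_nat (leaf_label (Node 0 F)) else 0)"

lemma leaf_form_empty [simp]: "leaf_form {#} = 0"
  by (simp add: leaf_form_def)

text \<open>The label of the leaf of a chain is that of its top vertex \<open>a\<close> if the chain ends there, and
  otherwise it is found in the rest \<open>R\<close>; \<open>leaf_form\<close> vanishes if \<open>R\<close> is empty, so the two cases can be added.\<close>

lemma leaf_form_add_mset: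
  "leaf_form (add_mset (Node a R) R') =
    (if R' = {#} then of_nat a * unit_form R + leaf_form R else 0)"
proof (cases R')
  case empty
  then show ?thesis
    by (auto simp: leaf_form_def leaf_label_def unit_form_def)
next
  case (add C G)
  then have "size (leaves (Node 0 (add_mset (Node a R) R'))) > 1"
    using size_leaves[of "Node a R"] size_leaves[of C] by simp
  with add show ?thesis
    by (simp add: leaf_form_def)
qed

lemma conv_leaf_form: "conv (\<lambda>F. 1) leaf_form F = of_nat (forest_weight F)"
proof (induction F rule: forest_induct)
  case (add a F G)
  have "cut_sum F (\<lambda>P R. unit_form R) = 1"
    using cut_sum_kept_empty[of F "\<lambda>_. 1 :: rat"] by (simp add: unit_form_def)
  with add show ?case
    by (simp add: conv_def leaf_form_add_mset cut_sum_kept_empty[of G "\<lambda>P. _"] cut_sum_distrib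
        cut_sum_mult_left)
qed (simp add: conv_def)

text \<open>Infinitesimal characters of the Hopf algebra of forests: \<open>infinitesimal_plus\<close> is the derivation property.\<close>

definition infinitesimal :: "('a forest \<Rightarrow> rat) \<Rightarrow> bool" where
  "infinitesimal a \<longleftrightarrow> (\<forall>F. size F \<noteq> 1 \<longrightarrow> a F = 0)"

lemma infinitesimal_plus:
  assumes "infinitesimal a"
  shows "a (F + G) = a F * unit_form G + unit_form F * a G"
proof (cases "F = {#} \<or> G = {#}")
  case True
  have "a {#} = 0"
    using assms by (simp add: infinitesimal_def)
  then show ?thesis
    using True by (auto simp: unit_form_def)
next
  case False
  then have "size F > 0" "size G > 0"
    by (simp_all add: nonempty_has_size)
  then have "size (F + G) \<noteq> 1"
    by simp
  with False show ?thesis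
    using assms by (simp add: infinitesimal_def unit_form_def del: size_union)
qed

text \<open>Convolution with an infinitesimal form cuts off a single branch, either from \<open>F\<close> or from \<open>G\<close>, and so it
  acts on a decomposition of \<open>b\<close> by the Leibniz rule.\<close>

lemma conv_infinitesimal_plus:
  assumes "infinitesimal a" and "\<And>F G. b (F + G) = (\<Sum>i\<in>I. u i F * v i G)"
  shows "conv a b (F + G) = (\<Sum>i\<in>I. conv a (u i) F * v i G + u i F * conv a (v i) G)"
proof -
  have "conv a b (F + G) = cut_sum F (\<lambda>P R. cut_sum G (\<lambda>P' R'. \<Sum>i\<in>I.
      (a P * u i R) * (unit_form P' * v i R') + (unit_form P * u i R) * (a P' * v i R')))"
    by (simp add: conv_def cut_sum_plus assms(2) infinitesimal_plus[OF assms(1)] sum_distrib_left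
        algebra_simps sum.distrib)
  also have "\<dots> = (\<Sum>i\<in>I. conv a (u i) F * conv unit_form (v i) G +
      conv unit_form (u i) F * conv a (v i) G)"
    by (simp add: conv_def cut_sum_sum cut_sum_distrib cut_sum_mult_left cut_sum_mult_right
        del: conv_unit_left)
  finally show ?thesis
    by simp
qed

text \<open>The form of \<open>m(t)\<close>.\<close>

definition root_form :: "nat forest \<Rightarrow> rat" where
  "root_form F = (if size F = 1 then of_nat (child_label (Node 0 F)) else 0)"

lemma root_form_single: "root_form {#C#} = of_nat (root_label C)"
  by (simp add: root_form_def child_label_def)

lemma infinitesimal_root_form: "infinitesimal root_form"
  by (simp add: infinitesimal_def root_form_def)

lemma conv_root_form: "conv root_form (\<lambda>F. 1) F = of_nat (forest_weight F)"
proof (induction F rule: forest_induct)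
  case (add a F G)
  have "conv root_form (\<lambda>F. 1) {#Node a F#} = of_nat (weight (Node a F))"
    using add.IH(1) by (simp add: conv_def root_form_single)
  then show ?case
    using conv_infinitesimal_plus[OF infinitesimal_root_form, where b = "\<lambda>F. 1" and I = "{()}" and
        u = "\<lambda>_ F. 1" and v = "\<lambda>_ F. 1" and F = "{#Node a F#}" and G = G]
      add.IH(2) by simp
qed (simp add: conv_def root_form_def)

section \<open>Exponentials of infinitesimal forms\<close>

fun conv_pow :: "('a forest \<Rightarrow> rat) \<Rightarrow> nat \<Rightarrow> 'a forest \<Rightarrow> rat" where
  "conv_pow a 0 = unit_form"
| "conv_pow a (Suc k) = conv (conv_pow a k) a"

lemma conv_pow_Suc: "conv_pow a (Suc k) = conv a (conv_pow a k)"
  by (induction k) (simp_all add: conv_assoc)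

declare conv_pow.simps(2) [simp del]

text \<open>Each factor of the power cuts off at least one vertex. Therefore all exponential series are finite.\<close>

lemma conv_pow_eq_0:
  assumes "infinitesimal a" "k > forest_size F"
  shows "conv_pow a k F = 0"
  using assms(2)
proof (induction k arbitrary: F)
  case (Suc k)
  have "a P * conv_pow a k R = 0" if "(P, R) \<in># forest_cuts F" for P R
  proof (cases "size P = 1")
    case True
    then obtain C where "P = {#C#}"
      using size_1_singleton_mset by blast
    then have "forest_size P > 0"
      by (cases C) simp
    then have "k > forest_size R"
      using forest_size_cut[OF that] Suc.prems by simp
    then show ?thesis
      using Suc.IH by simp
  qed (use assms(1) in \<open>simp add: infinitesimal_def\<close>)
  then have "conv a (conv_pow a k) F = cut_sum F (\<lambda>P R. 0)"
    unfolding conv_def by (intro cut_sum_cong)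
  then show ?case
    by (simp add: conv_pow_Suc)
qed simp

definition divided_pow :: "('a forest \<Rightarrow> rat) \<Rightarrow> nat \<Rightarrow> 'a forest \<Rightarrow> rat" where
  "divided_pow a k F = conv_pow a k F / fact k"

lemma conv_divided_pow: "conv a (divided_pow a k) F = of_nat (Suc k) * divided_pow a (Suc k) F"
proof -
  have "conv a (divided_pow a k) F = conv a (conv_pow a k) F / fact k"
    unfolding conv_def divided_pow_def divide_inverse mult.assoc[symmetric] by (rule cut_sum_mult_right)
  then show ?thesis
    by (simp add: divided_pow_def conv_pow_Suc del: of_nat_Suc)
qed

text \<open>The binomial formula for divided powers. Multiplication with \<open>Suc n\<close> turns the left-hand side into a
  convolution with \<open>a\<close>, to which the Leibniz rule applies; the two sums that result carry the factors
  \<open>i\<close> and \<open>Suc n - i\<close>, which add up to \<open>Suc n\<close>.\<close>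

lemma divided_pow_plus:
  assumes "infinitesimal a"
  shows "divided_pow a n (F + G) = (\<Sum>i\<le>n. divided_pow a i F * divided_pow a (n - i) G)"
proof (induction n arbitrary: F G)
  case (Suc n)
  let ?d = "divided_pow a"
  \<comment> \<open>The factors \<open>Suc i\<close> and \<open>Suc n - i\<close> come from \<open>conv_divided_pow\<close>; shifting the index of the first sum aligns them.\<close>
  have "of_nat (Suc n) * ?d (Suc n) (F + G) = conv a (?d n) (F + G)"
    by (simp add: conv_divided_pow)
  also have "\<dots> = (\<Sum>i\<le>n. conv a (?d i) F * ?d (n - i) G + ?d i F * conv a (?d (n - i)) G)"
    by (rule conv_infinitesimal_plus[OF assms, where I = "{..n}" and u = ?d and v = "\<lambda>i. ?d (n - i)"])
      (rule Suc.IH)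
  also have "\<dots> = (\<Sum>i\<le>n. of_nat (Suc i) * (?d (Suc i) F * ?d (Suc n - Suc i) G)) +
      (\<Sum>i\<le>n. of_nat (Suc n - i) * (?d i F * ?d (Suc n - i) G))"
    by (simp add: sum.distrib conv_divided_pow mult_ac Suc_diff_le del: of_nat_Suc cong: sum.cong_simp)
  also have "\<dots> = (\<Sum>i\<le>Suc n. of_nat i * (?d i F * ?d (Suc n - i) G)) +
      (\<Sum>i\<le>Suc n. of_nat (Suc n - i) * (?d i F * ?d (Suc n - i) G))"
  proof -
    have "(\<Sum>i\<le>Suc n. of_nat i * (?d i F * ?d (Suc n - i) G)) =
        (\<Sum>i\<le>n. of_nat (Suc i) * (?d (Suc i) F * ?d (Suc n - Suc i) G))"
      by (subst sum.atMost_Suc_shift) simp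
    moreover have "(\<Sum>i\<le>Suc n. of_nat (Suc n - i) * (?d i F * ?d (Suc n - i) G)) =
        (\<Sum>i\<le>n. of_nat (Suc n - i) * (?d i F * ?d (Suc n - i) G))"
      by simp
    ultimately show ?thesis
      by simp
  qed
  also have "\<dots> = of_nat (Suc n) * (\<Sum>i\<le>Suc n. ?d i F * ?d (Suc n - i) G)"
    unfolding sum_distrib_left sum.distrib[symmetric]
    by (intro sum.cong) (simp_all flip: distrib_right of_nat_add)
  finally show ?case
    by (simp del: of_nat_Suc sum.atMost_Suc)
qed (simp add: divided_pow_def unit_form_def)

lemma divided_pow_eq_0: "infinitesimal a \<Longrightarrow> k > forest_size F \<Longrightarrow> divided_pow a k F = 0"
  by (simp add: divided_pow_def conv_pow_eq_0)

definition exp_form :: "('a forest \<Rightarrow> rat) \<Rightarrow> 'a forest \<Rightarrow> rat" where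
  "exp_form a F = (\<Sum>k\<le>forest_size F. divided_pow a k F)"

lemma exp_form_eq:
  assumes "infinitesimal a" "n \<ge> forest_size F"
  shows "(\<Sum>k\<le>n. divided_pow a k F) = exp_form a F"
  unfolding exp_form_def using assms
  by (intro sum.mono_neutral_right) (auto simp: divided_pow_eq_0)

text \<open>The Cauchy product of the two exponential series. The divided powers beyond the size of a forest
  vanish, so the triangle of indices can be replaced by a rectangle.\<close>

lemma exp_form_plus:
  assumes "infinitesimal a"
  shows "exp_form a (F + G) = exp_form a F * exp_form a G"
proof -
  let ?n = "forest_size F" and ?m = "forest_size G" and ?d = "divided_pow a"
  have le: "k \<le> forest_size H" if "?d k H \<noteq> 0" for k H
    using divided_pow_eq_0[OF assms] that not_le by blast
  have fin: "finite {(i, j). i + j \<le> ?n + ?m}"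
    by (rule finite_subset[of _ "{..?n + ?m} \<times> {..?n + ?m}"]) auto
  have "exp_form a (F + G) = (\<Sum>(i, j)\<in>{(i, j). i + j \<le> ?n + ?m}. ?d i F * ?d j G)"
    by (simp add: exp_form_def divided_pow_plus[OF assms] sum.triangle_reindex_eq)
  also have "\<dots> = (\<Sum>(i, j)\<in>{..?n} \<times> {..?m}. ?d i F * ?d j G)"
    by (rule sum.mono_neutral_right) (use fin in \<open>auto dest: le\<close>)
  also have "\<dots> = exp_form a F * exp_form a G"
    by (simp add: exp_form_def sum_product sum.cartesian_product)
  finally show ?thesis .
qed

lemma exp_form_eq_1:
  assumes "infinitesimal a" and "\<And>C. exp_form a {#C#} = 1"
  shows "exp_form a F = 1"
proof (induction F)
  case empty
  show ?case
    by (simp add: exp_form_def divided_pow_def unit_form_def)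
next
  case (add C F)
  then show ?case
    using exp_form_plus[OF assms(1), of "{#C#}" F] by (simp add: assms(2))
qed

section \<open>The constants theta\<close>

text \<open>A cut with a single branch is a cut at one edge, which is either the edge above a tree \<open>u\<close> of the forest,
  the root of the forest being imagined above all its trees, or an edge within \<open>u\<close>.\<close>

lemma cut_sum_single:
  fixes f :: "'a forest \<Rightarrow> 'a forest \<Rightarrow> 'b::comm_monoid_add"
  shows "cut_sum F (\<lambda>P R. if size P = 1 then f P R else 0) =
    (\<Sum>u\<in>#F. f {#u#} (F - {#u#}) + cut_sum (branches u)
      (\<lambda>P R. if size P = 1 then f P (add_mset (Node (root_label u) R) (F - {#u#})) else 0))"
proof (induction F arbitrary: f rule: forest_induct)
  case (add a F G)
  let ?C = "Node a F"
  have if_cut_sum: "cut_sum G (\<lambda>P R. if b then h P R else 0) = (if b then cut_sum G h else 0)"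
    for b and h :: "_ \<Rightarrow> _ \<Rightarrow> 'b"
    by simp
  have "cut_sum G (\<lambda>P R. if size (add_mset ?C P) = 1 then f (add_mset ?C P) R else 0) =
      cut_sum G (\<lambda>P R. if P = {#} then f {#?C#} R else 0)"
    by (intro cut_sum_cong) auto
  then have 1: "cut_sum G (\<lambda>P R. if size (add_mset ?C P) = 1 then f (add_mset ?C P) R else 0) = f {#?C#} G"
    by (simp only: cut_sum_cut_empty)
  have "cut_sum F (\<lambda>P R. cut_sum G (\<lambda>P' R'.
      if size (P + P') = 1 then f (P + P') (add_mset (Node a R) R') else 0)) =
    cut_sum F (\<lambda>P R. cut_sum G (\<lambda>P' R'.
      (if P' = {#} then if size P = 1 then f P (add_mset (Node a R) R') else 0 else 0) +
      (if P = {#} then if size P' = 1 then f P' (add_mset (Node a R) R') else 0 else 0)))"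
    by (intro cut_sum_cong) (auto simp: add_is_1)
  also have "\<dots> = cut_sum F (\<lambda>P R. if size P = 1 then f P (add_mset (Node a R) G) else 0) +
    cut_sum F (\<lambda>P R. if P = {#} then
      cut_sum G (\<lambda>P' R'. if size P' = 1 then f P' (add_mset (Node a R) R') else 0) else 0)"
    by (simp only: cut_sum_distrib cut_sum_cut_empty if_cut_sum)
  also have "\<dots> = cut_sum F (\<lambda>P R. if size P = 1 then f P (add_mset (Node a R) G) else 0) +
    cut_sum G (\<lambda>P R. if size P = 1 then f P (add_mset ?C R) else 0)"
    by (simp only: cut_sum_cut_empty)
  finally have 2: "cut_sum F (\<lambda>P R. cut_sum G (\<lambda>P' R'.
      if size (P + P') = 1 then f (P + P') (add_mset (Node a R) R') else 0)) = \<dots>" .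
  have "(\<Sum>u\<in>#G. f {#u#} (add_mset ?C G - {#u#}) + cut_sum (branches u)
      (\<lambda>P R. if size P = 1 then f P (add_mset (Node (root_label u) R) (add_mset ?C G - {#u#})) else 0)) =
    (\<Sum>u\<in>#G. f {#u#} (add_mset ?C (G - {#u#})) + cut_sum (branches u)
      (\<lambda>P R. if size P = 1 then f P (add_mset ?C (add_mset (Node (root_label u) R) (G - {#u#}))) else 0))"
  proof (intro arg_cong[where f = sum_mset] image_mset_cong)
    fix u
    assume "u \<in># G"
    then have "add_mset ?C G - {#u#} = add_mset ?C (G - {#u#})"
      by simp
    then show "f {#u#} (add_mset ?C G - {#u#}) + cut_sum (branches u)
        (\<lambda>P R. if size P = 1 then f P (add_mset (Node (root_label u) R) (add_mset ?C G - {#u#})) else 0) =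
      f {#u#} (add_mset ?C (G - {#u#})) + cut_sum (branches u)
        (\<lambda>P R. if size P = 1 then f P (add_mset ?C (add_mset (Node (root_label u) R) (G - {#u#}))) else 0)"
      by (simp only: add_mset_commute[of ?C])
  qed
  also have "\<dots> = cut_sum G (\<lambda>P R. if size P = 1 then f P (add_mset ?C R) else 0)"
    by (rule add.IH(2)[symmetric])
  finally show ?case
    unfolding cut_sum_add_mset 1 2 by (simp add: add.assoc cong: if_cong)
qed simp

text \<open>The set of paths \<open>V\<close> has the shape of \<open>T\<close>, the labels of \<open>T\<close> being arbitrary. The numbers of the
  children form any finite set \<open>I\<close>, because cutting an edge leaves gaps in the numbering.\<close>

inductive represents :: "nat list set \<Rightarrow> 'a tree \<Rightarrow> bool" where
  representsI: "finite I \<Longrightarrow> (\<And>i. i \<in> I \<Longrightarrow> represents (X i) (T i)) \<Longrightarrow>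
    represents (insert [] (\<Union>i\<in>I. (#) i ` X i)) (Node a (image_mset T (mset_set I)))"

lemma Cons_mem_root_union [simp]:
  "i # v \<in> insert [] (\<Union>i\<in>I. (#) i ` X i) \<longleftrightarrow> i \<in> I \<and> v \<in> X i"
  by auto

lemma represents_basic:
  assumes "represents V T"
  shows "[] \<in> V" "finite V" "\<And>u v. u @ v \<in> V \<Longrightarrow> u \<in> V" "card V = tree_size T"
    "card {v \<in> V. length v = 1} = size (branches T)"
proof -
  have "[] \<in> V \<and> finite V \<and> (\<forall>u v. u @ v \<in> V \<longrightarrow> u \<in> V) \<and> card V = tree_size T \<and>
    card {v \<in> V. length v = 1} = size (branches T)"
    using assms
  proof induction
    case (representsI I X T a)
    let ?V = "insert [] (\<Union>i\<in>I. (#) i ` X i)"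
    have "u \<in> ?V" if "u @ v \<in> ?V" for u v
      using that representsI.IH by (cases u) (simp, simp del: insert_iff UN_iff, blast)
    moreover have "card ?V = Suc (\<Sum>i\<in>I. card (X i))"
    proof -
      have "card (\<Union>i\<in>I. (#) i ` X i) = (\<Sum>i\<in>I. card ((#) i ` X i))"
        by (rule card_UN_disjoint) (use representsI.hyps representsI.IH in auto)
      moreover have "finite (\<Union>i\<in>I. (#) i ` X i)"
        using representsI.hyps representsI.IH by simp
      ultimately show ?thesis
        by (subst card_insert_disjoint) (auto simp: card_image)
    qed
    moreover have "{v \<in> ?V. length v = 1} = (\<lambda>i. [i]) ` I"
      using representsI.IH by (auto simp: image_iff)
    then have "card {v \<in> ?V. length v = 1} = card I"
      by (simp add: card_image inj_on_def)
    ultimately show ?case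
      using representsI.hyps representsI.IH
      by (auto simp: sum_unfold_sum_mset image_mset.compositionality comp_def intro!: arg_cong[where f = sum_mset] image_mset_cong)
  qed
  then show "[] \<in> V" "finite V" "\<And>u v. u @ v \<in> V \<Longrightarrow> u \<in> V" "card V = tree_size T"
    "card {v \<in> V. length v = 1} = size (branches T)"
    by auto
qed

lemma represents_rooted_tree_set: "represents V T \<Longrightarrow> rooted_tree_set V"
  using represents_basic(1,2,3) unfolding rooted_tree_set_def prefix_def by blast

lemma represents_verts: "represents (verts t) (iso_class t)"
proof (induction t rule: verts.induct)
  case (1 a ts)
  have "map iso_class ts = map (\<lambda>i. iso_class (ts ! i)) [0..<length ts]"
    by (rule nth_equalityI) simp_all
  then have "mset (map iso_class ts) = image_mset (\<lambda>i. iso_class (ts ! i)) (mset_set {..<length ts})"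
    by (metis mset_map mset_upt atLeast0LessThan)
  then show ?case
    using representsI[of "{..<length ts}" "\<lambda>i. verts (ts ! i)" "\<lambda>i. iso_class (ts ! i)" a] 1
    by (simp add: verts.simps)
qed

lemma represents_add_root:
  assumes "represents V T"
  shows "represents (add_root V) (Node a {#T#})"
  using representsI[of "{0}" "\<lambda>_. V" "\<lambda>_. T" a] assms by (simp add: add_root_def)

text \<open>Edges of a set of paths are cuts with a single branch of the tree it represents. Here \<open>q\<close> and \<open>f\<close> are
  an expression on sets of paths and its counterpart on trees.\<close>

lemma sum_edges:
  fixes q :: "nat list set \<Rightarrow> nat list set \<Rightarrow> 'b::comm_monoid_add"
  assumes "represents V T"
    and "\<And>A B C R. represents A C \<Longrightarrow> represents B (Node (root_label T) R) \<Longrightarrow> q A B = f {#C#} R"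
  shows "(\<Sum>e\<in>edges V. q (cut_branch e V) (cut_root e V)) =
    cut_sum (branches T) (\<lambda>P R. if size P = 1 then f P R else 0)"
  using assms
proof (induction arbitrary: q f)
  case (representsI I X T a)
  let ?V = "\<lambda>X. insert [] (\<Union>i\<in>I. (#) i ` X i)" and ?F = "image_mset T (mset_set I)"
  let ?rest = "\<lambda>i. insert [] (\<Union>j\<in>I - {i}. (#) j ` X j)"
  have X: "[] \<in> X i" "finite (X i)" if "i \<in> I" for i
    using represents_basic[OF representsI.hyps(2)[OF that]] by auto
  have edges: "edges (?V X) = (\<Union>i\<in>I. insert [i] ((#) i ` edges (X i)))"
    using X by (auto simp: edges_def)
  have root_cut: "cut_branch [i] (?V X) = X i" "cut_root [i] (?V X) = ?rest i" if "i \<in> I" for i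
  proof -
    show "cut_branch [i] (?V X) = X i"
      using that by (auto simp: cut_branch_def)
    have "v \<in> cut_root [i] (?V X) \<longleftrightarrow> v \<in> ?rest i" for v
      by (cases v) (auto simp: cut_root_def)
    then show "cut_root [i] (?V X) = ?rest i"
      by blast
  qed
  have deep_cut: "cut_branch (i # e) (?V X) = cut_branch e (X i)"
    "cut_root (i # e) (?V X) = ?V (X(i := cut_root e (X i)))" if "i \<in> I" for i e
  proof -
    show "cut_branch (i # e) (?V X) = cut_branch e (X i)"
      using that by (auto simp: cut_branch_def)
    have "v \<in> cut_root (i # e) (?V X) \<longleftrightarrow> v \<in> ?V (X(i := cut_root e (X i)))" for v
    proof (cases v)
      case (Cons j w)
      then show ?thesis
        unfolding cut_root_def mem_Collect_eq Cons Cons_mem_root_union by auto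
    qed (simp add: cut_root_def)
    then show "cut_root (i # e) (?V X) = ?V (X(i := cut_root e (X i)))"
      by blast
  qed
  have rest: "?F - {#T i#} = image_mset T (mset_set (I - {i}))" if "i \<in> I" for i
    using representsI.hyps(1) that by (simp add: mset_set_Diff image_mset_Diff)
  \<comment> \<open>Cutting an edge within the branch \<open>i\<close> replaces this branch by what is kept of it.\<close>
  have update: "represents (?V (X(i := B))) (Node a (add_mset C (?F - {#T i#})))"
    if "i \<in> I" "represents B C" for i B C
  proof -
    have "represents (?V (X(i := B))) (Node a (image_mset (T(i := C)) (mset_set I)))"
      by (rule represents.representsI) (use representsI.hyps that in auto)
    moreover have "image_mset (T(i := C)) (mset_set (insert i (I - {i}))) =
        add_mset C (image_mset T (mset_set (I - {i})))"
      using representsI.hyps(1) by (subst mset_set.insert) (auto intro!: image_mset_cong)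
    ultimately show ?thesis
      using that by (simp add: rest insert_absorb)
  qed
  have "(\<Sum>e\<in>edges (?V X). q (cut_branch e (?V X)) (cut_root e (?V X))) =
    (\<Sum>i\<in>I. q (X i) (?rest i) +
      (\<Sum>e\<in>edges (X i). q (cut_branch e (X i)) (?V (X(i := cut_root e (X i))))))"
  proof -
    have split: "sum g (\<Union>i\<in>I. insert [i] ((#) i ` edges (X i))) =
        (\<Sum>i\<in>I. g [i] + (\<Sum>e\<in>edges (X i). g (i # e)))" for g :: "nat list \<Rightarrow> 'b"
    proof -
      have "sum g (insert [i] ((#) i ` edges (X i))) = g [i] + (\<Sum>e\<in>edges (X i). g (i # e))"
        if "i \<in> I" for i
        using X[OF that] by (subst sum.insert) (auto simp: edges_def sum.reindex)
      then show ?thesis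
        using X representsI.hyps(1)
        by (subst sum.UNION_disjoint) (auto simp: edges_def intro!: sum.cong)
    qed
    show ?thesis
      unfolding edges split by (intro sum.cong refl) (simp only: root_cut, simp only: deep_cut)
  qed
  also have "\<dots> = (\<Sum>i\<in>I. f {#T i#} (?F - {#T i#}) + cut_sum (branches (T i))
      (\<lambda>P R. if size P = 1 then f P (add_mset (Node (root_label (T i)) R) (?F - {#T i#})) else 0))"
  proof (intro sum.cong refl arg_cong2[where f = "(+)"])
    fix i
    assume i: "i \<in> I"
    have "represents (?rest i) (Node a (?F - {#T i#}))"
      unfolding rest[OF i] by (rule represents.representsI) (use representsI.hyps in auto)
    then show "q (X i) (?rest i) = f {#T i#} (?F - {#T i#})"
      using representsI.prems representsI.hyps(2)[OF i] by simp
    show "(\<Sum>e\<in>edges (X i). q (cut_branch e (X i)) (?V (X(i := cut_root e (X i))))) =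
        cut_sum (branches (T i))
          (\<lambda>P R. if size P = 1 then f P (add_mset (Node (root_label (T i)) R) (?F - {#T i#})) else 0)"
      by (rule representsI.IH[OF i, where q = "\<lambda>A B. q A (?V (X(i := B)))"])
        (use representsI.prems update[OF i] in simp)
  qed
  also have "\<dots> = cut_sum ?F (\<lambda>P R. if size P = 1 then f P R else 0)"
    by (simp only: cut_sum_single[of ?F f] sum_unfold_sum_mset image_mset.compositionality comp_def)
  finally show ?case
    by simp
qed

text \<open>The inner sum in the recursion for \<open>theta_set\<close>, with any function \<open>h\<close> in place of \<open>theta_set\<close>. The freedom to
  choose \<open>h\<close> is needed to treat the recursion before \<open>theta_set\<close> is known to depend on the shape only.\<close>

definition chain_sum :: "(nat list set \<Rightarrow> rat) \<Rightarrow> nat list set \<Rightarrow> nat \<Rightarrow> rat" where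
  "chain_sum h V k = (\<Sum>es\<in>{es. length es = k \<and> edge_chain V es}. prod_list (map h (pieces V es)))"

lemma finite_chains: "finite V \<Longrightarrow> finite {es. length es = k \<and> edge_chain V es}"
  by (rule finite_subset[OF _ finite_lists_length_eq[of "edges V" k]]) (auto simp: edge_chain_def edges_def)

text \<open>The conditions on the later edges of a chain may be read in \<open>V\<close> or in what is left of \<open>V\<close> after the
  first cut, since removing more vertices does not affect which of the remaining ones lie above which.\<close>

lemma edge_chain_Cons: "edge_chain V (e # es) \<longleftrightarrow> e \<in> edges V \<and> edge_chain (cut_root e V) es"
proof -
  have "sorted_wrt (\<lambda>e e'. e' \<in> edges (cut_root e V)) es \<longleftrightarrow>
      sorted_wrt (\<lambda>x y. y \<in> edges (cut_root x (cut_root e V))) es"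
    if "set es \<subseteq> edges (cut_root e V)"
    using that by (induction es) (auto simp: edges_def cut_root_def)
  then show ?thesis
    by (auto simp: edge_chain_def) (auto simp: edges_def cut_root_def)
qed

lemma chain_sum_0: "chain_sum h V 0 = h V"
proof -
  have "{es. length es = 0 \<and> edge_chain V es} = {[]}"
    by (auto simp: edge_chain_def)
  then show ?thesis
    by (simp add: chain_sum_def)
qed

lemma chain_sum_Suc:
  assumes "finite V"
  shows "chain_sum h V (Suc k) =
    (\<Sum>e\<in>edges V. h (add_root (cut_branch e V)) * chain_sum h (cut_root e V) k)"
proof -
  let ?C = "\<lambda>V k. {es. length es = k \<and> edge_chain V es}"
  have fin: "finite (edges V)" "finite (?C (cut_root e V) k)" for e
    using assms by (auto simp: edges_def cut_root_def intro!: finite_chains)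
  have "chain_sum h V (Suc k) = (\<Sum>(e, es)\<in>(SIGMA e:edges V. ?C (cut_root e V) k).
      prod_list (map h (pieces V (e # es))))"
    unfolding chain_sum_def
    by (rule sum.reindex_bij_witness[of _ "\<lambda>(e, es). e # es" "\<lambda>es. (hd es, tl es)"])
      (auto simp: length_Suc_conv edge_chain_Cons)
  also have "\<dots> = (\<Sum>e\<in>edges V. \<Sum>es\<in>?C (cut_root e V) k. prod_list (map h (pieces V (e # es))))"
    using fin by (subst sum.Sigma) auto
  finally show ?thesis
    by (simp add: chain_sum_def sum_distrib_left)
qed

text \<open>The first edge of a chain is a cut with a single branch, and the other edges form a chain in the
  part that is kept. An infinitesimal form ignores all other cuts.\<close>

lemma chain_sum_eq_conv_pow:
  assumes h: "\<And>V T :: 'a tree. represents V T \<Longrightarrow> h V = k (branches T)"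
    and k: "infinitesimal k" and "represents V (T :: 'a tree)"
  shows "chain_sum h V n = conv_pow k (Suc n) (branches T)"
  using assms(3)
proof (induction n arbitrary: V T)
  case 0
  then show ?case
    by (simp add: chain_sum_0 h conv_pow_Suc)
next
  case (Suc n)
  have "chain_sum h V (Suc n) =
      (\<Sum>e\<in>edges V. h (add_root (cut_branch e V)) * chain_sum h (cut_root e V) n)"
    using represents_basic(2)[OF Suc.prems] by (rule chain_sum_Suc)
  also have "\<dots> = cut_sum (branches T) (\<lambda>P R. if size P = 1 then k P * conv_pow k (Suc n) R else 0)"
  proof (rule sum_edges[OF Suc.prems])
    fix A B and C :: "'a tree" and R
    assume "represents A C" "represents B (Node (root_label T) R)"
    then show "h (add_root A) * chain_sum h B n = k {#C#} * conv_pow k (Suc n) R"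
      using h[OF represents_add_root] Suc.IH by fastforce
  qed
  also have "\<dots> = conv k (conv_pow k (Suc n)) (branches T)"
    unfolding conv_def using k by (intro cut_sum_cong) (simp add: infinitesimal_def)
  finally show ?case
    by (simp add: conv_pow_Suc)
qed

lemma theta_set_chain_sum:
  assumes "represents V T"
  shows "theta_set V = (if tree_size T = 1 \<or> size (branches T) > 1 then 0 else if tree_size T = 2 then 1
    else 1 - (\<Sum>m\<in>{2..tree_size T}. 1 / fact m *
      chain_sum (\<lambda>U. if card U < card V then theta_set U else 0) V (m - 1)))"
proof -
  have "V = {[]} \<longleftrightarrow> card V = 1"
    using represents_basic(1,2)[OF assms] by (auto simp: card_1_singleton_iff)
  then show ?thesis
    by (subst theta_set.simps) (simp only: represents_basic(4,5)[OF assms] chain_sum_def)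
qed

lemma represents_planar: "represents (verts (planar T)) T"
  using represents_verts[of "planar T"] by simp

definition theta_form :: "nat forest \<Rightarrow> rat" where
  "theta_form F = theta (Node 0 F)"

lemma infinitesimal_theta_form: "infinitesimal theta_form"
  unfolding infinitesimal_def
proof (intro allI impI)
  fix F :: "nat forest"
  assume "size F \<noteq> 1"
  then have "F = {#} \<or> size F > 1"
    by (cases "size F") auto
  then show "theta_form F = 0"
    unfolding theta_form_def theta_def theta_set_chain_sum[OF represents_planar] by auto
qed

text \<open>The value of \<open>theta_set\<close> depends only on the shape of the tree, by induction on its size: the recursion is
  applied both to \<open>V\<close> and to the vertex set of a planar representative of \<open>T\<close>, and by the induction
  hypothesis both chain sums are convolution powers of the same form \<open>?k\<close>. This form carries the
  guard of the recursion.\<close>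

lemma theta_set_represents:
  assumes "represents V (T :: nat tree)"
  shows "theta_set V = theta_form (branches T)"
  using assms
proof (induction "card V" arbitrary: V T rule: less_induct)
  case less
  obtain a F where T: "T = Node a F"
    by (cases T)
  let ?V = "verts (planar (Node 0 F))" and ?n = "tree_size T"
  let ?h = "\<lambda>U. if card U < ?n then theta_set U else 0"
  \<comment> \<open>The guard compares sizes with \<open>?n\<close>, which is the same number for \<open>V\<close> and \<open>?V\<close>.\<close>
  let ?k = "\<lambda>G. if tree_size (Node 0 G) < ?n then theta_form G else 0"
  have V: "represents ?V (Node 0 F)"
    by (rule represents_planar)
  have card: "card V = ?n" "card ?V = ?n"
    using represents_basic(4)[OF less.prems] represents_basic(4)[OF V] by (simp_all add: T)
  have h: "?h U = ?k (branches S)" if "represents U S" for U and S :: "nat tree"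
  proof -
    have "card U = tree_size (Node 0 (branches S))"
      using represents_basic(4)[OF that] by (cases S) simp
    then show ?thesis
      using less.hyps[of U S] that card by simp
  qed
  have k: "infinitesimal ?k"
    using infinitesimal_theta_form by (simp add: infinitesimal_def)
  have "chain_sum ?h V n = chain_sum ?h ?V n" for n
    using chain_sum_eq_conv_pow[of ?h ?k, OF h k less.prems] chain_sum_eq_conv_pow[of ?h ?k, OF h k V]
    by (simp add: T)
  then have "theta_set V = theta_set ?V"
    unfolding theta_set_chain_sum[OF less.prems] theta_set_chain_sum[OF V] card by (simp add: T)
  then show ?case
    by (simp add: theta_form_def theta_def T)
qed

lemma theta_eq: "theta T = theta_form (branches T)"
  unfolding theta_def by (rule theta_set_represents[OF represents_planar])

text \<open>On a single tree this is the recursion for \<open>theta_set\<close>: the summands with \<open>m \<ge> 2\<close> are divided powers, the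
  one with \<open>m = 1\<close> is \<open>\<theta>\<close> itself. The two-vertex tree is exceptional in the definition, but there only
  the summand with \<open>m = 1\<close> is left.\<close>

lemma exp_theta_form: "exp_form theta_form F = 1"
proof (rule exp_form_eq_1[OF infinitesimal_theta_form])
  fix C :: "nat tree"
  let ?F = "{#C#}" and ?T = "Node 0 {#C#}"
  let ?V = "verts (planar ?T)" and ?n = "tree_size ?T"
  have V: "represents ?V ?T"
    by (rule represents_planar)
  have n: "card ?V = ?n" "?n \<ge> 2"
    using represents_basic(4)[OF V] by (simp, cases C, simp)
  have "exp_form theta_form ?F = (\<Sum>m\<le>?n. divided_pow theta_form m ?F)"
    by (rule exp_form_eq[OF infinitesimal_theta_form, symmetric]) simp
  also have "{..?n} = insert 0 (insert 1 {2..?n})"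
    using n(2) by auto
  also have "(\<Sum>m\<in>\<dots>. divided_pow theta_form m ?F) =
      theta_form ?F + (\<Sum>m\<in>{2..?n}. divided_pow theta_form m ?F)"
    by (simp add: divided_pow_def conv_pow_Suc unit_form_def)
  also have "\<dots> = 1"
  proof (cases "?n = 2")
    case True
    have single: "{2..?n} = {2}"
      unfolding True by simp
    have "forest_size ?F < 2"
      using True by simp
    then have zero: "divided_pow theta_form 2 ?F = 0"
      by (rule divided_pow_eq_0[OF infinitesimal_theta_form])
    have one: "theta_form ?F = 1"
      unfolding theta_form_def theta_def theta_set_chain_sum[OF V] True by simp
    show ?thesis
      by (subst single, subst one) (simp only: sum.insert finite.emptyI sum.empty empty_iff
        not_False_eq_True zero add_0_right)
  next
    case False
    have "card ?V \<noteq> card {[] :: nat list}"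
      unfolding n(1) using n(2) by simp
    then have "?V \<noteq> {[]}"
      by metis
    moreover have "\<not> card {v \<in> ?V. length v = 1} > 1"
      unfolding represents_basic(5)[OF V] by simp
    ultimately have "theta_form ?F = 1 - (\<Sum>m\<in>{2..?n}. 1 / fact m * chain_sum theta_set ?V (m - 1))"
      unfolding theta_form_def theta_def chain_sum_def n(1)[symmetric]
      using False n(1) by (intro theta_set_rec represents_rooted_tree_set[OF V]) simp_all
    also have "(\<Sum>m\<in>{2..?n}. 1 / fact m * chain_sum theta_set ?V (m - 1)) =
        (\<Sum>m\<in>{2..?n}. divided_pow theta_form m ?F)"
      using chain_sum_eq_conv_pow[OF theta_set_represents infinitesimal_theta_form V]
      by (intro sum.cong refl) (simp add: divided_pow_def)
    finally show ?thesis
      by simp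
  qed
  finally show "exp_form theta_form ?F = 1" .
qed

section \<open>Structure constants of the product\<close>

lemma cut_sum_nonzero:
  assumes "cut_sum F f \<noteq> 0"
  obtains P R where "(P, R) \<in># forest_cuts F" "f P R \<noteq> 0"
  using assms cut_sum_cong[of F f "\<lambda>P R. 0"] by force

definition delta_form :: "'a forest \<Rightarrow> 'a forest \<Rightarrow> rat" where
  "delta_form F G = (if G = F then 1 else 0)"

abbreviation gl_coeff :: "'a tree \<Rightarrow> 'a tree \<Rightarrow> 'a tree \<Rightarrow> nat" where
  "gl_coeff T S U \<equiv> count (gl_terms T S) U"

text \<open>The structure constants in the basis \<open>\<V>\<^sub>T\<close> are the values of convolutions of delta forms.\<close>

lemma gl_coeff_aut:
  "of_nat (gl_coeff T S U) * of_nat (aut U) = (of_nat (aut T) * of_nat (aut S) *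
    (if root_label U = root_label S
     then conv (delta_form (branches T)) (delta_form (branches S)) (branches U) else 0) :: rat)"
proof -
  have "of_nat (gl_coeff T S U * aut U) = (of_nat (aut T * aut S) * cut_sum (branches U)
      (\<lambda>P R. of_nat (if P = branches T \<and> Node (root_label U) R = S then 1 else 0)) :: rat)"
    unfolding count_gl_terms of_nat_mult cut_sum_of_nat ..
  also have "cut_sum (branches U)
      (\<lambda>P R. of_nat (if P = branches T \<and> Node (root_label U) R = S then 1 else 0)) =
    (if root_label U = root_label S
     then conv (delta_form (branches T)) (delta_form (branches S)) (branches U) else 0 :: rat)"
    unfolding conv_def delta_form_def by (cases S) (auto intro!: cut_sum_cong simp: cut_sum_cong[of _ _ "\<lambda>P R. 0"])
  finally show ?thesis
    by simp
qed

lemma gl_coeff_nonzero: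
  assumes "gl_coeff T S U \<noteq> 0"
  shows "root_label U = root_label S" "(branches T, branches S) \<in># forest_cuts (branches U)"
proof -
  have "of_nat (gl_coeff T S U) * of_nat (aut U) \<noteq> (0 :: rat)"
    using assms aut_pos[of U] by simp
  then have nz: "root_label U = root_label S \<and>
      conv (delta_form (branches T)) (delta_form (branches S)) (branches U) \<noteq> 0"
    unfolding gl_coeff_aut by (auto split: if_splits)
  then show "root_label U = root_label S"
    by simp
  from nz obtain P R where "(P, R) \<in># forest_cuts (branches U)"
    "delta_form (branches T) P * delta_form (branches S) R \<noteq> 0"
    unfolding conv_def by (meson cut_sum_nonzero)
  then show "(branches T, branches S) \<in># forest_cuts (branches U)"
    by (auto simp: delta_form_def split: if_splits)
qed

lemma bar_T_iff: "T \<in> bar_T W \<longleftrightarrow> root_label T = 0 \<and> forest_labels (branches T) \<subseteq> W"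
  by (cases T) (auto simp: bar_T_def)

lemma gl_coeff_bar_T:
  assumes "gl_coeff T S U \<noteq> 0" "T \<in> bar_T W" "S \<in> bar_T W"
  shows "U \<in> bar_T W"
  using gl_coeff_nonzero(1)[OF assms(1)] assms(2,3)
  unfolding bar_T_iff forest_labels_cut[OF gl_coeff_nonzero(2)[OF assms(1)], symmetric] by simp

lemma conv_sum_left: "conv (\<lambda>F. \<Sum>i\<in>I. c i * a i F) b F = (\<Sum>i\<in>I. c i * conv (a i) b F)"
  by (simp add: conv_def sum_distrib_right cut_sum_sum mult.assoc cut_sum_mult_left)

lemma conv_sum_right: "conv a (\<lambda>F. \<Sum>i\<in>I. c i * b i F) F = (\<Sum>i\<in>I. c i * conv a (b i) F)"
  by (simp add: conv_def sum_distrib_left cut_sum_sum mult.left_commute flip: cut_sum_mult_left)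

lemma conv_scale:
  "conv (\<lambda>F. x * a F) b F = x * conv a b F" "conv a (\<lambda>F. x * b F) F = x * conv a b F"
  by (simp_all add: conv_def mult.assoc mult.left_commute flip: cut_sum_mult_left)

text \<open>The product of two basis elements, as a form. All its terms have the root label of \<open>S\<close>, so the tree \<open>V\<close>
  is determined by the forest \<open>P\<close>.\<close>

lemma sum_gl_coeff_delta:
  assumes "finite D" "set_mset (gl_terms T S) \<subseteq> D"
  shows "(\<Sum>V\<in>D. (of_nat (gl_coeff T S V) * of_nat (aut V)) * delta_form (branches V) P) =
    of_nat (aut T) * of_nat (aut S) * conv (delta_form (branches T)) (delta_form (branches S)) P"
proof -
  let ?V = "Node (root_label S) P"
  have "(of_nat (gl_coeff T S V) * of_nat (aut V)) * delta_form (branches V) P =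
      (if V = ?V then of_nat (gl_coeff T S V) * of_nat (aut V) else 0)" for V
  proof (cases "gl_coeff T S V = 0")
    case False
    then have "root_label V = root_label S"
      by (rule gl_coeff_nonzero(1))
    then show ?thesis
      by (cases V) (auto simp: delta_form_def simp del: aut_Node)
  qed (auto simp del: aut_Node)
  then have "(\<Sum>V\<in>D. (of_nat (gl_coeff T S V) * of_nat (aut V)) * delta_form (branches V) P) =
      (if ?V \<in> D then of_nat (gl_coeff T S ?V) * of_nat (aut ?V) else 0)"
    using assms(1) by (simp del: aut_Node)
  also have "\<dots> = of_nat (gl_coeff T S ?V) * of_nat (aut ?V)"
    using assms(2) by (auto simp: not_in_iff)
  finally show ?thesis
    by (simp add: gl_coeff_aut del: aut_Node)
qed

text \<open>After multiplication with \<open>aut U\<close> both sides are, up to the factors of \<open>T\<close>, \<open>S\<close> and \<open>R\<close>, the convolution of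
  three delta forms.\<close>

lemma gl_coeff_assoc:
  assumes "finite D" "set_mset (gl_terms T S) \<subseteq> D" "finite E" "set_mset (gl_terms S R) \<subseteq> E"
  shows "(\<Sum>V\<in>D. gl_coeff T S V * gl_coeff V R U) = (\<Sum>V\<in>E. gl_coeff S R V * gl_coeff T V U)"
proof -
  let ?d = "\<lambda>V. delta_form (branches V)" and ?n = "\<lambda>V. of_nat (aut V) :: rat"
  let ?c = "\<lambda>T S U. of_nat (gl_coeff T S U) :: rat"
  have "of_nat (\<Sum>V\<in>D. gl_coeff T S V * gl_coeff V R U) * ?n U =
      (\<Sum>V\<in>D. ?c T S V * (?c V R U * ?n U))"
    by (simp add: sum_distrib_right mult.assoc)
  also have "\<dots> = (if root_label U = root_label R then ?n R *
      (\<Sum>V\<in>D. (?c T S V * ?n V) * conv (?d V) (?d R) (branches U)) else 0)"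
    by (simp only: gl_coeff_aut[of _ R U]) (simp add: sum_distrib_left mult_ac)
  also have "(\<Sum>V\<in>D. (?c T S V * ?n V) * conv (?d V) (?d R) (branches U)) =
      ?n T * ?n S * conv (conv (?d T) (?d S)) (?d R) (branches U)"
    by (simp add: sum_gl_coeff_delta[OF assms(1,2)] conv_scale flip: conv_sum_left)
  also have "conv (conv (?d T) (?d S)) (?d R) = conv (?d T) (conv (?d S) (?d R))"
    by (rule conv_assoc)
  also have "(if root_label U = root_label R then ?n R *
      (?n T * ?n S * conv (?d T) (conv (?d S) (?d R)) (branches U)) else 0) =
    (if root_label U = root_label R then ?n T *
      (\<Sum>V\<in>E. (?c S R V * ?n V) * conv (?d T) (?d V) (branches U)) else 0)"
  proof -
    have "(\<Sum>V\<in>E. (?c S R V * ?n V) * conv (?d T) (?d V) (branches U)) =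
        ?n S * ?n R * conv (?d T) (conv (?d S) (?d R)) (branches U)"
      by (simp add: sum_gl_coeff_delta[OF assms(3,4)] conv_scale flip: conv_sum_right)
    then show ?thesis
      by (simp only: mult_ac)
  qed
  also have "\<dots> = (\<Sum>V\<in>E. ?c S R V * (?c T V U * ?n U))"
  proof -
    have "?c S R V * (?c T V U * ?n U) = (if root_label U = root_label R then
        ?n T * (?c S R V * ?n V * conv (?d T) (?d V) (branches U)) else 0)" for V
    proof (cases "gl_coeff S R V = 0")
      case False
      then have "root_label V = root_label R"
        by (rule gl_coeff_nonzero(1))
      then show ?thesis
        by (simp only: gl_coeff_aut[of T V U]) (simp add: mult_ac)
    qed simp
    then show ?thesis
      by (simp add: sum_distrib_left)
  qed
  also have "\<dots> = of_nat (\<Sum>V\<in>E. gl_coeff S R V * gl_coeff T V U) * ?n U"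
    by (simp add: sum_distrib_right mult.assoc)
  finally show ?thesis
    using aut_pos[of U] by (simp del: of_nat_sum)
qed

lemma delta_form_empty: "delta_form {#} = unit_form"
  by (auto simp: delta_form_def unit_form_def)

lemma gl_coeff_unit:
  assumes "S \<in> bar_T W"
  shows "gl_coeff single_vertex S U = (if U = S then 1 else 0)"
    and "gl_coeff S single_vertex U = (if U = S then 1 else 0)"
proof -
  have S: "root_label S = 0"
    using assms by (simp add: bar_T_iff)
  have "of_nat (gl_coeff single_vertex S U) * of_nat (aut U) =
      (of_nat (aut S) * (if root_label U = 0 then delta_form (branches S) (branches U) else 0) :: rat)"
    by (simp add: gl_coeff_aut delta_form_empty S)
  also have "\<dots> = (if U = S then of_nat (aut U) else 0)"
    using S by (cases S; cases U) (auto simp: delta_form_def)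
  finally show "gl_coeff single_vertex S U = (if U = S then 1 else 0)"
    using aut_pos[of U] by (auto split: if_splits)
  have "of_nat (gl_coeff S single_vertex U) * of_nat (aut U) =
      (of_nat (aut S) * (if root_label U = 0 then delta_form (branches S) (branches U) else 0) :: rat)"
    by (simp add: gl_coeff_aut delta_form_empty S)
  also have "\<dots> = (if U = S then of_nat (aut U) else 0)"
    using S by (cases S; cases U) (auto simp: delta_form_def)
  finally show "gl_coeff S single_vertex U = (if U = S then 1 else 0)"
    using aut_pos[of U] by (auto split: if_splits)
qed

text \<open>Since all labels are positive, a nonempty forest decomposes into the label of a root and two forests of
  smaller weight.\<close>

lemma finite_forests_of_weight:
  assumes "W \<subseteq> {n. n > 0}"
  shows "finite {F. forest_labels F \<subseteq> W \<and> forest_weight F \<le> n}"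
proof (induction n)
  case 0
  have "F = {#}" if "forest_labels F \<subseteq> W" "forest_weight F \<le> 0" for F
  proof (cases F)
    case (add C G)
    then show ?thesis
      using that assms by (cases C) auto
  qed
  then have "{F. forest_labels F \<subseteq> W \<and> forest_weight F \<le> 0} \<subseteq> {{#}}"
    by blast
  then show ?case
    by (rule finite_subset) simp
next
  case (Suc n)
  let ?A = "{F. forest_labels F \<subseteq> W \<and> forest_weight F \<le> n}"
  let ?B = "insert {#} ((\<lambda>(a, F, G). add_mset (Node a F) G) ` ({..Suc n} \<times> ?A \<times> ?A))"
  have "F \<in> ?B" if F: "forest_labels F \<subseteq> W" "forest_weight F \<le> Suc n" for F
  proof (cases F)
    case (add C G)
    obtain a H where C: "C = Node a H"
      by (cases C)
    then have "a > 0"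
      using F(1) assms by (auto simp: add)
    then have "(a, H, G) \<in> {..Suc n} \<times> ?A \<times> ?A"
      using F by (auto simp: add C)
    from imageI[OF this, of "\<lambda>(a, F, G). add_mset (Node a F) G"] show ?thesis
      by (simp add: add C)
  qed simp
  then have "{F. forest_labels F \<subseteq> W \<and> forest_weight F \<le> Suc n} \<subseteq> ?B"
    by blast
  then show ?case
    by (rule finite_subset) (simp add: Suc.IH)
qed

lemma finite_bar_T_weight:
  assumes "W \<subseteq> {n. n > 0}"
  shows "finite {T \<in> bar_T W. weight T = n}"
proof (rule finite_subset)
  show "{T \<in> bar_T W. weight T = n} \<subseteq> Node 0 ` {F. forest_labels F \<subseteq> W \<and> forest_weight F \<le> n}"
  proof
    fix T
    assume "T \<in> {T \<in> bar_T W. weight T = n}"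
    then show "T \<in> Node 0 ` {F. forest_labels F \<subseteq> W \<and> forest_weight F \<le> n}"
      by (cases T) (auto simp: bar_T_iff)
  qed
qed (simp add: finite_forests_of_weight[OF assms])

lemma forest_size_le_weight:
  assumes "W \<subseteq> {n. n > 0}" "forest_labels F \<subseteq> W"
  shows "forest_size F \<le> forest_weight F"
  using assms(2)
proof (induction F rule: forest_induct)
  case (add a F G)
  then have "a > 0"
    using assms(1) by auto
  with add show ?case
    by (simp add: Suc_le_eq)
qed simp

section \<open>The Grossman-Larson algebra\<close>

lemma (in cring) finsum_swap:
  assumes "finite A" "finite B" "\<And>i j. i \<in> A \<Longrightarrow> j \<in> B \<Longrightarrow> f i j \<in> carrier R"
  shows "(\<Oplus>i\<in>A. \<Oplus>j\<in>B. f i j) = (\<Oplus>j\<in>B. \<Oplus>i\<in>A. f i j)"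
  using assms(1,3)
proof (induction A rule: finite_induct)
  case (insert a A)
  have "(\<Oplus>j\<in>B. \<Oplus>i\<in>insert a A. f i j) = (\<Oplus>j\<in>B. f a j \<oplus> (\<Oplus>i\<in>A. f i j))"
    using insert by (intro finsum_cong') (auto simp: Pi_iff)
  also have "\<dots> = (\<Oplus>j\<in>B. f a j) \<oplus> (\<Oplus>j\<in>B. \<Oplus>i\<in>A. f i j)"
    using insert by (intro finsum_addf) auto
  also have "\<dots> = (\<Oplus>i\<in>insert a A. \<Oplus>j\<in>B. f i j)"
    using insert by simp
  finally show ?case ..
qed simp

lemma (in cring) finsum_rotate:
  assumes "finite A" "finite B" "finite C" "\<And>i j k. f i j k \<in> carrier R"
  shows "(\<Oplus>i\<in>A. \<Oplus>j\<in>B. \<Oplus>k\<in>C. f i j k) = (\<Oplus>j\<in>B. \<Oplus>k\<in>C. \<Oplus>i\<in>A. f i j k)"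
proof -
  have "(\<Oplus>i\<in>A. \<Oplus>j\<in>B. \<Oplus>k\<in>C. f i j k) = (\<Oplus>j\<in>B. \<Oplus>i\<in>A. \<Oplus>k\<in>C. f i j k)"
    using assms by (intro finsum_swap) auto
  also have "\<dots> = (\<Oplus>j\<in>B. \<Oplus>k\<in>C. \<Oplus>i\<in>A. f i j k)"
    using assms by (intro finsum_cong' refl finsum_swap) auto
  finally show ?thesis .
qed

lemma (in cring) finsum_double_mult:
  assumes "finite A" "finite B" "\<And>i j. f i j \<in> carrier R" "a \<in> carrier R" "b \<in> carrier R"
  shows "a \<otimes> ((\<Oplus>i\<in>A. \<Oplus>j\<in>B. f i j) \<otimes> b) = (\<Oplus>i\<in>A. \<Oplus>j\<in>B. a \<otimes> (f i j \<otimes> b))"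
    and "a \<otimes> (b \<otimes> (\<Oplus>i\<in>A. \<Oplus>j\<in>B. f i j)) = (\<Oplus>i\<in>A. \<Oplus>j\<in>B. a \<otimes> (b \<otimes> f i j))"
proof -
  have inner: "a \<otimes> ((\<Oplus>j\<in>B. f i j) \<otimes> b) = (\<Oplus>j\<in>B. a \<otimes> (f i j \<otimes> b))"
    "a \<otimes> (b \<otimes> (\<Oplus>j\<in>B. f i j)) = (\<Oplus>j\<in>B. a \<otimes> (b \<otimes> f i j))" for i
    using assms by (simp_all add: finsum_ldistr finsum_rdistr Pi_iff)
  show "a \<otimes> ((\<Oplus>i\<in>A. \<Oplus>j\<in>B. f i j) \<otimes> b) = (\<Oplus>i\<in>A. \<Oplus>j\<in>B. a \<otimes> (f i j \<otimes> b))"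
    and "a \<otimes> (b \<otimes> (\<Oplus>i\<in>A. \<Oplus>j\<in>B. f i j)) = (\<Oplus>i\<in>A. \<Oplus>j\<in>B. a \<otimes> (b \<otimes> f i j))"
    unfolding inner[symmetric] using assms by (simp_all add: finsum_ldistr finsum_rdistr Pi_iff)
qed

text \<open>Elements of the algebra are functions to \<open>K\<close>. All their structure constants are images of rational
  numbers under the homomorphism \<open>\<rho>\<close>, the natural multiples in the product included (\<open>add_pow_eq\<close>).\<close>

locale grossman_larson =
  fixes K :: "(rat, 'k, 'm) module_scheme" (structure) and W :: "nat set"
  assumes algebra: "algebra rat_ring K" and W_pos: "W \<subseteq> {n. n > 0}"
begin

sublocale K: cring K
  using algebra by (rule algebra.M_cring)

abbreviation \<rho> :: "rat \<Rightarrow> 'k" where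
  "\<rho> \<equiv> rat_scalar K"

abbreviation A :: "('k, nat tree \<Rightarrow> 'k) module" where
  "A \<equiv> gl_algebra K W"

lemma \<rho>_closed [simp]: "\<rho> q \<in> carrier K"
  and \<rho>_add: "\<rho> (p + q) = \<rho> p \<oplus> \<rho> q"
  and \<rho>_mult: "\<rho> (p * q) = \<rho> p \<otimes> \<rho> q"
  and \<rho>_0 [simp]: "\<rho> 0 = \<zero>"
  and \<rho>_1 [simp]: "\<rho> 1 = \<one>"
proof -
  interpret algebra rat_ring K
    by (rule algebra)
  have carrier: "x \<in> carrier rat_ring" for x
    by (simp add: rat_ring_def)
  show closed: "\<rho> q \<in> carrier K" for q
    by (simp add: rat_scalar_def carrier)
  show "\<rho> (p + q) = \<rho> p \<oplus> \<rho> q"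
    using smult_l_distr[OF carrier carrier, of "\<one>" p q] by (simp add: rat_scalar_def rat_ring_def)
  show "\<rho> (p * q) = \<rho> p \<otimes> \<rho> q"
    using smult_assoc1[OF carrier carrier, of "\<one>" p q] smult_assoc2[OF carrier, of "\<one>" "\<rho> q" p] closed[of q]
    by (simp add: rat_scalar_def rat_ring_def)
  show "\<rho> 0 = \<zero>"
    using smult_l_null[of "\<one>"] by (simp add: rat_scalar_def rat_ring_def)
  show "\<rho> 1 = \<one>"
    using smult_one[of "\<one>"] by (simp add: rat_scalar_def rat_ring_def)
qed

lemma \<rho>_minus: "\<rho> (- q) = \<ominus> \<rho> q"
  using \<rho>_add[of "- q" q] by (intro K.minus_equality[symmetric]) simp_all

lemma \<rho>_sum: "finite S \<Longrightarrow> \<rho> (\<Sum>i\<in>S. f i) = (\<Oplus>i\<in>S. \<rho> (f i))"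
  by (induction S rule: finite_induct) (simp_all add: \<rho>_add)

lemma add_pow_eq: "x \<in> carrier K \<Longrightarrow> [(n :: nat)] \<cdot>\<^bsub>K\<^esub> x = \<rho> (of_nat n) \<otimes> x"
  by (induction n) (simp_all add: \<rho>_add K.l_distr K.a_comm)

lemma carrier_A:
  "x \<in> carrier A \<longleftrightarrow> (\<forall>T. x T \<in> carrier K) \<and> finite {T. x T \<noteq> \<zero>} \<and> (\<forall>T. T \<notin> bar_T W \<longrightarrow> x T = \<zero>)"
  by (auto simp: gl_algebra_def)

lemma A_simps [simp]:
  "\<zero>\<^bsub>A\<^esub> = (\<lambda>U. \<zero>)" "\<one>\<^bsub>A\<^esub> = (\<lambda>U. if U = single_vertex then \<one> else \<zero>)"
  "x \<oplus>\<^bsub>A\<^esub> y = (\<lambda>U. x U \<oplus> y U)" "c \<odot>\<^bsub>A\<^esub> x = (\<lambda>U. c \<otimes> x U)"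
  by (simp_all add: gl_algebra_def)

lemma A_closed [simp]: "x \<in> carrier A \<Longrightarrow> x T \<in> carrier K"
  by (simp add: carrier_A)

lemma abelian_group_A: "abelian_group A"
proof (rule abelian_groupI)
  fix x y
  assume x: "x \<in> carrier A" and y: "y \<in> carrier A"
  have "{T. x T \<oplus> y T \<noteq> \<zero>} \<subseteq> {T. x T \<noteq> \<zero>} \<union> {T. y T \<noteq> \<zero>}"
    by auto
  with x y show "x \<oplus>\<^bsub>A\<^esub> y \<in> carrier A"
    by (auto simp: carrier_A intro: finite_subset)
  show "x \<oplus>\<^bsub>A\<^esub> y = y \<oplus>\<^bsub>A\<^esub> x"
    using x y by (simp add: K.a_comm)
next
  fix x
  assume x: "x \<in> carrier A"
  have "{T. \<ominus> x T \<noteq> \<zero>} = {T. x T \<noteq> \<zero>}"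
    using x by auto
  with x have "(\<lambda>T. \<ominus> x T) \<in> carrier A"
    by (auto simp: carrier_A)
  moreover have "(\<lambda>T. \<ominus> x T) \<oplus>\<^bsub>A\<^esub> x = \<zero>\<^bsub>A\<^esub>"
    using x by (simp add: K.l_neg)
  ultimately show "\<exists>y\<in>carrier A. y \<oplus>\<^bsub>A\<^esub> x = \<zero>\<^bsub>A\<^esub>"
    by blast
  show "\<zero>\<^bsub>A\<^esub> \<oplus>\<^bsub>A\<^esub> x = x"
    using x by simp
next
  fix x y z
  assume "x \<in> carrier A" "y \<in> carrier A" "z \<in> carrier A"
  then show "x \<oplus>\<^bsub>A\<^esub> y \<oplus>\<^bsub>A\<^esub> z = x \<oplus>\<^bsub>A\<^esub> (y \<oplus>\<^bsub>A\<^esub> z)"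
    by (simp add: K.a_assoc)
qed (simp add: carrier_A)

sublocale A: abelian_group A
  by (rule abelian_group_A)

text \<open>The sums over supports can be taken over any larger finite sets. Only then can products of different
  elements be compared.\<close>

lemma A_mult:
  assumes x: "x \<in> carrier A" and y: "y \<in> carrier A"
    and D: "finite D" "{T. x T \<noteq> \<zero>} \<subseteq> D" and E: "finite E" "{T. y T \<noteq> \<zero>} \<subseteq> E"
  shows "(x \<otimes>\<^bsub>A\<^esub> y) U = (\<Oplus>T\<in>D. \<Oplus>S\<in>E. \<rho> (of_nat (gl_coeff T S U)) \<otimes> (x T \<otimes> y S))"
proof -
  have inner: "(\<Oplus>S\<in>{S. y S \<noteq> \<zero>}. [gl_coeff T S U] \<cdot>\<^bsub>K\<^esub> (x T \<otimes> y S)) =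
      (\<Oplus>S\<in>E. \<rho> (of_nat (gl_coeff T S U)) \<otimes> (x T \<otimes> y S))" for T
    by (rule K.add.finprod_mono_neutral_cong_left) (use x y E in \<open>auto simp: add_pow_eq\<close>)
  have "(x \<otimes>\<^bsub>A\<^esub> y) U = (\<Oplus>T\<in>{T. x T \<noteq> \<zero>}. \<Oplus>S\<in>E. \<rho> (of_nat (gl_coeff T S U)) \<otimes> (x T \<otimes> y S))"
    by (simp add: gl_algebra_def inner)
  also have "\<dots> = (\<Oplus>T\<in>D. \<Oplus>S\<in>E. \<rho> (of_nat (gl_coeff T S U)) \<otimes> (x T \<otimes> y S))"
    by (rule K.add.finprod_mono_neutral_cong_left) (use x y D in auto)
  finally show ?thesis .
qed

lemma A_mult_support:
  assumes x: "x \<in> carrier A" and y: "y \<in> carrier A" and nz: "(x \<otimes>\<^bsub>A\<^esub> y) U \<noteq> \<zero>"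
  obtains T S where "x T \<noteq> \<zero>" "y S \<noteq> \<zero>" "gl_coeff T S U \<noteq> 0"
proof -
  have fin: "finite {T. x T \<noteq> \<zero>}" "finite {T. y T \<noteq> \<zero>}"
    using x y by (simp_all add: carrier_A)
  have "(x \<otimes>\<^bsub>A\<^esub> y) U = \<zero>"
    if "\<And>T S. x T \<noteq> \<zero> \<Longrightarrow> y S \<noteq> \<zero> \<Longrightarrow> gl_coeff T S U = 0"
    unfolding A_mult[OF x y fin(1) subset_refl fin(2) subset_refl]
    using that x y by (intro K.add.finprod_one_eqI) simp
  then show thesis
    using nz that by blast
qed

lemma A_mult_support_subset:
  assumes x: "x \<in> carrier A" and y: "y \<in> carrier A"
  shows "{U. (x \<otimes>\<^bsub>A\<^esub> y) U \<noteq> \<zero>} \<subseteq>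
    (\<Union>T\<in>{T. x T \<noteq> \<zero>}. \<Union>S\<in>{S. y S \<noteq> \<zero>}. set_mset (gl_terms T S))"
proof
  fix U
  assume "U \<in> {U. (x \<otimes>\<^bsub>A\<^esub> y) U \<noteq> \<zero>}"
  then obtain T S where "x T \<noteq> \<zero>" "y S \<noteq> \<zero>" "gl_coeff T S U \<noteq> 0"
    using A_mult_support[OF x y] by blast
  then show "U \<in> (\<Union>T\<in>{T. x T \<noteq> \<zero>}. \<Union>S\<in>{S. y S \<noteq> \<zero>}. set_mset (gl_terms T S))"
    by (auto simp: count_eq_zero_iff)
qed

lemma A_mult_closed:
  assumes x: "x \<in> carrier A" and y: "y \<in> carrier A"
  shows "x \<otimes>\<^bsub>A\<^esub> y \<in> carrier A"
proof -
  have fin: "finite {T. x T \<noteq> \<zero>}" "finite {T. y T \<noteq> \<zero>}"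
    using x y by (simp_all add: carrier_A)
  have "(x \<otimes>\<^bsub>A\<^esub> y) U \<in> carrier K" for U
    unfolding A_mult[OF x y fin(1) subset_refl fin(2) subset_refl]
    using x y by (intro K.finsum_closed) auto
  moreover have "finite {U. (x \<otimes>\<^bsub>A\<^esub> y) U \<noteq> \<zero>}"
    by (rule finite_subset[OF A_mult_support_subset[OF x y]]) (use fin in simp)
  moreover have "(x \<otimes>\<^bsub>A\<^esub> y) U = \<zero>" if "U \<notin> bar_T W" for U
  proof (rule ccontr)
    assume "(x \<otimes>\<^bsub>A\<^esub> y) U \<noteq> \<zero>"
    then obtain T S where TS: "x T \<noteq> \<zero>" "y S \<noteq> \<zero>" "gl_coeff T S U \<noteq> 0"
      using A_mult_support[OF x y] by blast
    then have "T \<in> bar_T W" "S \<in> bar_T W"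
      using x y unfolding carrier_A by metis+
    then show False
      using gl_coeff_bar_T[OF TS(3)] that by blast
  qed
  ultimately show ?thesis
    by (simp add: carrier_A)
qed

text \<open>Both sides are sums of \<open>x T \<otimes> (y S \<otimes> z R)\<close>, and the coefficients agree by \<open>gl_coeff_assoc\<close>. The
  sets \<open>D\<close> and \<open>E\<close> contain the supports of the inner products.\<close>

lemma A_assoc:
  assumes x: "x \<in> carrier A" and y: "y \<in> carrier A" and z: "z \<in> carrier A"
  shows "x \<otimes>\<^bsub>A\<^esub> y \<otimes>\<^bsub>A\<^esub> z = x \<otimes>\<^bsub>A\<^esub> (y \<otimes>\<^bsub>A\<^esub> z)"
proof
  fix U
  define X Y Z where "X = {T. x T \<noteq> \<zero>}" and "Y = {T. y T \<noteq> \<zero>}" and "Z = {T. z T \<noteq> \<zero>}"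
  define D where "D = (\<Union>T\<in>X. \<Union>S\<in>Y. set_mset (gl_terms T S))"
  define E where "E = (\<Union>S\<in>Y. \<Union>R\<in>Z. set_mset (gl_terms S R))"
  have fin: "finite X" "finite Y" "finite Z"
    using x y z by (simp_all add: carrier_A X_def Y_def Z_def)
  then have finDE: "finite D" "finite E"
    by (simp_all add: D_def E_def)
  let ?c = "\<lambda>T S U. \<rho> (of_nat (gl_coeff T S U))"
  have closed [simp]: "x T \<in> carrier K" "y T \<in> carrier K" "z T \<in> carrier K" for T
    using x y z by simp_all
  have subD: "{V. (x \<otimes>\<^bsub>A\<^esub> y) V \<noteq> \<zero>} \<subseteq> D" and subE: "{V. (y \<otimes>\<^bsub>A\<^esub> z) V \<noteq> \<zero>} \<subseteq> E"
    unfolding D_def E_def X_def Y_def Z_def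
    by (rule A_mult_support_subset[OF x y], rule A_mult_support_subset[OF y z])
  let ?m = "\<lambda>T S R. x T \<otimes> (y S \<otimes> z R)"
  have "(x \<otimes>\<^bsub>A\<^esub> y \<otimes>\<^bsub>A\<^esub> z) U =
      (\<Oplus>V\<in>D. \<Oplus>R\<in>Z. ?c V R U \<otimes> ((\<Oplus>T\<in>X. \<Oplus>S\<in>Y. ?c T S V \<otimes> (x T \<otimes> y S)) \<otimes> z R))"
    unfolding A_mult[OF A_mult_closed[OF x y] z finDE(1) subD fin(3) eq_refl[OF Z_def[symmetric]]]
      A_mult[OF x y fin(1) eq_refl[OF X_def[symmetric]] fin(2) eq_refl[OF Y_def[symmetric]]] ..
  also have "\<dots> = (\<Oplus>V\<in>D. \<Oplus>R\<in>Z. \<Oplus>T\<in>X. \<Oplus>S\<in>Y. ?c T S V \<otimes> ?c V R U \<otimes> ?m T S R)"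
  proof -
    have "?c V R U \<otimes> (?c T S V \<otimes> (x T \<otimes> y S) \<otimes> z R) = ?c T S V \<otimes> ?c V R U \<otimes> ?m T S R" for T S R V
      by (simp add: K.m_ac)
    then show ?thesis
      using fin by (simp only: K.finsum_double_mult(1)[OF fin(1,2)] K.m_closed \<rho>_closed closed)
  qed
  also have "\<dots> = (\<Oplus>V\<in>D. \<Oplus>T\<in>X. \<Oplus>S\<in>Y. \<Oplus>R\<in>Z. ?c T S V \<otimes> ?c V R U \<otimes> ?m T S R)"
    by (intro K.finsum_cong' refl K.finsum_rotate fin) (auto intro!: K.finsum_closed)
  also have "\<dots> = (\<Oplus>T\<in>X. \<Oplus>V\<in>D. \<Oplus>S\<in>Y. \<Oplus>R\<in>Z. ?c T S V \<otimes> ?c V R U \<otimes> ?m T S R)"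
    by (intro K.finsum_swap fin finDE) (auto intro!: K.finsum_closed)
  also have "\<dots> = (\<Oplus>T\<in>X. \<Oplus>S\<in>Y. \<Oplus>R\<in>Z. \<Oplus>V\<in>D. ?c T S V \<otimes> ?c V R U \<otimes> ?m T S R)"
    by (intro K.finsum_cong' refl K.finsum_rotate fin finDE) (auto intro!: K.finsum_closed)
  also have "\<dots> = (\<Oplus>T\<in>X. \<Oplus>S\<in>Y. \<Oplus>R\<in>Z.
      \<rho> (of_nat (\<Sum>V\<in>D. gl_coeff T S V * gl_coeff V R U)) \<otimes> ?m T S R)"
    using finDE by (simp add: \<rho>_sum \<rho>_mult K.finsum_ldistr)
  also have "\<dots> = (\<Oplus>T\<in>X. \<Oplus>S\<in>Y. \<Oplus>R\<in>Z.
      \<rho> (of_nat (\<Sum>V\<in>E. gl_coeff S R V * gl_coeff T V U)) \<otimes> ?m T S R)"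
  proof (intro K.finsum_cong' refl)
    fix T S R
    assume "T \<in> X" "S \<in> Y" "R \<in> Z"
    then have sub: "set_mset (gl_terms T S) \<subseteq> D" "set_mset (gl_terms S R) \<subseteq> E"
      by (auto simp: D_def E_def)
    show "\<rho> (of_nat (\<Sum>V\<in>D. gl_coeff T S V * gl_coeff V R U)) \<otimes> ?m T S R =
        \<rho> (of_nat (\<Sum>V\<in>E. gl_coeff S R V * gl_coeff T V U)) \<otimes> ?m T S R"
      by (simp only: gl_coeff_assoc[OF finDE(1) sub(1) finDE(2) sub(2)])
  qed (auto intro!: K.finsum_closed)
  also have "\<dots> = (\<Oplus>T\<in>X. \<Oplus>S\<in>Y. \<Oplus>R\<in>Z. \<Oplus>V\<in>E. ?c S R V \<otimes> ?c T V U \<otimes> ?m T S R)"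
    using finDE by (simp add: \<rho>_sum \<rho>_mult K.finsum_ldistr)
  also have "\<dots> = (\<Oplus>T\<in>X. \<Oplus>V\<in>E. \<Oplus>S\<in>Y. \<Oplus>R\<in>Z. ?c S R V \<otimes> ?c T V U \<otimes> ?m T S R)"
    by (intro K.finsum_cong' refl K.finsum_rotate[symmetric] fin finDE) (auto intro!: K.finsum_closed)
  also have "\<dots> = (\<Oplus>T\<in>X. \<Oplus>V\<in>E. ?c T V U \<otimes> (x T \<otimes> (\<Oplus>S\<in>Y. \<Oplus>R\<in>Z. ?c S R V \<otimes> (y S \<otimes> z R))))"
  proof -
    have "?c T V U \<otimes> (x T \<otimes> (?c S R V \<otimes> (y S \<otimes> z R))) = ?c S R V \<otimes> ?c T V U \<otimes> ?m T S R" for T S R V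
      by (simp add: K.m_ac)
    then show ?thesis
      using fin by (simp only: K.finsum_double_mult(2)[OF fin(2,3)] K.m_closed \<rho>_closed closed)
  qed
  also have "\<dots> = (x \<otimes>\<^bsub>A\<^esub> (y \<otimes>\<^bsub>A\<^esub> z)) U"
    unfolding A_mult[OF x A_mult_closed[OF y z] fin(1) eq_refl[OF X_def[symmetric]] finDE(2) subE]
      A_mult[OF y z fin(2) eq_refl[OF Y_def[symmetric]] fin(3) eq_refl[OF Z_def[symmetric]]] ..
  finally show "(x \<otimes>\<^bsub>A\<^esub> y \<otimes>\<^bsub>A\<^esub> z) U = (x \<otimes>\<^bsub>A\<^esub> (y \<otimes>\<^bsub>A\<^esub> z)) U" .
qed

lemma A_one_closed: "\<one>\<^bsub>A\<^esub> \<in> carrier A"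
  by (auto simp: carrier_A bar_T_iff intro: finite_subset[of _ "{single_vertex}"])

lemma A_one_mult:
  assumes x: "x \<in> carrier A"
  shows "\<one>\<^bsub>A\<^esub> \<otimes>\<^bsub>A\<^esub> x = x" "x \<otimes>\<^bsub>A\<^esub> \<one>\<^bsub>A\<^esub> = x"
proof -
  have one: "{T. \<one>\<^bsub>A\<^esub> T \<noteq> \<zero>} \<subseteq> {single_vertex}"
    by auto
  have bar: "S \<in> bar_T W" if "x S \<noteq> \<zero>" for S
    using x that by (auto simp: carrier_A)
  have "(\<one>\<^bsub>A\<^esub> \<otimes>\<^bsub>A\<^esub> x) U = x U \<and> (x \<otimes>\<^bsub>A\<^esub> \<one>\<^bsub>A\<^esub>) U = x U" for U
  proof -
    let ?D = "insert U {T. x T \<noteq> \<zero>}"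
    have D: "finite ?D" "{T. x T \<noteq> \<zero>} \<subseteq> ?D"
      using x by (auto simp: carrier_A)
    have coeff: "\<rho> (of_nat (gl_coeff single_vertex S U)) \<otimes> x S = (if S = U then x S else \<zero>)"
      "\<rho> (of_nat (gl_coeff S single_vertex U)) \<otimes> x S = (if S = U then x S else \<zero>)" for S
    proof -
      have "x S \<in> carrier K"
        using x by simp
      then show "\<rho> (of_nat (gl_coeff single_vertex S U)) \<otimes> x S = (if S = U then x S else \<zero>)"
        "\<rho> (of_nat (gl_coeff S single_vertex U)) \<otimes> x S = (if S = U then x S else \<zero>)"
        using gl_coeff_unit[OF bar[of S], of U] by (cases "x S = \<zero>", auto)+
    qed
    have pick: "(\<Oplus>S\<in>?D. if S = U then x S else \<zero>) = x U"
      using K.add.finprod_singleton_swap[of U ?D x] x D(1) by (simp add: Pi_iff)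
    have "(\<one>\<^bsub>A\<^esub> \<otimes>\<^bsub>A\<^esub> x) U = x U"
      unfolding A_mult[OF A_one_closed x _ one D, OF finite.insertI[OF finite.emptyI]]
      using x pick by (simp add: coeff)
    moreover have "(x \<otimes>\<^bsub>A\<^esub> \<one>\<^bsub>A\<^esub>) U = x U"
      unfolding A_mult[OF x A_one_closed D _ one, OF finite.insertI[OF finite.emptyI]]
      using x pick by (simp add: coeff)
    ultimately show ?thesis
      by simp
  qed
  then show "\<one>\<^bsub>A\<^esub> \<otimes>\<^bsub>A\<^esub> x = x" "x \<otimes>\<^bsub>A\<^esub> \<one>\<^bsub>A\<^esub> = x"
    by auto
qed

lemma A_distrib:
  assumes x: "x \<in> carrier A" and y: "y \<in> carrier A" and z: "z \<in> carrier A"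
  shows "(x \<oplus>\<^bsub>A\<^esub> y) \<otimes>\<^bsub>A\<^esub> z = x \<otimes>\<^bsub>A\<^esub> z \<oplus>\<^bsub>A\<^esub> y \<otimes>\<^bsub>A\<^esub> z"
    and "z \<otimes>\<^bsub>A\<^esub> (x \<oplus>\<^bsub>A\<^esub> y) = z \<otimes>\<^bsub>A\<^esub> x \<oplus>\<^bsub>A\<^esub> z \<otimes>\<^bsub>A\<^esub> y"
proof -
  let ?D = "{T. x T \<noteq> \<zero>} \<union> {T. y T \<noteq> \<zero>} \<union> {T. z T \<noteq> \<zero>}"
  have D: "finite ?D" and sub: "{T. x T \<noteq> \<zero>} \<subseteq> ?D" "{T. y T \<noteq> \<zero>} \<subseteq> ?D" "{T. z T \<noteq> \<zero>} \<subseteq> ?D"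
    "{T. (x \<oplus>\<^bsub>A\<^esub> y) T \<noteq> \<zero>} \<subseteq> ?D"
    using x y z by (auto simp: carrier_A)
  have xy: "x \<oplus>\<^bsub>A\<^esub> y \<in> carrier A"
    using x y by (rule A.a_closed)
  have [simp]: "x T \<in> carrier K" "y T \<in> carrier K" "z T \<in> carrier K" for T
    using x y z by simp_all
  show "(x \<oplus>\<^bsub>A\<^esub> y) \<otimes>\<^bsub>A\<^esub> z = x \<otimes>\<^bsub>A\<^esub> z \<oplus>\<^bsub>A\<^esub> y \<otimes>\<^bsub>A\<^esub> z"
  proof
    fix U
    show "((x \<oplus>\<^bsub>A\<^esub> y) \<otimes>\<^bsub>A\<^esub> z) U = (x \<otimes>\<^bsub>A\<^esub> z \<oplus>\<^bsub>A\<^esub> y \<otimes>\<^bsub>A\<^esub> z) U"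
      unfolding A_simps(3)[of "_ \<otimes>\<^bsub>A\<^esub> _"]
        A_mult[OF xy z D sub(4) D sub(3)] A_mult[OF x z D sub(1) D sub(3)] A_mult[OF y z D sub(2) D sub(3)]
      by (simp add: K.l_distr K.r_distr Pi_iff flip: K.finsum_addf)
  qed
  show "z \<otimes>\<^bsub>A\<^esub> (x \<oplus>\<^bsub>A\<^esub> y) = z \<otimes>\<^bsub>A\<^esub> x \<oplus>\<^bsub>A\<^esub> z \<otimes>\<^bsub>A\<^esub> y"
  proof
    fix U
    show "(z \<otimes>\<^bsub>A\<^esub> (x \<oplus>\<^bsub>A\<^esub> y)) U = (z \<otimes>\<^bsub>A\<^esub> x \<oplus>\<^bsub>A\<^esub> z \<otimes>\<^bsub>A\<^esub> y) U"
      unfolding A_simps(3)[of "_ \<otimes>\<^bsub>A\<^esub> _"]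
        A_mult[OF z xy D sub(3) D sub(4)] A_mult[OF z x D sub(3) D sub(1)] A_mult[OF z y D sub(3) D sub(2)]
      by (simp add: K.l_distr K.r_distr Pi_iff flip: K.finsum_addf)
  qed
qed

lemma A_smult_closed:
  assumes "c \<in> carrier K" "x \<in> carrier A"
  shows "c \<odot>\<^bsub>A\<^esub> x \<in> carrier A"
proof -
  have "{T. c \<otimes> x T \<noteq> \<zero>} \<subseteq> {T. x T \<noteq> \<zero>}"
    using assms by auto
  then show ?thesis
    using assms by (auto simp: carrier_A intro: finite_subset)
qed

lemma A_smult_mult:
  assumes c: "c \<in> carrier K" and x: "x \<in> carrier A" and y: "y \<in> carrier A"
  shows "(c \<odot>\<^bsub>A\<^esub> x) \<otimes>\<^bsub>A\<^esub> y = c \<odot>\<^bsub>A\<^esub> (x \<otimes>\<^bsub>A\<^esub> y)" "x \<otimes>\<^bsub>A\<^esub> (c \<odot>\<^bsub>A\<^esub> y) = c \<odot>\<^bsub>A\<^esub> (x \<otimes>\<^bsub>A\<^esub> y)"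
proof -
  let ?D = "{T. x T \<noteq> \<zero>} \<union> {T. y T \<noteq> \<zero>}"
  have D: "finite ?D" and sub: "{T. x T \<noteq> \<zero>} \<subseteq> ?D" "{T. y T \<noteq> \<zero>} \<subseteq> ?D"
    "{T. (c \<odot>\<^bsub>A\<^esub> x) T \<noteq> \<zero>} \<subseteq> ?D" "{T. (c \<odot>\<^bsub>A\<^esub> y) T \<noteq> \<zero>} \<subseteq> ?D"
    using c x y by (auto simp: carrier_A)
  have [simp]: "x T \<in> carrier K" "y T \<in> carrier K" for T
    using x y by simp_all
  have cx: "c \<odot>\<^bsub>A\<^esub> x \<in> carrier A" and cy: "c \<odot>\<^bsub>A\<^esub> y \<in> carrier A"
    using A_smult_closed c x y by blast+
  show "(c \<odot>\<^bsub>A\<^esub> x) \<otimes>\<^bsub>A\<^esub> y = c \<odot>\<^bsub>A\<^esub> (x \<otimes>\<^bsub>A\<^esub> y)"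
  proof
    fix U
    show "((c \<odot>\<^bsub>A\<^esub> x) \<otimes>\<^bsub>A\<^esub> y) U = (c \<odot>\<^bsub>A\<^esub> (x \<otimes>\<^bsub>A\<^esub> y)) U"
      unfolding A_simps(4)[of c "_ \<otimes>\<^bsub>A\<^esub> _"] A_mult[OF cx y D sub(3) D sub(2)] A_mult[OF x y D sub(1) D sub(2)]
      using c D by (simp add: K.finsum_rdistr Pi_iff K.m_ac)
  qed
  show "x \<otimes>\<^bsub>A\<^esub> (c \<odot>\<^bsub>A\<^esub> y) = c \<odot>\<^bsub>A\<^esub> (x \<otimes>\<^bsub>A\<^esub> y)"
  proof
    fix U
    show "(x \<otimes>\<^bsub>A\<^esub> (c \<odot>\<^bsub>A\<^esub> y)) U = (c \<odot>\<^bsub>A\<^esub> (x \<otimes>\<^bsub>A\<^esub> y)) U"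
      unfolding A_simps(4)[of c "_ \<otimes>\<^bsub>A\<^esub> _"] A_mult[OF x cy D sub(1) D sub(4)] A_mult[OF x y D sub(1) D sub(2)]
      using c D by (simp add: K.finsum_rdistr Pi_iff K.m_ac)
  qed
qed

lemma assoc_algebra_A: "assoc_algebra K A"
proof -
  have "module K A"
    by (rule moduleI) (auto simp: K.is_cring abelian_group_A A_smult_closed simp del: A_simps(4),
      auto simp: K.l_distr K.r_distr K.m_assoc)
  moreover have "monoid A"
    by (rule monoidI) (auto simp: A_mult_closed A_one_closed A_assoc A_one_mult simp del: A_simps)
  then have "ring A"
    by (intro ringI abelian_group_A) (auto simp: A_distrib simp del: A_simps)
  ultimately show ?thesis
    by (auto simp: assoc_algebra_def assoc_algebra_axioms_def A_smult_mult simp del: A_simps)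
qed

section \<open>Power series given by forms\<close>

text \<open>The series \<open>\<Sum> t\<^bsup>|T| - e\<^esup> a\<^sub>T \<V>\<^sub>T\<close> over \<open>bar_T W\<close>, where \<open>a\<^sub>T\<close> is the value of the form \<open>a\<close> on the
  forest below the root of \<open>T\<close>.\<close>

definition form_series :: "(nat forest \<Rightarrow> rat) \<Rightarrow> nat \<Rightarrow> nat \<Rightarrow> nat tree \<Rightarrow> 'k" where
  "form_series a e n U =
     (if U \<in> bar_T W \<and> weight U = n + e then \<rho> (a (branches U) / of_nat (aut U)) else \<zero>)"

abbreviation trees_of_weight :: "nat \<Rightarrow> nat tree set" where
  "trees_of_weight n \<equiv> {T \<in> bar_T W. weight T = n}"

lemma finite_trees_of_weight: "finite (trees_of_weight n)"
  by (rule finite_bar_T_weight[OF W_pos])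

lemma weight_bar_T: "T \<in> bar_T W \<Longrightarrow> weight T = forest_weight (branches T)"
  by (cases T) (simp add: bar_T_iff)

lemma form_series_closed: "form_series a e n \<in> carrier A"
proof -
  have "finite {T. form_series a e n T \<noteq> \<zero>}"
    by (rule finite_subset[OF _ finite_trees_of_weight[of "n + e"]]) (auto simp: form_series_def)
  then show ?thesis
    by (simp add: carrier_A form_series_def)
qed

lemma form_series_carrier: "form_series a e \<in> carrier (ps_ring A)"
  by (simp add: ps_ring_def form_series_closed)

lemma finsum_A_apply:
  "(\<And>i. i \<in> S \<Longrightarrow> f i \<in> carrier A) \<Longrightarrow> finsum A f S U = (\<Oplus>i\<in>S. f i U)"
proof (induction S rule: infinite_finite_induct)
  case (insert i S)
  then show ?case
    by (simp add: Pi_iff)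
qed simp_all

lemma tree_series_eq:
  assumes X: "X \<subseteq> bar_T W"
    and c: "\<And>T. T \<in> bar_T W \<Longrightarrow> a (branches T) = (if T \<in> X then c T else 0)"
  shows "tree_series K W X e c = form_series a e"
proof (intro ext)
  fix n U
  let ?S = "{T \<in> X. weight T = n + e}"
  let ?v = "\<lambda>T. \<rho> (c T / of_nat (aut T))"
  have basis: "\<rho> (c T) \<odot>\<^bsub>A\<^esub> V_elt K W T = (\<lambda>U. if T = U then ?v T else \<zero>)" for T
    by (auto simp: V_elt_def gl_basis_def num_auts_eq fun_eq_iff simp flip: \<rho>_mult)
  have *: "(\<lambda>U. if T = U then ?v T else \<zero>) \<in> carrier A" if "T \<in> X" for T
    using X that by (auto simp: carrier_A intro: finite_subset[of _ "{T}"])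
  have "tree_series K W X e c n U = (\<Oplus>T\<in>?S. if T = U then ?v T else \<zero>)"
    unfolding tree_series_def basis by (rule finsum_A_apply) (use * in blast)
  also have "\<dots> = form_series a e n U"
  proof (cases "U \<in> ?S")
    case True
    have "finite ?S"
      by (rule finite_subset[OF _ finite_trees_of_weight[of "n + e"]]) (use X in auto)
    then have "(\<Oplus>T\<in>?S. if T = U then ?v T else \<zero>) = ?v U"
      using K.add.finprod_singleton_swap[of U ?S ?v] True by simp
    then show ?thesis
      using True X c[of U] by (auto simp: form_series_def)
  next
    case False
    then have "(\<Oplus>T\<in>?S. if T = U then ?v T else \<zero>) = \<zero>"
      by (intro K.add.finprod_one_eqI) auto
    then show ?thesis
      using False c[of U] by (auto simp: form_series_def)
  qed
  finally show "tree_series K W X e c n U = form_series a e n U" .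
qed

lemma gl_coeff_form:
  fixes a b :: "nat forest \<Rightarrow> rat"
  assumes "T \<in> bar_T W" "S \<in> bar_T W"
  shows "of_nat (gl_coeff T S U) * (a (branches T) / of_nat (aut T) * (b (branches S) / of_nat (aut S))) =
    (if root_label U = 0 then cut_sum (branches U)
      (\<lambda>P R. if P = branches T \<and> R = branches S then a P * b R else 0) / of_nat (aut U) else 0)"
proof -
  have pos: "aut T \<noteq> 0" "aut S \<noteq> 0" "aut U \<noteq> 0"
    using aut_pos[of T] aut_pos[of S] aut_pos[of U] by simp_all
  have S: "root_label S = 0"
    using assms by (simp add: bar_T_iff)
  have coeff: "of_nat (gl_coeff T S U) = of_nat (aut T) * of_nat (aut S) *
      (if root_label U = 0 then conv (delta_form (branches T)) (delta_form (branches S)) (branches U) else 0) /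
      (of_nat (aut U) :: rat)"
    using gl_coeff_aut[of T S U] pos S by (simp add: field_simps)
  have conv: "cut_sum (branches U) (\<lambda>P R. if P = branches T \<and> R = branches S then a P * b R else 0) =
      conv (delta_form (branches T)) (delta_form (branches S)) (branches U) * (a (branches T) * b (branches S))"
    unfolding conv_def cut_sum_mult_right[symmetric] by (intro cut_sum_cong) (simp add: delta_form_def)
  show ?thesis
    unfolding coeff conv using pos by simp
qed

lemma sum_trees_of_weight:
  "(\<Sum>T\<in>trees_of_weight k. if F = branches T then x else 0) =
    (if forest_labels F \<subseteq> W \<and> forest_weight F = k then x else (0 :: rat))"
proof -
  have "(\<Sum>T\<in>trees_of_weight k. if F = branches T then x else 0) =
      (\<Sum>T\<in>trees_of_weight k. if T = Node 0 F then x else 0)"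
  proof (intro sum.cong refl)
    fix T
    assume "T \<in> trees_of_weight k"
    then have "F = branches T \<longleftrightarrow> T = Node 0 F"
      by (cases T) (auto simp: bar_T_iff)
    then show "(if F = branches T then x else 0) = (if T = Node 0 F then x else 0)"
      by simp
  qed
  also have "\<dots> = (if Node 0 F \<in> trees_of_weight k then x else 0)"
    by (simp add: finite_trees_of_weight)
  finally show ?thesis
    by (simp add: bar_T_iff)
qed

text \<open>A cut \<open>(P, R)\<close> of \<open>U\<close> occurs exactly once on the left-hand side: the index \<open>i\<close> is the weight of \<open>P\<close> minus
  \<open>e\<close>. The assumptions exclude the cuts for which this difference would be negative, or greater than
  \<open>n\<close>.\<close>

lemma sum_gl_coeff_form:
  assumes a: "\<And>F. forest_labels F \<subseteq> W \<Longrightarrow> forest_weight F < e \<Longrightarrow> a F = 0"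
    and b: "\<And>F. forest_labels F \<subseteq> W \<Longrightarrow> forest_weight F < e' \<Longrightarrow> b F = 0"
  shows "(\<Sum>i\<le>n. \<Sum>T\<in>trees_of_weight (i + e). \<Sum>S\<in>trees_of_weight (n - i + e').
      of_nat (gl_coeff T S U) * (a (branches T) / of_nat (aut T) * (b (branches S) / of_nat (aut S)))) =
    (if U \<in> bar_T W \<and> weight U = n + (e + e') then conv a b (branches U) / of_nat (aut U) else 0)"
    (is "?sum = _")
proof (cases "U \<in> bar_T W \<and> weight U = n + (e + e')")
  case False
  have "gl_coeff T S U = 0"
    if "i \<le> n" "T \<in> trees_of_weight (i + e)" "S \<in> trees_of_weight (n - i + e')" for i T S
  proof (rule ccontr)
    assume nz: "gl_coeff T S U \<noteq> 0"
    then have U: "U \<in> bar_T W"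
      using gl_coeff_bar_T that by blast
    moreover have "weight U = n + (e + e')"
      using that forest_weight_cut[OF gl_coeff_nonzero(2)[OF nz]] weight_bar_T[OF U]
        weight_bar_T[of T] weight_bar_T[of S] by auto
    ultimately show False
      using False by simp
  qed
  then have "?sum = 0"
    by (intro sum.neutral ballI) simp
  then show ?thesis
    unfolding if_not_P[OF False] .
next
  case True
  then have U: "root_label U = 0" "forest_labels (branches U) \<subseteq> W"
    "forest_weight (branches U) = n + (e + e')"
    by (auto simp: bar_T_iff weight_bar_T)
  have "?sum = (\<Sum>i\<le>n. \<Sum>T\<in>trees_of_weight (i + e). \<Sum>S\<in>trees_of_weight (n - i + e').
      cut_sum (branches U) (\<lambda>P R. if P = branches T \<and> R = branches S then a P * b R else 0) / of_nat (aut U))"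
  proof (intro sum.cong refl)
    fix i T S
    assume "T \<in> trees_of_weight (i + e)" "S \<in> trees_of_weight (n - i + e')"
    then show "of_nat (gl_coeff T S U) * (a (branches T) / of_nat (aut T) * (b (branches S) / of_nat (aut S))) =
      cut_sum (branches U) (\<lambda>P R. if P = branches T \<and> R = branches S then a P * b R else 0) / of_nat (aut U)"
      by (subst gl_coeff_form) (simp_all add: U(1))
  qed
  also have "\<dots> = cut_sum (branches U) (\<lambda>P R. \<Sum>i\<le>n. \<Sum>T\<in>trees_of_weight (i + e).
      \<Sum>S\<in>trees_of_weight (n - i + e'). if P = branches T \<and> R = branches S then a P * b R else 0) /
      of_nat (aut U)"
    by (simp add: cut_sum_sum flip: sum_divide_distrib)
  also have "cut_sum (branches U) (\<lambda>P R. \<Sum>i\<le>n. \<Sum>T\<in>trees_of_weight (i + e).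
      \<Sum>S\<in>trees_of_weight (n - i + e'). if P = branches T \<and> R = branches S then a P * b R else 0) =
      conv a b (branches U)"
    unfolding conv_def
  proof (rule cut_sum_cong)
    fix P R
    assume cut: "(P, R) \<in># forest_cuts (branches U)"
    have labels: "forest_labels P \<subseteq> W" "forest_labels R \<subseteq> W"
      using forest_labels_cut[OF cut] U(2) by blast+
    have weights: "forest_weight P + forest_weight R = n + (e + e')"
      using forest_weight_cut[OF cut] U(3) by simp
    have "(\<Sum>S\<in>trees_of_weight k. if P = branches T \<and> R = branches S then x else 0) =
        (if P = branches T then if forest_weight R = k then x else 0 else 0)" for T k and x :: rat
      using sum_trees_of_weight[of R x k] labels(2) by simp
    then have "(\<Sum>i\<le>n. \<Sum>T\<in>trees_of_weight (i + e).
        \<Sum>S\<in>trees_of_weight (n - i + e'). if P = branches T \<and> R = branches S then a P * b R else 0) =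
      (\<Sum>i\<le>n. if forest_weight P = i + e then if forest_weight R = n - i + e' then a P * b R else 0 else 0)"
      by (simp only: sum_trees_of_weight labels(1) simp_thms)
    also have "\<dots> = a P * b R"
    proof (cases "a P * b R = 0")
      case False
      have "forest_weight P \<ge> e"
        by (rule ccontr) (use a[OF labels(1)] False in simp)
      moreover have R: "forest_weight R \<ge> e'"
        by (rule ccontr) (use b[OF labels(2)] False in simp)
      ultimately have "(\<Sum>i\<le>n. if forest_weight P = i + e then if forest_weight R = n - i + e' then a P * b R else 0 else 0) =
          (\<Sum>i\<le>n. if i = forest_weight P - e then a P * b R else 0)"
        using weights by (intro sum.cong) auto
      also have "\<dots> = a P * b R"
      proof -
        have "forest_weight P - e \<le> n"
          using weights R by linarith
        then show ?thesis
          by simp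
      qed
      finally show ?thesis .
    qed (auto intro!: sum.neutral)
    finally show "(\<Sum>i\<le>n. \<Sum>T\<in>trees_of_weight (i + e).
        \<Sum>S\<in>trees_of_weight (n - i + e'). if P = branches T \<and> R = branches S then a P * b R else 0) =
      a P * b R" .
  qed
  finally show ?thesis
    using True by simp
qed

text \<open>Convolution of forms is multiplication of series, because cutting preserves the total weight.\<close>

lemma form_series_mult:
  assumes a: "\<And>F. forest_labels F \<subseteq> W \<Longrightarrow> forest_weight F < e \<Longrightarrow> a F = 0"
    and b: "\<And>F. forest_labels F \<subseteq> W \<Longrightarrow> forest_weight F < e' \<Longrightarrow> b F = 0"
  shows "form_series a e \<otimes>\<^bsub>ps_ring A\<^esub> form_series b e' = form_series (conv a b) (e + e')"
proof (intro ext)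
  fix n U
  let ?B = trees_of_weight
  have coeff: "(form_series a e i \<otimes>\<^bsub>A\<^esub> form_series b e' j) U = \<rho> (\<Sum>T\<in>?B (i + e). \<Sum>S\<in>?B (j + e').
      of_nat (gl_coeff T S U) * (a (branches T) / of_nat (aut T) * (b (branches S) / of_nat (aut S))))" for i j
  proof -
    have "{T. form_series a e i T \<noteq> \<zero>} \<subseteq> ?B (i + e)" "{T. form_series b e' j T \<noteq> \<zero>} \<subseteq> ?B (j + e')"
      by (auto simp: form_series_def)
    then have "(form_series a e i \<otimes>\<^bsub>A\<^esub> form_series b e' j) U = (\<Oplus>T\<in>?B (i + e). \<Oplus>S\<in>?B (j + e').
        \<rho> (of_nat (gl_coeff T S U)) \<otimes> (form_series a e i T \<otimes> form_series b e' j S))"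
      by (intro A_mult form_series_closed finite_trees_of_weight)
    also have "\<dots> = (\<Oplus>T\<in>?B (i + e). \<Oplus>S\<in>?B (j + e').
        \<rho> (of_nat (gl_coeff T S U) * (a (branches T) / of_nat (aut T) * (b (branches S) / of_nat (aut S)))))"
      by (intro K.finsum_cong' refl) (auto simp: form_series_def simp flip: \<rho>_mult intro!: K.finsum_closed)
    finally show ?thesis
      by (simp only: \<rho>_sum[OF finite_trees_of_weight])
  qed
  have "(form_series a e \<otimes>\<^bsub>ps_ring A\<^esub> form_series b e') n U =
      (\<Oplus>i\<in>{..n}. (form_series a e i \<otimes>\<^bsub>A\<^esub> form_series b e' (n - i)) U)"
    by (simp add: ps_ring_def finsum_A_apply A_mult_closed form_series_closed)
  also have "\<dots> = \<rho> (\<Sum>i\<le>n. \<Sum>T\<in>?B (i + e). \<Sum>S\<in>?B (n - i + e').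
      of_nat (gl_coeff T S U) * (a (branches T) / of_nat (aut T) * (b (branches S) / of_nat (aut S))))"
    by (simp only: coeff \<rho>_sum[OF finite_atMost])
  also have "\<dots> = form_series (conv a b) (e + e') n U"
    by (subst sum_gl_coeff_form) (simp_all add: a b form_series_def)
  finally show "(form_series a e \<otimes>\<^bsub>ps_ring A\<^esub> form_series b e') n U = form_series (conv a b) (e + e') n U" .
qed

lemma forest_eq_empty:
  assumes "forest_labels F \<subseteq> W" "forest_weight F = 0"
  shows "F = {#}"
proof (cases F)
  case (add C G)
  then show ?thesis
    using assms W_pos by (cases C) auto
qed

lemma form_series_unit: "form_series unit_form 0 = \<one>\<^bsub>ps_ring A\<^esub>"
proof (intro ext)
  fix n and U :: "nat tree"
  have "U \<in> bar_T W \<and> branches U = {#} \<longleftrightarrow> U = single_vertex"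
    by (cases U) (auto simp: bar_T_iff)
  then show "form_series unit_form 0 n U = \<one>\<^bsub>ps_ring A\<^esub> n U"
    by (auto simp: form_series_def ps_ring_def unit_form_def)
qed

lemma form_series_at_0:
  "form_series a 0 0 = (\<lambda>U. if U = single_vertex then \<rho> (a {#}) else \<zero>)"
proof
  fix U :: "nat tree"
  have "U \<in> bar_T W \<and> weight U = 0 \<longleftrightarrow> U = single_vertex"
    using forest_eq_empty[of "branches U"] by (cases U) (auto simp: bar_T_iff)
  then show "form_series a 0 0 U = (if U = single_vertex then \<rho> (a {#}) else \<zero>)"
    by (auto simp: form_series_def)
qed

lemma form_series_deriv:
  "ps_deriv A (form_series a 0) = form_series (\<lambda>F. of_nat (forest_weight F) * a F) 1"
proof (intro ext)
  fix n U
  have "([k] \<cdot>\<^bsub>A\<^esub> x) U = \<rho> (of_nat k) \<otimes> x U" if "x \<in> carrier A" for k :: nat and x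
    using that by (induction k) (simp_all add: \<rho>_add K.l_distr K.a_comm)
  then have "ps_deriv A (form_series a 0) n U = \<rho> (of_nat (Suc n)) \<otimes> form_series a 0 (Suc n) U"
    by (simp only: ps_deriv_def form_series_closed)
  also have "\<dots> = form_series (\<lambda>F. of_nat (forest_weight F) * a F) 1 n U"
  proof (cases "U \<in> bar_T W \<and> weight U = Suc n")
    case True
    then have "forest_weight (branches U) = Suc n"
      using weight_bar_T[of U] by simp
    then show ?thesis
      unfolding form_series_def by (simp only: True) (simp del: of_nat_Suc flip: \<rho>_mult)
  qed (auto simp: form_series_def)
  finally show "ps_deriv A (form_series a 0) n U = form_series (\<lambda>F. of_nat (forest_weight F) * a F) 1 n U" .
qed

lemma form_series_neg_arg:
  "ps_neg_arg A (form_series a 0) = form_series (\<lambda>F. (- 1) ^ forest_weight F * a F) 0"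
proof (intro ext)
  fix n U
  have "(\<ominus>\<^bsub>A\<^esub> x) U = \<ominus> x U" if x: "x \<in> carrier A" for x
  proof -
    have "(\<ominus>\<^bsub>A\<^esub> x \<oplus>\<^bsub>A\<^esub> x) U = \<zero>"
      using A.l_neg[OF x] by simp
    then show ?thesis
      using x A.a_inv_closed[OF x] by (intro K.minus_equality[symmetric]) simp_all
  qed
  then show "ps_neg_arg A (form_series a 0) n U = form_series (\<lambda>F. (- 1) ^ forest_weight F * a F) 0 n U"
    by (auto simp: ps_neg_arg_def form_series_closed form_series_def weight_bar_T simp flip: \<rho>_minus)
qed

lemma form_series_pow:
  "form_series a 0 [^]\<^bsub>ps_ring A\<^esub> k = form_series (conv_pow a k) 0"
proof (induction k)
  case 0
  then show ?case
    by (simp add: nat_pow_def form_series_unit)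
next
  case (Suc k)
  then show ?case
    by (simp add: nat_pow_def form_series_mult conv_pow.simps(2))
qed

text \<open>The coefficient of \<open>t\<^sup>n\<close> takes the powers up to \<open>n\<close> into account. This is enough since a forest of
  weight \<open>n\<close> with positive labels has at most \<open>n\<close> vertices.\<close>

lemma form_series_exp:
  assumes "infinitesimal a"
  shows "ps_exp K A (form_series a 0) = form_series (exp_form a) 0"
proof (intro ext)
  fix n U
  have "ps_exp K A (form_series a 0) n U =
      (\<Oplus>k\<in>{..n}. \<rho> (1 / fact k) \<otimes> form_series (conv_pow a k) 0 n U)"
    unfolding ps_exp_def form_series_pow
    by (subst finsum_A_apply) (auto intro!: A_smult_closed form_series_closed simp del: A_simps(4), simp)
  also have "\<dots> = form_series (exp_form a) 0 n U"
  proof (cases "U \<in> bar_T W \<and> weight U = n")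
    case True
    let ?F = "branches U"
    have "forest_size ?F \<le> n"
      using forest_size_le_weight[OF W_pos, of ?F] True weight_bar_T[of U] by (auto simp: bar_T_iff)
    then have "exp_form a ?F / of_nat (aut U) = (\<Sum>k\<le>n. 1 / fact k * (conv_pow a k ?F / of_nat (aut U)))"
      by (simp add: divided_pow_def sum_divide_distrib flip: exp_form_eq[OF assms])
    then show ?thesis
      using True by (simp add: form_series_def \<rho>_sum flip: \<rho>_mult)
  next
    case False
    then show ?thesis
      by (auto simp: form_series_def)
  qed
  finally show "ps_exp K A (form_series a 0) n U = form_series (exp_form a) 0 n U" .
qed

lemma g_series_eq: "g_series K W = form_series (\<lambda>F. 1) 0"
  unfolding g_series_def by (rule tree_series_eq) auto

lemma f_series_eq: "f_series K W = form_series (\<lambda>F. (- 1) ^ forest_weight F * antipode_form F) 0"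
  unfolding f_series_def
proof (rule tree_series_eq)
  fix T
  assume T: "T \<in> bar_T W"
  then show "(- 1) ^ forest_weight (branches T) * antipode_form (branches T) =
      (if T \<in> bar_S W then (- 1) ^ (size (branches T) + weight T) else 0)"
    by (auto simp: bar_S_def antipode_form_def weight_bar_T power_add)
qed (auto simp: bar_S_def)

text \<open>The sum over \<open>bar_P W\<close> can be extended to all trees since \<open>\<theta>\<close> vanishes on the others.\<close>

lemma d_series_eq: "d_series K W = form_series theta_form 0"
  unfolding d_series_def
proof (rule tree_series_eq)
  fix T
  assume "T \<in> bar_T W"
  then show "theta_form (branches T) = (if T \<in> bar_P W then theta T else 0)"
    using infinitesimal_theta_form by (auto simp: bar_P_def theta_eq infinitesimal_def)
qed (auto simp: bar_P_def)

lemma h_series_eq: "h_series K W = form_series leaf_form 1"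
  unfolding h_series_def
proof (rule tree_series_eq)
  fix T
  assume T: "T \<in> bar_T W"
  then obtain F where "T = Node 0 F"
    by (auto simp: bar_T_def)
  then show "leaf_form (branches T) = (if T \<in> bar_H W then of_nat (leaf_label T) else 0)"
    using T unfolding bar_H_def leaf_form_def by (simp del: leaves.simps)
qed (auto simp: bar_H_def)

lemma m_series_eq: "m_series K W = form_series root_form 1"
  unfolding m_series_def
proof (rule tree_series_eq)
  fix T
  assume T: "T \<in> bar_T W"
  then have "T = Node 0 (branches T)"
    by (cases T) (simp add: bar_T_iff)
  then show "root_form (branches T) = (if T \<in> bar_P W then of_nat (child_label T) else 0)"
    using T by (simp add: bar_P_def root_form_def)
qed (auto simp: bar_P_def)

lemma ncs_system_tree_series:
  "ncs_system K A (f_series K W) (g_series K W) (d_series K W) (h_series K W) (m_series K W)"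
  unfolding ncs_system_def f_series_eq g_series_eq d_series_eq h_series_eq m_series_eq
proof (intro conjI)
  let ?f = "\<lambda>F. (- 1) ^ forest_weight F * antipode_form F" and ?g = "\<lambda>F :: nat forest. 1 :: rat"
  show "algebra rat_ring K" "assoc_algebra K A"
    by (rule algebra, rule assoc_algebra_A)
  show "{form_series ?f 0, form_series ?g 0, form_series theta_form 0,
      form_series leaf_form 1, form_series root_form 1} \<subseteq> carrier (ps_ring A)"
    by (simp add: form_series_carrier)
  show "form_series ?f 0 0 = \<one>\<^bsub>A\<^esub>"
    by (simp add: form_series_at_0 cong: if_cong)
  have neg: "ps_neg_arg A (form_series ?f 0) = form_series antipode_form 0"
    by (simp add: form_series_neg_arg flip: mult.assoc power_mult_distrib)
  show "ps_neg_arg A (form_series ?f 0) \<otimes>\<^bsub>ps_ring A\<^esub> form_series ?g 0 = \<one>\<^bsub>ps_ring A\<^esub>"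
    unfolding neg by (simp add: form_series_mult conv_antipode_left form_series_unit)
  show "form_series ?g 0 \<otimes>\<^bsub>ps_ring A\<^esub> ps_neg_arg A (form_series ?f 0) = \<one>\<^bsub>ps_ring A\<^esub>"
    unfolding neg by (simp add: form_series_mult conv_antipode_right form_series_unit)
  show "form_series theta_form 0 0 = \<zero>\<^bsub>A\<^esub>"
  proof -
    have "theta_form {#} = 0"
      using infinitesimal_theta_form by (simp add: infinitesimal_def)
    then show ?thesis
      by (simp add: form_series_at_0 cong: if_cong)
  qed
  show "ps_exp K A (form_series theta_form 0) = form_series ?g 0"
  proof -
    have "exp_form theta_form = ?g"
      by (simp add: fun_eq_iff exp_theta_form)
    then show ?thesis
      by (simp only: form_series_exp[OF infinitesimal_theta_form])
  qed
  have deriv: "ps_deriv A (form_series ?g 0) = form_series (\<lambda>F. of_nat (forest_weight F)) 1"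
    by (simp add: form_series_deriv)
  have zero: "leaf_form F = 0" "root_form F = 0" if "forest_labels F \<subseteq> W" "forest_weight F < 1" for F
    using forest_eq_empty[OF that(1)] that(2) by (simp_all add: root_form_def)
  show "ps_deriv A (form_series ?g 0) = form_series ?g 0 \<otimes>\<^bsub>ps_ring A\<^esub> form_series leaf_form 1"
  proof -
    have "conv ?g leaf_form = (\<lambda>F. of_nat (forest_weight F))"
      by (rule ext) (rule conv_leaf_form)
    moreover have "form_series ?g 0 \<otimes>\<^bsub>ps_ring A\<^esub> form_series leaf_form 1 = form_series (conv ?g leaf_form) (0 + 1)"
      by (rule form_series_mult) (simp_all add: zero)
    ultimately show ?thesis
      by (simp only: deriv add_0_left)
  qed
  show "ps_deriv A (form_series ?g 0) = form_series root_form 1 \<otimes>\<^bsub>ps_ring A\<^esub> form_series ?g 0"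
  proof -
    have "conv root_form ?g = (\<lambda>F. of_nat (forest_weight F))"
      by (rule ext) (rule conv_root_form)
    moreover have "form_series root_form 1 \<otimes>\<^bsub>ps_ring A\<^esub> form_series ?g 0 = form_series (conv root_form ?g) (1 + 0)"
      by (rule form_series_mult) (simp_all add: zero)
    ultimately show ?thesis
      by (simp only: deriv add_0_right)
  qed
qed

end

theorem theorem4p5:
  fixes K :: "(rat, 'k, 'm) module_scheme" and W :: "nat set"
  assumes "algebra rat_ring K"
    and "W \<noteq> {}" and "W \<subseteq> {n. n > 0}"
  shows "ncs_system K (gl_algebra K W)
           (f_series K W) (g_series K W) (d_series K W) (h_series K W) (m_series K W)"
proof -
  interpret grossman_larson K W
    by (rule grossman_larson.intro) (rule assms)+
  show ?thesis
    by (rule ncs_system_tree_series)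
qed

end
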